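(* Let $k$ be an algebraically closed field and $\Lambda=k[[T]]$. Let $\alpha,\beta,\gamma$ be partitions such that $\beta\setminus\gamma$ is a horizontal and vertical strip, and let $\Gamma,\widetilde\Gamma$ be LR-tableaux of type $(\alpha,\beta,\gamma)$. The following are equivalent: (1) $\widetilde\Gamma$ is obtained from $\Gamma$ by a (possibly empty) sequence of increasing box moves. (2) $\Gamma\le_{\sf boundary}\widetilde\Gamma$. (3) $\Gamma$ and $\widetilde\Gamma$ are in the dominance partial order, $\Gamma\le_{\sf dom}\widetilde\Gamma$.
   Context: Put $p=T\in\Lambda=k[[T]]$. All modules are finite length $\Lambda$-modules. For a partition $\beta=(\beta_1\ge\dots\ge\beta_s\ge1)$ put $N_\beta=\bigoplus_i\Lambda/(p^{\beta_i})$; a module isomorphic to $N_\beta$ has type $\beta$. $\beta'$ denotes the transpose partition. Tableaux. The Young diagram of $\beta$ is drawn with columns of lengths $\beta_1,\beta_2,\dots$ from left to right, aligned at the top; rows are numbered from the top, so row $i$ has $(\beta')_i$ boxes. A tableau is a sequence $\Gamma=[\gamma^{(0)}\subset\gamma^{(1)}\subset\dots\subset\gamma^{(s)}]$ of partitions; boxes in $\gamma^{(0)}$ are empty and boxes in $\gamma^{(e)}\setminus\gamma^{(e-1)}$ carry the entry $e$ (repeating the last partition does not change the tableau). An LR-tableau of type $(\alpha,\beta,\gamma)$ (shape $\beta\setminus\gamma$, content $\alpha$) is a tableau with $\gamma^{(0)}=\gamma$, $\gamma^{(s)}=\beta$, having $(\alpha')_e$ entries $e$ for each $e\geq1$, whose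 entries weakly increase along rows (left to right), strictly increase down columns, and such that for every vertical column and every $e\ge1$, on the right hand side of this column there occur at least as many entries $e$ as entries $e+1$. The skew diagram $\beta\setminus\gamma$ is a horizontal and vertical strip if it contains at most one box in each row and at most one box in each column. The tableau of an embedding $A\subset B$ (of finite length modules) is $[\gamma^{(0)},\dots,\gamma^{(r)}]$ where $p^rA=0$ and $\gamma^{(e)}$ is the type of $B/p^eA$. The union of tableaux $[\varepsilon^{(i)}]$, $[\zeta^{(i)}]$ is $[\varepsilon^{(i)}\cup\zeta^{(i)}]$ (union of multisets of parts, where the last partition of the shorter sequence is repeated). For $1\le e\le f$, the column tableau $C(e,f)_n$ is the one-column tableau of height $n$ whose lowest $f-e+1$ boxes contain $e,e+1,\dots,f$ from top to bottom, the other boxes being empty; $C(1,0)_n$ is the empty column of height $n$. Increasing box move. Let $\Gamma,\widetilde\Gamma$ be LR-tableaux of the same shape and content. $\widetilde\Gamma$ is obtained from $\Gamma$ by an increasing box move if both are unions of column tableaux which differ in exactly two columns: $\Gamma=\Delta\cup C(e,f)_n\cup C(e',f')_{n'}$ and $\widetilde\Gamma=\Delta\cup C(e',f')_n\cup C(e,f)_{n'}$, where $\Delta$ is a union of column tableaux and $n>n'$, $1\le e\le f$, $e<e'$, $f<f'$, $f-e=f'-e'$. Boundary order. $\mathbb V_{\alpha,\gamma}^\beta$ is the set of $\Lambda$-linear monomorphisms $f:N_\alpha\to N_\beta$ with cokernel isomorphic to $N_\gamma$, a subset of the affine space $\mathrm{Hom}_k(N_\alpha,N_\beta)$ with the Zariski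 topology. $\mathbb V_\Gamma\subset\mathbb V_{\alpha,\gamma}^\beta$ is the set of those $f$ for which $(f(N_\alpha)\subset N_\beta)$ has tableau $\Gamma$; $\overline{\mathbb V}_\Gamma$ is its closure. Write $\Gamma\preceq_{\sf boundary}\widetilde\Gamma$ if $\mathbb V_{\widetilde\Gamma}\cap\overline{\mathbb V}_\Gamma\ne\emptyset$; $\le_{\sf boundary}$ is the reflexive and transitive closure of $\preceq_{\sf boundary}$ on the set of LR-tableaux of type $(\alpha,\beta,\gamma)$. Dominance order. For $\Gamma=[\gamma^{(\ell)}]$ and $\widetilde\Gamma=[\widetilde\gamma^{(\ell)}]$ of the same type, $\Gamma\le_{\sf dom}\widetilde\Gamma$ means that for all $\ell\geq0$, $m\ge1$: $(\gamma^{(\ell)})'_1+\dots+(\gamma^{(\ell)})'_m\le(\widetilde\gamma^{(\ell)})'_1+\dots+(\widetilde\gamma^{(\ell)})'_m$. *)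

theory Defs
  imports
    "HOL-Computational_Algebra.Polynomial"
    "HOL-Computational_Algebra.Formal_Power_Series"
    "HOL-Analysis.Abstract_Topology"
    "HOL-Algebra.Module"
    "HOL-Algebra.Ideal"
begin

section \<open>Partitions and Young diagrams\<close>

definition is_partition :: "nat list \<Rightarrow> bool" where
  "is_partition \<beta> \<longleftrightarrow> sorted_wrt (\<ge>) \<beta> \<and> 0 \<notin> set \<beta>"

text \<open>A box is a pair (row, column), both counted from 1; column \<open>j\<close> has length \<open>\<beta>\<^sub>j\<close>.\<close>

definition diagram :: "nat list \<Rightarrow> (nat \<times> nat) set" where
  "diagram \<beta> = {(i, j). 1 \<le> j \<and> j \<le> length \<beta> \<and> 1 \<le> i \<and> i \<le> \<beta> ! (j - 1)}"

text \<open>\<open>conj_part \<beta> i\<close> is the part \<open>(\<beta>')\<^sub>i\<close> of the transpose partition, for \<open>i \<ge> 1\<close>.\<close>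

definition conj_part :: "nat list \<Rightarrow> nat \<Rightarrow> nat" where
  "conj_part \<beta> i = card {j. (i, j) \<in> diagram \<beta>}"

definition skew :: "nat list \<Rightarrow> nat list \<Rightarrow> (nat \<times> nat) set" where
  "skew \<beta> \<gamma> = diagram \<beta> - diagram \<gamma>"

definition horizontal_vertical_strip :: "nat list \<Rightarrow> nat list \<Rightarrow> bool" where
  "horizontal_vertical_strip \<beta> \<gamma> \<longleftrightarrow>
     diagram \<gamma> \<subseteq> diagram \<beta> \<and>
     (\<forall>i. card {j. (i, j) \<in> skew \<beta> \<gamma>} \<le> 1) \<and>
     (\<forall>j. card {i. (i, j) \<in> skew \<beta> \<gamma>} \<le> 1)"

section \<open>Tableaux\<close>

text \<open>A tableau \<open>[\<gamma>\<^sup>0, \<dots>, \<gamma>\<^sup>s]\<close> is encoded as the infinite sequence in which its last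
  partition is repeated forever. Since repeating the last partition does not change a tableau,
  equality of tableaux is equality of these sequences.\<close>

type_synonym tableau = "nat \<Rightarrow> nat list"

definition is_tableau :: "tableau \<Rightarrow> bool" where
  "is_tableau \<Gamma> \<longleftrightarrow>
     (\<forall>l. is_partition (\<Gamma> l)) \<and>
     (\<forall>l. diagram (\<Gamma> l) \<subseteq> diagram (\<Gamma> (Suc l))) \<and>
     (\<exists>s. \<forall>l\<ge>s. \<Gamma> l = \<Gamma> s)"

text \<open>\<open>entry_boxes \<Gamma> e\<close> is the set of boxes carrying the entry \<open>e\<close>, for \<open>e \<ge> 1\<close>.\<close>

definition entry_boxes :: "tableau \<Rightarrow> nat \<Rightarrow> (nat \<times> nat) set" where
  "entry_boxes \<Gamma> e = diagram (\<Gamma> e) - diagram (\<Gamma> (e - 1))"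

text \<open>In the last condition the boxes to the right of column \<open>c\<close> are compared. The
  case \<open>c = 0\<close>, where all boxes are counted, is harmless: it already follows from the content
  being \<open>\<alpha>\<close>.\<close>

definition LR_tableau :: "nat list \<Rightarrow> nat list \<Rightarrow> nat list \<Rightarrow> tableau \<Rightarrow> bool" where
  "LR_tableau \<alpha> \<beta> \<gamma> \<Gamma> \<longleftrightarrow>
     is_tableau \<Gamma> \<and>
     \<Gamma> 0 = \<gamma> \<and>
     (\<exists>s. \<forall>l\<ge>s. \<Gamma> l = \<beta>) \<and>
     (\<forall>e\<ge>1. card (entry_boxes \<Gamma> e) = conj_part \<alpha> e) \<and>
     (\<forall>i j j' e e'. e \<ge> 1 \<longrightarrow> e' \<ge> 1 \<longrightarrow> (i, j) \<in> entry_boxes \<Gamma> e \<longrightarrow>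
        (i, j') \<in> entry_boxes \<Gamma> e' \<longrightarrow> j < j' \<longrightarrow> e \<le> e') \<and>
     (\<forall>i i' j e e'. e \<ge> 1 \<longrightarrow> e' \<ge> 1 \<longrightarrow> (i, j) \<in> entry_boxes \<Gamma> e \<longrightarrow>
        (i', j) \<in> entry_boxes \<Gamma> e' \<longrightarrow> i < i' \<longrightarrow> e < e') \<and>
     (\<forall>c. \<forall>e\<ge>1. card {(i, j) \<in> entry_boxes \<Gamma> (Suc e). c < j}
                 \<le> card {(i, j) \<in> entry_boxes \<Gamma> e. c < j})"

definition tableau_union :: "tableau \<Rightarrow> tableau \<Rightarrow> tableau" where
  "tableau_union \<Gamma> \<Delta> = (\<lambda>l. rev (sort (\<Gamma> l @ \<Delta> l)))"

text \<open>\<open>column_tableau e f n\<close> is \<open>C(e,f)\<^sub>n\<close>: its \<open>l\<close>-th partition consists of the empty boxes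
  and the boxes with entry at most \<open>l\<close>, that is, of all but the lowest
  \<open>card {x \<in> {e..f}. l < x}\<close> boxes. As \<open>{1..0} = {}\<close>, this covers \<open>C(1,0)\<^sub>n\<close>.\<close>

definition column_tableau :: "nat \<Rightarrow> nat \<Rightarrow> nat \<Rightarrow> tableau" where
  "column_tableau e f n =
     (\<lambda>l. let h = n - card {x \<in> {e..f}. l < x} in if h = 0 then [] else [h])"

definition valid_column :: "nat \<Rightarrow> nat \<Rightarrow> nat \<Rightarrow> bool" where
  "valid_column e f n \<longleftrightarrow> 1 \<le> n \<and> ((1 \<le> e \<and> e \<le> f \<and> f - e + 1 \<le> n) \<or> (e = 1 \<and> f = 0))"

inductive union_of_columns :: "tableau \<Rightarrow> bool" where
  empty: "union_of_columns (\<lambda>_. [])"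
| column: "union_of_columns \<Delta> \<Longrightarrow> valid_column e f n \<Longrightarrow>
     union_of_columns (tableau_union \<Delta> (column_tableau e f n))"

text \<open>The condition \<open>f - e = f' - e'\<close> is written additively because subtraction on
  natural numbers truncates.\<close>

definition increasing_box_move ::
  "nat list \<Rightarrow> nat list \<Rightarrow> nat list \<Rightarrow> tableau \<Rightarrow> tableau \<Rightarrow> bool" where
  "increasing_box_move \<alpha> \<beta> \<gamma> \<Gamma> \<Gamma>' \<longleftrightarrow>
     LR_tableau \<alpha> \<beta> \<gamma> \<Gamma> \<and> LR_tableau \<alpha> \<beta> \<gamma> \<Gamma>' \<and>
     (\<exists>\<Delta> e f e' f' n n'.
        union_of_columns \<Delta> \<and>
        valid_column e f n \<and> valid_column e' f' n' \<and>
        valid_column e' f' n \<and> valid_column e f n' \<and>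
        n > n' \<and> 1 \<le> e \<and> e \<le> f \<and> e < e' \<and> f < f' \<and> f + e' = f' + e \<and>
        \<Gamma> = tableau_union (tableau_union \<Delta> (column_tableau e f n)) (column_tableau e' f' n') \<and>
        \<Gamma>' = tableau_union (tableau_union \<Delta> (column_tableau e' f' n)) (column_tableau e f n'))"

definition dom_le :: "tableau \<Rightarrow> tableau \<Rightarrow> bool" where
  "dom_le \<Gamma> \<Gamma>' \<longleftrightarrow>
     (\<forall>l. \<forall>m\<ge>1. (\<Sum>i=1..m. conj_part (\<Gamma> l) i) \<le> (\<Sum>i=1..m. conj_part (\<Gamma>' l) i))"

section \<open>Modules over the power series ring\<close>

definition Lambda :: "'k::field fps ring" (\<open>\<Lambda>\<close>) where
  "\<Lambda> = \<lparr>carrier = UNIV, monoid.mult = (*), one = 1, ring.zero = 0, add = (+)\<rparr>"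

lemma cring_Lambda: "cring (\<Lambda> :: 'k::field fps ring)"
proof (rule cringI)
  show "abelian_group (\<Lambda> :: 'k fps ring)"
  proof (rule abelian_groupI)
    fix x :: "'k fps"
    show "\<exists>y\<in>carrier \<Lambda>. y \<oplus>\<^bsub>\<Lambda>\<^esub> x = \<zero>\<^bsub>\<Lambda>\<^esub>"
      by (rule bexI[of _ "- x"]) (simp_all add: Lambda_def)
  qed (simp_all add: Lambda_def algebra_simps)
  show "comm_monoid (\<Lambda> :: 'k fps ring)"
    by (rule comm_monoidI) (simp_all add: Lambda_def algebra_simps)
qed (simp add: Lambda_def algebra_simps)

text \<open>The components \<open>mult\<close> and \<open>one\<close> of a module record carry no meaning.\<close>

definition regular_module :: "('k::field fps, 'k fps) module" where
  "regular_module =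
     \<lparr>carrier = UNIV, monoid.mult = undefined, one = undefined,
      ring.zero = 0, add = (+), module.smult = (*)\<rparr>"

definition quotient_module ::
  "('r, 'a) module \<Rightarrow> 'a set \<Rightarrow> ('r, 'a set) module" where
  "quotient_module M H =
     \<lparr>carrier = a_rcosets\<^bsub>M\<^esub> H, monoid.mult = undefined, one = undefined,
      ring.zero = H, add = set_add M,
      module.smult = (\<lambda>r C. \<Union>x\<in>C. H +>\<^bsub>M\<^esub> (r \<odot>\<^bsub>M\<^esub> x))\<rparr>"

definition direct_sum :: "('r, 'a) module list \<Rightarrow> ('r, nat \<Rightarrow> 'a) module" where
  "direct_sum Ms =
     \<lparr>carrier = (\<Pi>\<^sub>E i\<in>{..<length Ms}. carrier (Ms ! i)), monoid.mult = undefined, one = undefined,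
      ring.zero = (\<lambda>i\<in>{..<length Ms}. \<zero>\<^bsub>Ms ! i\<^esub>),
      add = (\<lambda>u v. \<lambda>i\<in>{..<length Ms}. u i \<oplus>\<^bsub>Ms ! i\<^esub> v i),
      module.smult = (\<lambda>r v. \<lambda>i\<in>{..<length Ms}. r \<odot>\<^bsub>Ms ! i\<^esub> v i)\<rparr>"

definition cyclic_module :: "nat \<Rightarrow> ('k::field fps, 'k fps set) module" where
  "cyclic_module b = quotient_module regular_module (PIdl\<^bsub>\<Lambda>\<^esub> (fps_X ^ b))"

definition N_mod :: "nat list \<Rightarrow> ('k::field fps, nat \<Rightarrow> 'k fps set) module" where
  "N_mod \<beta> = direct_sum (map cyclic_module \<beta>)"

text \<open>These constructions do yield \<open>\<Lambda>\<close>-modules.\<close>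

lemma module_regular_module: "Module.module \<Lambda> (regular_module :: ('k::field fps, 'k fps) module)"
proof (rule moduleI)
  show "cring (\<Lambda> :: 'k fps ring)" by (rule cring_Lambda)
  show "abelian_group (regular_module :: ('k fps, 'k fps) module)"
  proof (rule abelian_groupI)
    fix x :: "'k fps"
    show "\<exists>y\<in>carrier regular_module.
        y \<oplus>\<^bsub>regular_module\<^esub> x = \<zero>\<^bsub>regular_module\<^esub>"
      by (rule bexI[of _ "- x"]) (simp_all add: regular_module_def)
  qed (simp_all add: regular_module_def algebra_simps)
qed (simp_all add: regular_module_def Lambda_def algebra_simps)

lemma quotient_module_smult:
  assumes "Module.module R M" "submodule H R M" "r \<in> carrier R" "x \<in> carrier M"
  shows "r \<odot>\<^bsub>quotient_module M H\<^esub> (H +>\<^bsub>M\<^esub> x) = H +>\<^bsub>M\<^esub> (r \<odot>\<^bsub>M\<^esub> x)"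
proof -
  interpret Module.module R M by fact
  interpret S: submodule H R M by fact
  interpret A: abelian_subgroup H M
    by (rule abelian_subgroupI3) (simp_all add: additive_subgroup.intro S.subgroup_axioms M.abelian_group_axioms)
  have "H +>\<^bsub>M\<^esub> (r \<odot>\<^bsub>M\<^esub> y) = H +>\<^bsub>M\<^esub> (r \<odot>\<^bsub>M\<^esub> x)" if y: "y \<in> H +>\<^bsub>M\<^esub> x" for y
  proof -
    obtain h where h: "h \<in> H" "y = h \<oplus>\<^bsub>M\<^esub> x"
      using y unfolding a_r_coset_def' by auto
    have hM: "h \<in> carrier M" using h(1) A.a_subset by blast
    have "r \<odot>\<^bsub>M\<^esub> y = r \<odot>\<^bsub>M\<^esub> h \<oplus>\<^bsub>M\<^esub> r \<odot>\<^bsub>M\<^esub> x"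
      using assms hM h(2) by (simp add: smult_r_distr)
    moreover have "r \<odot>\<^bsub>M\<^esub> h \<in> H" using S.smult_closed assms(3) h(1) by blast
    ultimately have "r \<odot>\<^bsub>M\<^esub> y \<in> H +>\<^bsub>M\<^esub> (r \<odot>\<^bsub>M\<^esub> x)"
      unfolding a_r_coset_def' by auto
    then show ?thesis
      using A.a_repr_independence'[OF _ smult_closed[OF assms(3,4)]] by simp
  qed
  moreover have "x \<in> H +>\<^bsub>M\<^esub> x" using A.a_rcos_self assms(4) by blast
  ultimately have "(\<Union>y\<in>H +>\<^bsub>M\<^esub> x. H +>\<^bsub>M\<^esub> (r \<odot>\<^bsub>M\<^esub> y)) = H +>\<^bsub>M\<^esub> (r \<odot>\<^bsub>M\<^esub> x)"
    by blast
  then show ?thesis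
    by (simp add: quotient_module_def)
qed

lemma module_quotient_module:
  assumes "Module.module R M" "submodule H R M"
  shows "Module.module R (quotient_module M H)"
proof -
  interpret Module.module R M by fact
  interpret S: submodule H R M by fact
  interpret A: abelian_subgroup H M
    by (rule abelian_subgroupI3) (simp_all add: additive_subgroup.intro S.subgroup_axioms M.abelian_group_axioms)
  let ?Q = "quotient_module M H"
  have car: "carrier ?Q = {H +>\<^bsub>M\<^esub> x | x. x \<in> carrier M}"
    unfolding quotient_module_def A_RCOSETS_def' by auto
  have add: "(H +>\<^bsub>M\<^esub> x) \<oplus>\<^bsub>?Q\<^esub> (H +>\<^bsub>M\<^esub> y) = H +>\<^bsub>M\<^esub> (x \<oplus>\<^bsub>M\<^esub> y)"
    if "x \<in> carrier M" "y \<in> carrier M" for x y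
    using that by (simp add: quotient_module_def A.a_rcos_sum)
  have zero: "\<zero>\<^bsub>?Q\<^esub> = H +>\<^bsub>M\<^esub> \<zero>\<^bsub>M\<^esub>"
    by (simp add: quotient_module_def M.a_coset_add_zero A.a_subset)
  note smult = quotient_module_smult[OF assms]
  show ?thesis
  proof (rule moduleI)
    show "cring R" by (rule R.cring_axioms)
    show "abelian_group ?Q"
    proof (rule abelian_groupI)
      fix C assume "C \<in> carrier ?Q"
      then obtain x where x: "x \<in> carrier M" "C = H +>\<^bsub>M\<^esub> x" by (auto simp: car)
      then show "\<exists>Y\<in>carrier ?Q. Y \<oplus>\<^bsub>?Q\<^esub> C = \<zero>\<^bsub>?Q\<^esub>"
        by (intro bexI[of _ "H +>\<^bsub>M\<^esub> (\<ominus>\<^bsub>M\<^esub> x)"]) (auto simp: car add zero M.l_neg)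
      show "\<zero>\<^bsub>?Q\<^esub> \<oplus>\<^bsub>?Q\<^esub> C = C" using x by (simp add: add zero)
    next
      show "\<zero>\<^bsub>?Q\<^esub> \<in> carrier ?Q" by (auto simp: car zero)
    next
      fix C Y assume "C \<in> carrier ?Q" "Y \<in> carrier ?Q"
      then obtain x y where "x \<in> carrier M" "C = H +>\<^bsub>M\<^esub> x" "y \<in> carrier M" "Y = H +>\<^bsub>M\<^esub> y"
        by (auto simp: car)
      then show "C \<oplus>\<^bsub>?Q\<^esub> Y \<in> carrier ?Q" "C \<oplus>\<^bsub>?Q\<^esub> Y = Y \<oplus>\<^bsub>?Q\<^esub> C"
        by (auto simp: add car M.a_comm)
    next
      fix C Y Z assume "C \<in> carrier ?Q" "Y \<in> carrier ?Q" "Z \<in> carrier ?Q"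
      then show "C \<oplus>\<^bsub>?Q\<^esub> Y \<oplus>\<^bsub>?Q\<^esub> Z = C \<oplus>\<^bsub>?Q\<^esub> (Y \<oplus>\<^bsub>?Q\<^esub> Z)"
        by (auto simp: car add M.a_assoc)
    qed
  qed (auto simp: car add smult smult_l_distr smult_r_distr smult_assoc1)
qed

lemma module_direct_sum:
  assumes "cring R" "\<And>M. M \<in> set Ms \<Longrightarrow> Module.module R M"
  shows "Module.module R (direct_sum Ms)"
proof -
  have M: "Module.module R (Ms ! i)" if "i < length Ms" for i using assms(2) that by simp
  have A: "abelian_group (Ms ! i)" if "i < length Ms" for i using M[OF that] by (rule Module.module.axioms(2))
  have G: "abelian_group (direct_sum Ms)"
  proof (rule abelian_groupI)
    fix x assume x: "x \<in> carrier (direct_sum Ms)"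
    show "\<exists>y\<in>carrier (direct_sum Ms). y \<oplus>\<^bsub>direct_sum Ms\<^esub> x = \<zero>\<^bsub>direct_sum Ms\<^esub>"
      using x A by (intro bexI[of _ "\<lambda>i\<in>{..<length Ms}. \<ominus>\<^bsub>Ms ! i\<^esub> x i"])
        (auto simp: direct_sum_def fun_eq_iff restrict_def PiE_iff extensional_def
          abelian_group.l_neg abelian_group.a_inv_closed)
  next
    fix x y assume "x \<in> carrier (direct_sum Ms)" "y \<in> carrier (direct_sum Ms)"
    then show "x \<oplus>\<^bsub>direct_sum Ms\<^esub> y = y \<oplus>\<^bsub>direct_sum Ms\<^esub> x"
      using A by (auto simp: direct_sum_def fun_eq_iff PiE_iff abelian_group_def
          intro: abelian_monoid.a_comm)
  qed (use A in \<open>auto simp: direct_sum_def fun_eq_iff PiE_iff extensional_def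
        abelian_monoid.a_closed abelian_monoid.zero_closed
        abelian_monoid.a_assoc abelian_monoid.l_zero abelian_group_def\<close>)
  show ?thesis
    by (rule moduleI[OF assms(1) G])
      (auto simp: direct_sum_def fun_eq_iff PiE_iff extensional_def abelian_monoid.a_closed
        Module.module.smult_closed[OF M] Module.module.smult_l_distr[OF M]
        Module.module.smult_r_distr[OF M] Module.module.smult_assoc1[OF M]
        Module.module.smult_one[OF M])
qed

lemma module_cyclic_module: "Module.module \<Lambda> (cyclic_module b :: ('k::field fps, 'k fps set) module)"
  unfolding cyclic_module_def
proof (rule module_quotient_module[OF module_regular_module])
  interpret Module.module "\<Lambda> :: 'k fps ring" regular_module by (rule module_regular_module)
  let ?I = "PIdl\<^bsub>(\<Lambda> :: 'k fps ring)\<^esub> (fps_X ^ b)"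
  have I: "?I = range (\<lambda>x. x * fps_X ^ b)"
    by (auto simp: cgenideal_def Lambda_def)
  show "submodule ?I (\<Lambda> :: 'k fps ring) regular_module"
  proof (rule submoduleI)
    fix x :: "'k fps" assume "x \<in> ?I"
    then obtain y where y: "x = y * fps_X ^ b" unfolding I by auto
    have "(- x) \<oplus>\<^bsub>regular_module\<^esub> x = \<zero>\<^bsub>regular_module\<^esub>"
      by (simp add: regular_module_def)
    then have "\<ominus>\<^bsub>regular_module\<^esub> x = - x"
      by (intro M.minus_equality) (auto simp: regular_module_def)
    also have "\<dots> = (- y) * fps_X ^ b" using y by simp
    finally show "\<ominus>\<^bsub>regular_module\<^esub> x \<in> ?I" unfolding I by blast
  next
    show "\<zero>\<^bsub>regular_module\<^esub> \<in> ?I"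
      unfolding I by (auto simp: regular_module_def image_iff intro: exI[of _ 0])
  next
    fix x y :: "'k fps" assume "x \<in> ?I" "y \<in> ?I"
    then obtain c d where "x = c * fps_X ^ b" "y = d * fps_X ^ b" unfolding I by auto
    then have "x + y = (c + d) * fps_X ^ b" by (simp add: algebra_simps)
    then show "x \<oplus>\<^bsub>regular_module\<^esub> y \<in> ?I" unfolding I by (auto simp: regular_module_def)
  next
    fix r x :: "'k fps" assume "x \<in> ?I"
    then obtain c where "x = c * fps_X ^ b" unfolding I by auto
    then have "r * x = (r * c) * fps_X ^ b" by (simp add: algebra_simps)
    then show "r \<odot>\<^bsub>regular_module\<^esub> x \<in> ?I" unfolding I by (auto simp: regular_module_def)
  qed (auto simp: regular_module_def)
qed

lemma module_N_mod: "Module.module \<Lambda> (N_mod \<beta> :: ('k::field fps, nat \<Rightarrow> 'k fps set) module)"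
  unfolding N_mod_def
  by (rule module_direct_sum) (auto intro: cring_Lambda module_cyclic_module)

definition linear_maps ::
  "'r set \<Rightarrow> ('r, 'a) module \<Rightarrow> ('r, 'b) module \<Rightarrow> ('a \<Rightarrow> 'b) set" where
  "linear_maps S V W =
     {f \<in> carrier V \<rightarrow>\<^sub>E carrier W.
        (\<forall>x\<in>carrier V. \<forall>y\<in>carrier V. f (x \<oplus>\<^bsub>V\<^esub> y) = f x \<oplus>\<^bsub>W\<^esub> f y) \<and>
        (\<forall>r\<in>S. \<forall>x\<in>carrier V. f (r \<odot>\<^bsub>V\<^esub> x) = r \<odot>\<^bsub>W\<^esub> f x)}"

definition Hom_Lambda ::
  "('k::field fps, 'a) module \<Rightarrow> ('k fps, 'b) module \<Rightarrow> ('a \<Rightarrow> 'b) set" where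
  "Hom_Lambda V W = linear_maps UNIV V W"

definition Hom_k ::
  "('k::field fps, 'a) module \<Rightarrow> ('k fps, 'b) module \<Rightarrow> ('a \<Rightarrow> 'b) set" where
  "Hom_k V W = linear_maps (range fps_const) V W"

definition module_isomorphic ::
  "('k::field fps, 'a) module \<Rightarrow> ('k fps, 'b) module \<Rightarrow> bool" where
  "module_isomorphic V W \<longleftrightarrow> (\<exists>h\<in>Hom_Lambda V W. bij_betw h (carrier V) (carrier W))"

definition has_type :: "('k::field fps, 'a) module \<Rightarrow> nat list \<Rightarrow> bool" where
  "has_type M \<beta> \<longleftrightarrow> module_isomorphic M (N_mod \<beta>)"

definition p_power_image :: "('k::field fps, 'a) module \<Rightarrow> nat \<Rightarrow> 'a set \<Rightarrow> 'a set" where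
  "p_power_image B e A = (\<lambda>a. (fps_X ^ e) \<odot>\<^bsub>B\<^esub> a) ` A"

definition embedding_has_tableau :: "('k::field fps, 'a) module \<Rightarrow> 'a set \<Rightarrow> tableau \<Rightarrow> bool" where
  "embedding_has_tableau B A \<Gamma> \<longleftrightarrow>
     (\<forall>e. has_type (quotient_module B (p_power_image B e A)) (\<Gamma> e))"

section \<open>The Zariski topology on \<open>Hom\<^sub>k\<close>\<close>

definition k_dual :: "('k::field fps, 'b) module \<Rightarrow> ('b \<Rightarrow> 'k) set" where
  "k_dual W =
     {\<phi>. (\<forall>x\<in>carrier W. \<forall>y\<in>carrier W. \<phi> (x \<oplus>\<^bsub>W\<^esub> y) = \<phi> x + \<phi> y) \<and>
         (\<forall>c. \<forall>x\<in>carrier W. \<phi> (fps_const c \<odot>\<^bsub>W\<^esub> x) = c * \<phi> x)}"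

text \<open>Polynomial functions on the affine space \<open>Hom\<^sub>k(V, W)\<close>, for \<open>V\<close> and \<open>W\<close> of finite
  \<open>k\<close>-dimension: matrix entries with respect to bases of \<open>V\<close> and \<open>W\<close> are of the form
  \<open>f \<mapsto> \<phi> (f v)\<close>, and conversely each such function is a linear combination of matrix entries.\<close>

inductive_set poly_functions ::
  "('k::field fps, 'a) module \<Rightarrow> ('k fps, 'b) module \<Rightarrow> (('a \<Rightarrow> 'b) \<Rightarrow> 'k) set"
  for V W where
  const: "(\<lambda>_. c) \<in> poly_functions V W"
| coord: "v \<in> carrier V \<Longrightarrow> \<phi> \<in> k_dual W \<Longrightarrow> (\<lambda>f. \<phi> (f v)) \<in> poly_functions V W"
| add: "P \<in> poly_functions V W \<Longrightarrow> Q \<in> poly_functions V W \<Longrightarrow>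
    (\<lambda>f. P f + Q f) \<in> poly_functions V W"
| mult: "P \<in> poly_functions V W \<Longrightarrow> Q \<in> poly_functions V W \<Longrightarrow>
    (\<lambda>f. P f * Q f) \<in> poly_functions V W"

definition zariski_open ::
  "('k::field fps, 'a) module \<Rightarrow> ('k fps, 'b) module \<Rightarrow> ('a \<Rightarrow> 'b) set \<Rightarrow> bool" where
  "zariski_open V W U \<longleftrightarrow>
     (\<exists>S \<subseteq> poly_functions V W. U = Hom_k V W - {f. \<forall>P\<in>S. P f = 0})"

definition zariski ::
  "('k::field fps, 'a) module \<Rightarrow> ('k fps, 'b) module \<Rightarrow> ('a \<Rightarrow> 'b) topology" where
  "zariski V W = topology (zariski_open V W)"

lemma istopology_zariski_open: "istopology (zariski_open V W)"
  unfolding istopology_def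
proof (intro conjI allI impI)
  fix A B assume "zariski_open V W A" "zariski_open V W B"
  then obtain S T where S: "S \<subseteq> poly_functions V W" "A = Hom_k V W - {f. \<forall>P\<in>S. P f = 0}"
    and T: "T \<subseteq> poly_functions V W" "B = Hom_k V W - {f. \<forall>P\<in>T. P f = 0}"
    unfolding zariski_open_def by blast
  define ST where "ST = (\<lambda>(P, Q). (\<lambda>f. P f * Q f)) ` (S \<times> T)"
  have "ST \<subseteq> poly_functions V W"
    using S(1) T(1) unfolding ST_def by (auto intro: poly_functions.mult)
  moreover have "A \<inter> B = Hom_k V W - {f. \<forall>P\<in>ST. P f = 0}"
    unfolding ST_def S(2) T(2) by auto
  ultimately show "zariski_open V W (A \<inter> B)"
    unfolding zariski_open_def by blast
next
  fix \<K> assume K: "\<forall>K\<in>\<K>. zariski_open V W K"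
  define S where "S = {P \<in> poly_functions V W. \<exists>K\<in>\<K>. \<forall>f\<in>Hom_k V W - K. P f = 0}"
  have "\<Union>\<K> = Hom_k V W - {f. \<forall>P\<in>S. P f = 0}"
  proof (intro equalityI subsetI)
    fix f assume "f \<in> \<Union>\<K>"
    then obtain K' where K': "K' \<in> \<K>" "f \<in> K'" by (rule UnionE)
    from K K'(1) have "zariski_open V W K'" by (rule bspec)
    then obtain T where T: "T \<subseteq> poly_functions V W"
        "K' = Hom_k V W - {f. \<forall>P\<in>T. P f = 0}"
      unfolding zariski_open_def by (elim exE conjE)
    have "\<forall>g\<in>Hom_k V W - K'. P g = 0" if "P \<in> T" for P
      unfolding T(2) using that by auto
    then have "T \<subseteq> S" unfolding S_def using T(1) K'(1) by blast
    moreover have "f \<in> Hom_k V W" "\<exists>P\<in>T. P f \<noteq> 0" using K'(2) unfolding T(2) by auto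
    ultimately show "f \<in> Hom_k V W - {f. \<forall>P\<in>S. P f = 0}" by auto
  next
    fix f assume f: "f \<in> Hom_k V W - {f. \<forall>P\<in>S. P f = 0}"
    then obtain P where "P \<in> S" "P f \<noteq> 0" by auto
    then obtain K' where "K' \<in> \<K>" "\<forall>g\<in>Hom_k V W - K'. P g = 0"
      unfolding S_def by auto
    with f \<open>P f \<noteq> 0\<close> have "f \<in> K'" by auto
    with \<open>K' \<in> \<K>\<close> show "f \<in> \<Union>\<K>" by (rule UnionI)
  qed
  moreover have "S \<subseteq> poly_functions V W" unfolding S_def by blast
  ultimately show "zariski_open V W (\<Union>\<K>)"
    unfolding zariski_open_def by blast
qed

lemma openin_zariski: "openin (zariski V W) = zariski_open V W"
  unfolding zariski_def using istopology_zariski_open by (rule topology_inverse')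

lemma topspace_zariski: "topspace (zariski V W) = Hom_k V W"
proof -
  have "zariski_open V W (Hom_k V W)"
    unfolding zariski_open_def
    by (rule exI[of _ "{\<lambda>_. 1}"]) (auto intro: poly_functions.const)
  moreover have "U \<subseteq> Hom_k V W" if "zariski_open V W U" for U
    using that unfolding zariski_open_def by blast
  ultimately show ?thesis
    unfolding topspace_def openin_zariski by blast
qed

section \<open>The boundary order\<close>

definition VV ::
  "nat list \<Rightarrow> nat list \<Rightarrow> nat list \<Rightarrow> ((nat \<Rightarrow> 'k::field fps set) \<Rightarrow> (nat \<Rightarrow> 'k fps set)) set"
  where
  "VV \<alpha> \<beta> \<gamma> =
     {f \<in> Hom_Lambda (N_mod \<alpha>) (N_mod \<beta>).
        inj_on f (carrier (N_mod \<alpha>)) \<and>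
        module_isomorphic (quotient_module (N_mod \<beta>) (f ` carrier (N_mod \<alpha>))) (N_mod \<gamma>)}"

definition VV_tableau ::
  "nat list \<Rightarrow> nat list \<Rightarrow> nat list \<Rightarrow> tableau \<Rightarrow>
    ((nat \<Rightarrow> 'k::field fps set) \<Rightarrow> (nat \<Rightarrow> 'k fps set)) set" where
  "VV_tableau \<alpha> \<beta> \<gamma> \<Gamma> =
     {f \<in> VV \<alpha> \<beta> \<gamma>. embedding_has_tableau (N_mod \<beta>) (f ` carrier (N_mod \<alpha>)) \<Gamma>}"

text \<open>The field is passed as a type argument, since it does not occur in the types of the
  partitions and tableaux.\<close>

definition boundary_step ::
  "'k::field itself \<Rightarrow> nat list \<Rightarrow> nat list \<Rightarrow> nat list \<Rightarrow> tableau \<Rightarrow> tableau \<Rightarrow> bool" where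
  "boundary_step k \<alpha> \<beta> \<gamma> \<Gamma> \<Gamma>' \<longleftrightarrow>
     LR_tableau \<alpha> \<beta> \<gamma> \<Gamma> \<and> LR_tableau \<alpha> \<beta> \<gamma> \<Gamma>' \<and>
     VV_tableau \<alpha> \<beta> \<gamma> \<Gamma>' \<inter>
       Abstract_Topology.closure_of
         (zariski (N_mod \<alpha>) (N_mod \<beta> :: ('k fps, nat \<Rightarrow> 'k fps set) module))
         (VV_tableau \<alpha> \<beta> \<gamma> \<Gamma>) \<noteq> {}"

definition boundary_le ::
  "'k::field itself \<Rightarrow> nat list \<Rightarrow> nat list \<Rightarrow> nat list \<Rightarrow> tableau \<Rightarrow> tableau \<Rightarrow> bool" where
  "boundary_le k \<alpha> \<beta> \<gamma> = (boundary_step k \<alpha> \<beta> \<gamma>)\<^sup>*\<^sup>*"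

end

theory Submission
  imports Defs
begin

text \<open>For a strip, an LR-tableau is a lattice word \<open>w\<close>, the entry \<open>w x\<close> of row \<open>x\<close> being
  \<open>0\<close> if the row has no box, and the dominance order is the Bruhat order: every prefix of the
  smaller word has at least as many entries above any given bound. If \<open>w\<close> is below \<open>v\<close>, two entries
  of \<open>w\<close> can be interchanged so that the result is again a lattice word below \<open>v\<close>, and neither of
  the two entries occurs between them. Such an interchange is an increasing box move. It is also a
  boundary step: the \<open>c\<close>-th occurrences of the entries \<open>1, 2, \<dots>\<close> form chains, the generators
  of \<open>A\<close> are sent to sums of basis vectors along the chains, and a linear perturbation of one
  coefficient changes the tableau generically. Conversely, box moves increase the partial sums since
  truncation is concave, and boundary steps do since the dimension of \<open>p\<^sup>l A + p\<^sup>m B\<close> is lower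
  semicontinuous.\<close>

section \<open>Lattice words\<close>

text \<open>The partial sum over i \<le> m of the conjugate parts of the l-th partition is the
  dimension of B/(p^l A + p^m B); this is why the semicontinuity of dimensions speaks about the
  dominance order at all. The obstacle on the combinatorial side is the lattice condition. Let b be
  the entry of w in the first row where the words differ. Swapping it with the next entry that is
  smaller than b but not smaller than that of v brings w closer to v, yet may leave fewer entries b
  than b + 1 in some prefix. The larger entry is therefore taken from the end of the run b, b + 1,
  ... of entries that occur equally often. That neither entry occurs in between keeps the occurrence
  numbers of all other boxes fixed, so that a single extra coefficient realizes the exchange
  geometrically. On the algebraic side composition lengths are replaced by counting: a spanning
  family no larger than the dimension is independent, so types of quotients are established by
  exhibiting spanning families of the right size.\<close>

definition tally :: "(nat \<Rightarrow> nat) \<Rightarrow> nat \<Rightarrow> nat set \<Rightarrow> nat" where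
  "tally w m E = card {x. x \<le> m \<and> w x \<in> E}"

text \<open>Rows are read from the top. Further down in a strip the boxes lie further left, so this
  is the right-to-left condition on columns of an LR-tableau.\<close>

definition ballot :: "(nat \<Rightarrow> nat) \<Rightarrow> bool" where
  "ballot w \<longleftrightarrow> (\<forall>m. \<forall>e\<ge>1. tally w m {Suc e} \<le> tally w m {e})"

definition transpose_word :: "nat \<Rightarrow> nat \<Rightarrow> (nat \<Rightarrow> nat) \<Rightarrow> nat \<Rightarrow> nat" where
  "transpose_word p j w = w(p := w j, j := w p)"

lemma tally_0: "tally w 0 E = of_bool (w 0 \<in> E)"
proof -
  have "{x. x \<le> (0::nat) \<and> w x \<in> E} = (if w 0 \<in> E then {0} else {})" by auto
  then show ?thesis by (simp add: tally_def)
qed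

lemma tally_Suc: "tally w (Suc m) E = tally w m E + of_bool (w (Suc m) \<in> E)"
proof -
  have "{x. x \<le> Suc m \<and> w x \<in> E} =
      (if w (Suc m) \<in> E then insert (Suc m) {x. x \<le> m \<and> w x \<in> E} else {x. x \<le> m \<and> w x \<in> E})"
    by (auto simp: le_Suc_eq)
  then show ?thesis by (simp add: tally_def)
qed

lemma tally_Un: "E \<inter> F = {} \<Longrightarrow> tally w m (E \<union> F) = tally w m E + tally w m F"
  by (induction m) (auto simp: tally_0 tally_Suc)

lemma tally_mono: "m \<le> m' \<Longrightarrow> tally w m E \<le> tally w m' E"
  unfolding tally_def by (rule card_mono) auto

lemma tally_const:
  assumes "m \<le> m'" "\<And>x. m < x \<Longrightarrow> x \<le> m' \<Longrightarrow> w x \<notin> E"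
  shows "tally w m' E = tally w m E"
proof -
  have "{x. x \<le> m' \<and> w x \<in> E} = {x. x \<le> m \<and> w x \<in> E}"
    using assms by (auto simp: not_le[symmetric])
  then show ?thesis by (simp add: tally_def)
qed

lemma tally_less_ex:
  assumes "tally w m E < tally w m' E"
  obtains x where "m < x" "x \<le> m'" "w x \<in> E"
proof -
  have "m \<le> m'" using assms tally_mono[of m' m w E] by (cases "m \<le> m'") auto
  with assms tally_const[of m m' w E] that show ?thesis by fastforce
qed

lemma tally_agree_below:
  assumes "\<And>x. x < i \<Longrightarrow> w x = v x"
  shows "tally w i E + of_bool (v i \<in> E) = tally v i E + of_bool (w i \<in> E)"
proof -
  have "tally w m E = tally v m E" if "m < i" for m
  proof -
    have "{x. x \<le> m \<and> w x \<in> E} = {x. x \<le> m \<and> v x \<in> E}" using assms that by auto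
    then show ?thesis by (simp add: tally_def)
  qed
  then show ?thesis by (cases i) (auto simp: tally_0 tally_Suc)
qed

text \<open>Only the prefixes that contain row p but not row j notice the exchange. The two
  corrections stand on opposite sides because a difference of naturals would truncate.\<close>

lemma tally_transpose:
  assumes "p < j"
  shows "tally (transpose_word p j w) m E + of_bool (p \<le> m \<and> m < j \<and> w p \<in> E)
    = tally w m E + of_bool (p \<le> m \<and> m < j \<and> w j \<in> E)"
proof (induction m)
  case 0
  then show ?case using assms by (auto simp: tally_0 transpose_word_def)
next
  case (Suc m)
  consider "Suc m < p" | "Suc m = p" | "p \<le> m" "Suc m < j" | "p \<le> m" "Suc m = j" | "j \<le> m"
    by linarith
  then show ?case
    using Suc assms by cases (auto simp: tally_Suc transpose_word_def split: if_splits)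
qed

lemma ballot_antimono:
  assumes "ballot w" "1 \<le> e" "e \<le> f"
  shows "tally w m {f} \<le> tally w m {e}"
  using assms(3,2)
proof (induction f rule: dec_induct)
  case (step n)
  then show ?case using assms(1) unfolding ballot_def by (meson le_trans)
qed simp

lemma tally_greaterThan_Suc: "tally w m {l<..} = tally w m {Suc l} + tally w m {Suc l<..}"
proof -
  have "{l<..} = {Suc l} \<union> {Suc l<..}" by auto
  moreover have "{Suc l} \<inter> {Suc l<..} = {}" by auto
  ultimately show ?thesis using tally_Un by metis
qed

text \<open>Only the prefixes ending in rows p to j - 1 change: each gains an e = \<open>w j\<close>
  and loses a d = \<open>w p\<close>. Gaining e requires a spare e - 1 (\<open>LC\<close>), losing d
  requires fewer entries d + 1 than d (\<open>dSuc\<close>), and staying above v requires slack at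
  the levels from e to d - 1 (\<open>strict\<close>).\<close>

lemma ballot_exchange:
  assumes bw: "ballot w" and bv: "ballot v"
    and supp: "\<And>x. w x = 0 \<longleftrightarrow> v x = 0"
    and fin: "\<And>x. M < x \<Longrightarrow> w x = 0"
    and tot: "\<And>E. 0 \<notin> E \<Longrightarrow> tally w M E = tally v M E"
    and dom: "\<And>m l. tally v m {l<..} \<le> tally w m {l<..}"
    and ne: "w \<noteq> v"
  obtains p j where "p < j" "j \<le> M" "0 < w j" "w j < w p"
    "\<And>x. p < x \<Longrightarrow> x < j \<Longrightarrow> w x \<noteq> w p \<and> w x \<noteq> w j"
    "ballot (transpose_word p j w)"
    "\<And>m l. tally v m {l<..} \<le> tally (transpose_word p j w) m {l<..}"
proof -
  define i where "i = (LEAST x. w x \<noteq> v x)"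
  have ex: "\<exists>x. w x \<noteq> v x" using ne by auto
  have i: "w i \<noteq> v i" unfolding i_def using ex by (rule LeastI_ex)
  have below: "w x = v x" if "x < i" for x using not_less_Least[of x] that unfolding i_def by blast
  define a b where "a = v i" and "b = w i"
  have pre: "tally w i E + of_bool (a \<in> E) = tally v i E + of_bool (b \<in> E)" for E
    using tally_agree_below[of i w v E] below unfolding a_def b_def by blast
  have ab: "a < b"
  proof (rule ccontr)
    assume "\<not> a < b"
    then have "b < a" using i unfolding a_def b_def by simp
    then show False using pre[of "{b<..}"] dom[of i b] by simp
  qed
  have a0: "1 \<le> a" using ab supp[of i] unfolding a_def b_def by (cases "v i") auto
  have iM: "i \<le> M" using fin[of i] ab unfolding b_def by (cases "M < i") auto
  \<comment> \<open>After row i the word v is ahead by one entry from [a, b). The totals agree, so w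
    has such an entry further down.\<close>
  have "tally w i {a..<b} < tally v i {a..<b}" using pre[of "{a..<b}"] ab by simp
  also have "\<dots> \<le> tally v M {a..<b}" by (rule tally_mono[OF iM])
  also have "\<dots> = tally w M {a..<b}" using tot[of "{a..<b}"] a0 by simp
  finally obtain j0 where j0: "i < j0" "j0 \<le> M" "w j0 \<in> {a..<b}" by (rule tally_less_ex)
  define j where "j = (LEAST x. i < x \<and> w x \<in> {a..<b})"
  have j: "i < j" "w j \<in> {a..<b}" using LeastI[of "\<lambda>x. i < x \<and> w x \<in> {a..<b}" j0] j0 unfolding j_def by auto
  have jM: "j \<le> M" using Least_le[of "\<lambda>x. i < x \<and> w x \<in> {a..<b}" j0] j0 unfolding j_def by auto
  have between: "w x \<notin> {a..<b}" if "i < x" "x < j" for x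
    using not_less_Least[of x "\<lambda>x. i < x \<and> w x \<in> {a..<b}"] that unfolding j_def by blast
  define e where "e = w j"
  have e: "a \<le> e" "e < b" using j unfolding e_def by auto
  have const: "tally w m E = tally w i E" if "i \<le> m" "m < j" "E \<subseteq> {a..<b}" for m E
    by (rule tally_const) (use that between in force)+
  \<comment> \<open>Before row j the word w gains nothing in [a, b), while v has its additional a.
    Dominance at level a - 1 turns this deficit in a..l into a surplus above l.\<close>
  have LB: "tally v m {l<..} < tally w m {l<..}" if m: "i \<le> m" "m < j" and l: "a \<le> l" "l < b" for m l
  proof -
    have split: "{a - 1<..} = {a..l} \<union> {l<..}" using a0 l by auto
    have "{a..l} \<inter> {l<..} = {}" by auto
    then have parts: "tally u m {a - 1<..} = tally u m {a..l} + tally u m {l<..}" for u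
      unfolding split by (rule tally_Un)
    have "tally w m {a..l} = tally w i {a..l}" by (rule const[OF m]) (use l in auto)
    moreover have "tally w i {a..l} < tally v i {a..l}" using pre[of "{a..l}"] l by simp
    moreover have "tally v i {a..l} \<le> tally v m {a..l}" by (rule tally_mono[OF m(1)])
    ultimately show ?thesis using dom[of m "a - 1"] parts[of w] parts[of v] by linarith
  qed
  \<comment> \<open>If e = a, the a that v puts in row i is covered by an a - 1 of v, and up to row
    i both words have equally many a - 1. If e > a, the lattice condition of w at row j, which adds
    an e, forces the spare e - 1 before row j.\<close>
  have LC: "tally w m {e} < tally w m {e - 1}" if m: "i \<le> m" "m < j" and e2: "2 \<le> e" for m
  proof (cases "e = a")
    case True
    have "tally w m {e} = tally w i {e}" by (rule const[OF m]) (use e in auto)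
    moreover have "tally w i {e} < tally v i {e}" using pre[of "{e}"] True ab by simp
    moreover have "tally v i {e} \<le> tally v i {e - 1}" using ballot_antimono[OF bv, of "e - 1" e] e2 by simp
    moreover have "tally v i {e - 1} = tally w i {e - 1}"
    proof -
      have "a - 1 \<noteq> a" "a - 1 \<noteq> b" using ab a0 by auto
      then show ?thesis using pre[of "{a - 1}"] True by auto
    qed
    moreover have "tally w i {e - 1} \<le> tally w m {e - 1}" by (rule tally_mono[OF m(1)])
    ultimately show ?thesis by linarith
  next
    case False
    then have ea: "a < e" using e by simp
    obtain j' where j': "j = Suc j'" using j by (cases j) auto
    have "tally w j {e} = Suc (tally w j' {e})" "tally w j {e - 1} = tally w j' {e - 1}"
      unfolding j' tally_Suc using e2 by (auto simp: e_def j')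
    moreover have "tally w j {e} \<le> tally w j {e - 1}" using ballot_antimono[OF bw, of "e - 1" e] e2 by simp
    moreover have "tally w j' {e} = tally w m {e}" "tally w j' {e - 1} = tally w m {e - 1}"
    proof -
      have "{e} \<subseteq> {a..<b}" "{e - 1} \<subseteq> {a..<b}" using e ea by auto
      then show "tally w j' {e} = tally w m {e}" "tally w j' {e - 1} = tally w m {e - 1}"
        using const[of j'] const[OF m] j j' by auto
    qed
    ultimately show ?thesis by linarith
  qed
  define k where "k = j - 1"
  have k: "i \<le> k" "j = Suc k" using j unfolding k_def by auto
  define C where "C = tally w k {b}"
  have Cpos: "tally v i {b} < C"
  proof -
    have "tally v i {b} < tally w i {b}" using pre[of "{b}"] ab by simp
    also have "\<dots> \<le> C" unfolding C_def by (rule tally_mono[OF k(1)])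
    finally show ?thesis .
  qed
  \<comment> \<open>Entries larger than all those of w occur zero times while C is positive, so the
    run of equal counts starting at b ends.\<close>
  have ex_drop: "\<exists>d\<ge>b. tally w k {Suc d} \<noteq> tally w k {d}"
  proof (rule ccontr)
    assume "\<not> ?thesis"
    then have eq: "\<And>d. b \<le> d \<Longrightarrow> tally w k {Suc d} = tally w k {d}" by blast
    have all: "tally w k {b + n} = C" for n by (induction n) (auto simp: C_def eq)
    define n where "n = Suc (\<Sum>y\<le>k. w y)"
    have "w y \<noteq> b + n" if "y \<le> k" for y
      using member_le_sum[of y "{..k}" w] that unfolding n_def by simp
    then have "tally w k {b + n} = 0" unfolding tally_def by simp
    then show False using all[of n] Cpos by simp
  qed
  define d where "d = (LEAST d. b \<le> d \<and> tally w k {Suc d} \<noteq> tally w k {d})"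
  have d: "b \<le> d" "tally w k {Suc d} \<noteq> tally w k {d}"
    using LeastI_ex[of "\<lambda>d. b \<le> d \<and> tally w k {Suc d} \<noteq> tally w k {d}"] ex_drop unfolding d_def by blast+
  have dmin: "tally w k {Suc x} = tally w k {x}" if "b \<le> x" "x < d" for x
    using not_less_Least[of x "\<lambda>d. b \<le> d \<and> tally w k {Suc d} \<noteq> tally w k {d}"] that unfolding d_def by blast
  have level: "tally w k {x} = C" if "b \<le> x" "x \<le> d" for x
    using that by (induction x rule: dec_induct) (auto simp: C_def dmin)
  have b1: "1 \<le> b" using a0 ab by simp
  have dSuc: "tally w k {Suc d} < C"
    using d level[of d] bw b1 unfolding ballot_def by (metis d(1) le_neq_implies_less le_trans order_refl)
  \<comment> \<open>If d = b, row i itself will do. Otherwise up to row i the words have equally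
    many d, fewer than C by the lattice condition of v, whereas w has C of them before row
    j.\<close>
  have ex_p: "\<exists>x. i \<le> x \<and> x < j \<and> w x = d"
  proof (cases "d = b")
    case True
    then show ?thesis using j b_def by auto
  next
    case False
    have "tally w i {d} = tally v i {d}" using pre[of "{d}"] False d ab by auto
    also have "\<dots> \<le> tally v i {b}" by (rule ballot_antimono[OF bv b1 d(1)])
    also have "\<dots> < tally w k {d}" using Cpos level[of d] d by simp
    finally obtain x where "i < x" "x \<le> k" "w x = d" by (rule tally_less_ex) auto
    then show ?thesis using k by (intro exI[of _ x]) auto
  qed
  define p where "p = Max {x. i \<le> x \<and> x < j \<and> w x = d}"
  have finp: "finite {x. i \<le> x \<and> x < j \<and> w x = d}" by (rule finite_subset[of _ "{..j}"]) auto
  have "p \<in> {x. i \<le> x \<and> x < j \<and> w x = d}"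
    unfolding p_def using finp ex_p by (intro Max_in) auto
  then have p: "i \<le> p" "p < j" "w p = d" by auto
  have pmax: "w x \<noteq> d" if "p < x" "x < j" for x
  proof
    assume "w x = d"
    then have "x \<in> {x. i \<le> x \<and> x < j \<and> w x = d}" using that p(1) by simp
    then have "x \<le> p" unfolding p_def by (rule Max_ge[OF finp])
    then show False using that by simp
  qed
  \<comment> \<open>No d is added between p and j, so d has already reached the count C; the lattice
    condition squeezes the counts of b to d.\<close>
  have flat: "tally w m {x} = C" if m: "p \<le> m" "m < j" and x: "b \<le> x" "x \<le> d" for m x
  proof -
    have "tally w k {d} = tally w m {d}"
      by (rule tally_const) (use m k pmax in auto)
    then have "C = tally w m {d}" using level[of d] d by simp
    moreover have "tally w m {d} \<le> tally w m {x}"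
      by (rule ballot_antimono[OF bw]) (use x b1 in auto)
    moreover have "tally w m {x} \<le> tally w k {x}" by (rule tally_mono) (use m k in auto)
    ultimately show ?thesis using level[OF x] by simp
  qed
  \<comment> \<open>Below b this is \<open>LB\<close>. Beyond, if strictness were lost at level
    \<open>Suc n\<close>, then w would have more entries \<open>Suc n\<close> than v and, by
    \<open>flat\<close> and the lattice condition of v, also more entries
    \<open>Suc (Suc n)\<close>, which violates dominance one level higher.\<close>
  have strict: "tally v m {l<..} < tally w m {l<..}" if m: "p \<le> m" "m < j" and l: "e \<le> l" "l < d" for m l
  proof (cases "l < b")
    case True
    then show ?thesis using LB[of m l] m p l e by simp
  next
    case False
    then have "b - 1 \<le> l" by simp
    then show ?thesis using l(2)
    proof (induction l rule: dec_induct)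
      case base
      then show ?case using LB[of m "b - 1"] m p e ab by simp
    next
      case (step n)
      have st: "tally v m {n<..} < tally w m {n<..}" using step by simp
      have bn: "b \<le> Suc n" "Suc (Suc n) \<le> d" using step b1 by simp_all
      show ?case
      proof (rule ccontr)
        assume neg: "\<not> ?thesis"
        then have "tally w m {Suc n} > tally v m {Suc n}"
          using st tally_greaterThan_Suc[of v m n] tally_greaterThan_Suc[of w m n] by simp
        moreover have "tally v m {Suc (Suc n)} \<le> tally v m {Suc n}"
          using bv unfolding ballot_def by simp
        moreover have "tally w m {Suc (Suc n)} = tally w m {Suc n}"
          using flat[OF m] bn by simp
        ultimately show False
          using dom[of m "Suc (Suc n)"] neg tally_greaterThan_Suc[of v m "Suc n"]
            tally_greaterThan_Suc[of w m "Suc n"] by simp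
      qed
    qed
  qed
  note tr = tally_transpose[OF p(2), of w, unfolded p(3), folded e_def]
  show ?thesis
  proof (rule that[of p j])
    show "p < j" "j \<le> M" "0 < w j" "w j < w p" using p jM e a0 d e_def by auto
    show "w x \<noteq> w p \<and> w x \<noteq> w j" if "p < x" "x < j" for x
      using pmax[OF that] between[of x] that p j by auto
    show "ballot (transpose_word p j w)"
      unfolding ballot_def
    proof (intro allI impI)
      fix m x :: nat assume x: "1 \<le> x"
      have bx: "tally w m {Suc x} \<le> tally w m {x}" using bw x unfolding ballot_def by blast
      show "tally (transpose_word p j w) m {Suc x} \<le> tally (transpose_word p j w) m {x}"
      proof (cases "p \<le> m \<and> m < j")
        case False
        then show ?thesis using tr[of m "{x}"] tr[of m "{Suc x}"] bx by auto
      next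
        case True
        have ed: "e < d" using e d by simp
        have "tally w m {Suc d} < tally w m {d}"
          using dSuc flat[of m d] True d tally_mono[of m k w "{Suc d}"] k by simp
        moreover have "Suc x = e \<Longrightarrow> tally w m {e} < tally w m {x}"
          using LC[of m] True p x by force
        ultimately show ?thesis using tr[of m "{x}"] tr[of m "{Suc x}"] bx True ed
          by (cases "x = d"; cases "x = e"; cases "Suc x = d"; cases "Suc x = e") auto
      qed
    qed
    show "tally v m {l<..} \<le> tally (transpose_word p j w) m {l<..}" for m l
      using tr[of m "{l<..}"] dom[of m l] strict[of m l] e d
      by (cases "p \<le> m \<and> m < j"; cases "l < e"; cases "l < d") auto
  qed
qed

section \<open>Linear algebra over a field\<close>

text \<open>Elimination with a pivot vector k0 in coordinate i removes one vector and one
  coordinate, so both the spanning property and the inequality of cardinalities pass to the smaller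
  family.\<close>

lemma spanning_family_independent:
  fixes z :: "'j \<Rightarrow> 'i \<Rightarrow> 'k::field"
  assumes "finite I" "finite K" "card K \<le> card I"
    and "\<And>u. \<exists>c. \<forall>i\<in>I. u i = (\<Sum>k\<in>K. c k * z k i)"
    and "\<And>i. i \<in> I \<Longrightarrow> (\<Sum>k\<in>K. c k * z k i) = 0" and "k \<in> K"
  shows "c k = 0"
  using assms
proof (induction I arbitrary: K z c k rule: finite_induct)
  case empty
  then show ?case by simp
next
  case (insert i I)
  obtain a where a: "\<forall>i'\<in>insert i I. of_bool (i' = i) = (\<Sum>k\<in>K. a k * z k i')"
    using insert.prems(3)[of "\<lambda>i'. of_bool (i' = i)"] by blast
  have "(\<Sum>k\<in>K. a k * z k i) \<noteq> 0" using a by simp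
  then obtain k0 where k0: "k0 \<in> K" "z k0 i \<noteq> 0"
    by (metis (no_types, lifting) mult_zero_right sum.neutral)
  define K' where "K' = K - {k0}"
  define z' where "z' k i' = z k i' - z k i / z k0 i * z k0 i'" for k i'
  have finK: "finite K'" "k0 \<notin> K'" "K = insert k0 K'" using insert.prems(1) k0 by (auto simp: K'_def)
  have red: "(\<Sum>k\<in>K. b k * z k i') =
      (\<Sum>k\<in>K'. b k * z' k i') + (\<Sum>k\<in>K. b k * z k i) / z k0 i * z k0 i'" for b i'
  proof -
    have "(\<Sum>k\<in>K'. b k * z' k i') =
        (\<Sum>k\<in>K'. b k * z k i') - (\<Sum>k\<in>K'. b k * z k i) * (z k0 i' / z k0 i)"
      by (simp add: z'_def right_diff_distrib sum_subtractf sum_distrib_right sum_divide_distrib mult.assoc)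
    then show ?thesis
      using finK(1,2) k0(2) unfolding finK(3) by (simp add: field_simps)
  qed
  have K': "c k = 0" if "k \<in> K'" for k
  proof (rule insert.IH[of K' z' c])
    show "finite K'" by (fact finK)
    show "card K' \<le> card I" using insert.prems(2) insert.hyps finK by simp
    show "\<exists>c. \<forall>i\<in>I. u i = (\<Sum>k\<in>K'. c k * z' k i)" for u
    proof -
      obtain b where b: "\<forall>i'\<in>insert i I. (u(i := 0)) i' = (\<Sum>k\<in>K. b k * z k i')"
        using insert.prems(3)[of "u(i := 0)"] by blast
      have b0: "(\<Sum>k\<in>K. b k * z k i) = 0" using b by auto
      have "u i' = (\<Sum>k\<in>K'. b k * z' k i')" if "i' \<in> I" for i'
      proof -
        have "u i' = (u(i := 0)) i'" using that insert.hyps by auto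
        also have "\<dots> = (\<Sum>k\<in>K. b k * z k i')" using b that by blast
        finally show ?thesis using red[of b i'] b0 by simp
      qed
      then show ?thesis by blast
    qed
    show "(\<Sum>k\<in>K'. c k * z' k i') = 0" if "i' \<in> I" for i'
      using red[of c i'] insert.prems(4)[of i'] insert.prems(4)[of i] that by simp
    show "k \<in> K'" by fact
  qed
  have "(\<Sum>k\<in>K. c k * z k i) = c k0 * z k0 i"
    using finK(1,2) K' unfolding finK(3) by simp
  then have "c k0 = 0" using insert.prems(4)[of i] k0 by simp
  then show ?case using K' insert.prems(5) finK(3) by auto
qed

text \<open>A family that is too small stays spanning and small enough after a zero vector, with
  index \<open>None\<close>, is adjoined; but a family containing zero is dependent.\<close>

lemma card_le_spanning_family:
  fixes z :: "'j \<Rightarrow> 'i \<Rightarrow> 'k::field"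
  assumes "finite I" "finite K"
    and span: "\<And>u. \<exists>c. \<forall>i\<in>I. u i = (\<Sum>k\<in>K. c k * z k i)"
  shows "card I \<le> card K"
proof (rule ccontr)
  assume "\<not> ?thesis"
  then have "Suc (card K) \<le> card I" by simp
  moreover have "card (insert None (Some ` K)) = Suc (card K)"
    using assms(2) by (simp add: card_image)
  ultimately have le: "card (insert None (Some ` K)) \<le> card I" by simp
  define c :: "'j option \<Rightarrow> 'k" where "c k = (if k = None then 1 else 0)" for k
  have "c None = 0"
  proof (rule spanning_family_independent[OF assms(1) _ le])
    show "\<exists>c. \<forall>i\<in>I. u i = (\<Sum>k\<in>insert None (Some ` K). c k * (case k of None \<Rightarrow> 0 | Some k' \<Rightarrow> z k' i))" for u
    proof -
      obtain c where "\<forall>i\<in>I. u i = (\<Sum>k\<in>K. c k * z k i)" using span by blast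
      then show ?thesis using assms(2)
        by (intro exI[of _ "\<lambda>k. case k of None \<Rightarrow> 0 | Some k' \<Rightarrow> c k'"]) (simp add: sum.reindex)
    qed
  qed (use assms(2) in \<open>auto simp: sum.reindex c_def\<close>)
  then show False by (simp add: c_def)
qed

text \<open>Gaussian elimination with cleared denominators; the witness \<open>P\<close> is the product of the
  pivots, so no determinants are needed.\<close>

lemma spanning_selection:
  fixes z :: "'j \<Rightarrow> 'x \<Rightarrow> 'i \<Rightarrow> 'k::field" and A :: "('x \<Rightarrow> 'k) set"
  assumes "finite I"
    and const: "\<And>c. (\<lambda>_. c) \<in> A"
    and add: "\<And>P Q. P \<in> A \<Longrightarrow> Q \<in> A \<Longrightarrow> (\<lambda>x. P x + Q x) \<in> A"
    and mult: "\<And>P Q. P \<in> A \<Longrightarrow> Q \<in> A \<Longrightarrow> (\<lambda>x. P x * Q x) \<in> A"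
    and "\<And>j i. j \<in> J \<Longrightarrow> i \<in> I \<Longrightarrow> (\<lambda>x. z j x i) \<in> A"
    and "\<And>u. \<exists>F c. finite F \<and> F \<subseteq> J \<and> (\<forall>i\<in>I. u i = (\<Sum>k\<in>F. c k * z k x0 i))"
  shows "\<exists>C\<subseteq>J. finite C \<and> card C = card I \<and> (\<exists>P\<in>A. P x0 \<noteq> 0 \<and>
    (\<forall>x. P x \<noteq> 0 \<longrightarrow> (\<forall>u. \<exists>c. \<forall>i\<in>I. u i = (\<Sum>k\<in>C. c k * z k x i))))"
  using assms(1,5,6)
proof (induction I arbitrary: J z rule: finite_induct)
  case empty
  show ?case by (rule exI[of _ "{}"]) (auto intro!: bexI[OF _ const[of 1]])
next
  case (insert i I)
  obtain F a where F: "finite F" "F \<subseteq> J"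
    and a: "\<forall>i'\<in>insert i I. of_bool (i' = i) = (\<Sum>k\<in>F. a k * z k x0 i')"
    using insert.prems(2)[of "\<lambda>i'. of_bool (i' = i)"] by blast
  have "(\<Sum>k\<in>F. a k * z k x0 i) \<noteq> 0" using a by simp
  then obtain k0 where "k0 \<in> F" and pivot: "z k0 x0 i \<noteq> 0"
    by (metis (no_types, lifting) mult_zero_right sum.neutral)
  then have k0: "k0 \<in> J" using F by blast
  \<comment> \<open>Cross-multiplied rather than divided by the pivot, so that the entries stay
    inside \<open>A\<close>, which is closed under sums and products only.\<close>
  define z' where "z' k x i' = z k0 x i * z k x i' - z k x i * z k0 x i'" for k x i'
  have "\<exists>C\<subseteq>J - {k0}. finite C \<and> card C = card I \<and> (\<exists>P\<in>A. P x0 \<noteq> 0 \<and>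
    (\<forall>x. P x \<noteq> 0 \<longrightarrow> (\<forall>u. \<exists>c. \<forall>i\<in>I. u i = (\<Sum>k\<in>C. c k * z' k x i))))"
  proof (rule insert.IH)
    fix j i' assume j: "j \<in> J - {k0}" and i': "i' \<in> I"
    have "(\<lambda>x. z k0 x i * z j x i') \<in> A" "(\<lambda>x. z j x i * z k0 x i') \<in> A"
      using j i' k0 by (auto intro!: mult insert.prems(1))
    moreover from this(2) have "(\<lambda>x. - 1 * (z j x i * z k0 x i')) \<in> A" by (rule mult[OF const])
    ultimately have "(\<lambda>x. z k0 x i * z j x i' + - 1 * (z j x i * z k0 x i')) \<in> A"
      using add[of "\<lambda>x. z k0 x i * z j x i'" "\<lambda>x. - 1 * (z j x i * z k0 x i')"] by blast
    then show "(\<lambda>x. z' j x i') \<in> A" by (simp add: z'_def)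
  next
    fix u :: "'i \<Rightarrow> 'k"
    obtain F c where F: "finite F" "F \<subseteq> J"
      and c: "\<forall>i'\<in>insert i I. (u(i := 0)) i' = (\<Sum>k\<in>F. c k * z k x0 i')"
      using insert.prems(2)[of "u(i := 0)"] by blast
    have c0: "(\<Sum>k\<in>F. c k * z k x0 i) = 0" using c by auto
    have "u i' = (\<Sum>k\<in>F - {k0}. c k / z k0 x0 i * z' k x0 i')" if "i' \<in> I" for i'
    proof -
      have "(\<Sum>k\<in>F - {k0}. c k / z k0 x0 i * z' k x0 i') = (\<Sum>k\<in>F. c k / z k0 x0 i * z' k x0 i')"
        using F by (intro sum.mono_neutral_left) (auto simp: z'_def)
      also have "\<dots> = (\<Sum>k\<in>F. c k * z k x0 i') - (\<Sum>k\<in>F. c k * z k x0 i) * (z k0 x0 i' / z k0 x0 i)"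
        unfolding sum_distrib_right sum_subtractf[symmetric]
        using pivot by (intro sum.cong) (auto simp: z'_def field_simps)
      also have "\<dots> = (u(i := 0)) i'" unfolding c0 using c that by simp
      finally show ?thesis using that insert.hyps by auto
    qed
    then show "\<exists>F c. finite F \<and> F \<subseteq> J - {k0} \<and> (\<forall>i\<in>I. u i = (\<Sum>k\<in>F. c k * z' k x0 i))"
      using F by (intro exI[of _ "F - {k0}"] exI[of _ "\<lambda>k. c k / z k0 x0 i"]) auto
  qed
  then obtain C P where C: "C \<subseteq> J - {k0}" "finite C" "card C = card I" and P: "P \<in> A" "P x0 \<noteq> 0"
    and sp: "\<And>x u. P x \<noteq> 0 \<Longrightarrow> \<exists>c. \<forall>i\<in>I. u i = (\<Sum>k\<in>C. c k * z' k x i)"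
    by blast
  have k0C: "k0 \<notin> C" using C by blast
  have spanning: "\<exists>c. \<forall>i'\<in>insert i I. u i' = (\<Sum>k\<in>insert k0 C. c k * z k x i')"
    if nz: "z k0 x i * P x \<noteq> 0" for x u
  proof -
    have nz': "z k0 x i \<noteq> 0" "P x \<noteq> 0" using nz by auto
    obtain c where c: "\<forall>i'\<in>I. u i' - u i / z k0 x i * z k0 x i' = (\<Sum>k\<in>C. c k * z' k x i')"
      using sp[OF nz'(2), of "\<lambda>i'. u i' - u i / z k0 x i * z k0 x i'"] by blast
    define b where "b k = (if k = k0 then u i / z k0 x i - (\<Sum>k\<in>C. c k * z k x i) else c k * z k0 x i)" for k
    have b: "(\<Sum>k\<in>insert k0 C. b k * z k x i') =
        u i / z k0 x i * z k0 x i' + (\<Sum>k\<in>C. c k * z' k x i')" for i'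
    proof -
      have "(\<Sum>k\<in>C. b k * z k x i') = (\<Sum>k\<in>C. c k * z k0 x i * z k x i')"
        using k0C by (intro sum.cong) (auto simp: b_def)
      then show ?thesis using C(2) k0C
        by (simp add: b_def z'_def algebra_simps sum_subtractf sum_distrib_left sum_distrib_right)
    qed
    have "(\<Sum>k\<in>C. c k * z' k x i) = 0" by (simp add: z'_def)
    then have "u i' = (\<Sum>k\<in>insert k0 C. b k * z k x i')" if "i' \<in> insert i I" for i'
      unfolding b using that c nz' by (cases "i' = i") (auto simp: eq_diff_eq diff_eq_eq)
    then show ?thesis by blast
  qed
  have "(\<lambda>x. z k0 x i * P x) \<in> A" using P(1) k0 by (intro mult insert.prems(1)) auto
  moreover have "z k0 x0 i * P x0 \<noteq> 0" using pivot P(2) by simp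
  ultimately have "\<exists>P\<in>A. P x0 \<noteq> 0 \<and>
      (\<forall>x. P x \<noteq> 0 \<longrightarrow> (\<forall>u. \<exists>c. \<forall>i'\<in>insert i I. u i' = (\<Sum>k\<in>insert k0 C. c k * z k x i')))"
    using spanning by (intro bexI[of _ "\<lambda>x. z k0 x i * P x"]) blast+
  moreover have "insert k0 C \<subseteq> J" "finite (insert k0 C)" "card (insert k0 C) = card (insert i I)"
    using C k0 k0C insert.hyps by auto
  ultimately show ?case by blast
qed

section \<open>Tableaux of strips as lattice words\<close>

lemma conj_part_eq_length_filter:
  "conj_part \<nu> x = (if x = 0 then 0 else length (filter (\<lambda>h. x \<le> h) \<nu>))"
proof (cases "x = 0")
  case False
  then have "{j. (x, j) \<in> diagram \<nu>} = Suc ` {i. i < length \<nu> \<and> x \<le> \<nu> ! i}"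
  proof (intro Set.set_eqI)
    fix j show "j \<in> {j. (x, j) \<in> diagram \<nu>} \<longleftrightarrow> j \<in> Suc ` {i. i < length \<nu> \<and> x \<le> \<nu> ! i}"
      using False by (cases j) (auto simp: diagram_def)
  qed
  then show ?thesis using False
    by (simp add: conj_part_def length_filter_conv_card card_image)
qed (simp add: conj_part_def diagram_def)

lemma partition_nth_pos:
  assumes "is_partition \<nu>" "j < length \<nu>"
  shows "1 \<le> \<nu> ! j"
proof -
  have "\<nu> ! j \<in> set \<nu>" using assms(2) by simp
  then have "\<nu> ! j \<noteq> 0" using assms(1) unfolding is_partition_def by metis
  then show ?thesis by simp
qed

lemma conj_part_rev_sort: "conj_part (rev (sort xs)) x = conj_part xs x"
proof -
  have "mset (filter ((\<le>) x) (rev (sort xs))) = mset (filter ((\<le>) x) xs)" by (simp add: mset_filter)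
  then have "length (filter ((\<le>) x) (rev (sort xs))) = length (filter ((\<le>) x) xs)" by (rule mset_eq_length)
  then show ?thesis by (simp add: conj_part_eq_length_filter)
qed

lemma conj_part_append: "conj_part (xs @ ys) x = conj_part xs x + conj_part ys x"
  by (simp add: conj_part_eq_length_filter)

lemma conj_part_antimono: "1 \<le> x \<Longrightarrow> x \<le> y \<Longrightarrow> conj_part \<nu> y \<le> conj_part \<nu> x"
  by (induction \<nu>) (auto simp: conj_part_eq_length_filter)

text \<open>Parts decrease, so the columns of length at least x form an initial segment, and their
  number decides which columns these are. The index j counts from 0.\<close>

lemma le_nth_iff_less_conj_part:
  assumes "is_partition \<nu>" "1 \<le> x"
  shows "j < conj_part \<nu> x \<longleftrightarrow> j < length \<nu> \<and> x \<le> \<nu> ! j"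
proof -
  let ?A = "{i. i < length \<nu> \<and> x \<le> \<nu> ! i}"
  have card: "conj_part \<nu> x = card ?A"
    using assms(2) by (simp add: conj_part_eq_length_filter length_filter_conv_card)
  have down: "i' \<in> ?A" if "i \<in> ?A" "i' \<le> i" for i i'
  proof (cases "i' = i")
    case False
    then have "\<nu> ! i \<le> \<nu> ! i'" using assms(1) that
      by (auto simp: is_partition_def sorted_wrt_iff_nth_less)
    then show ?thesis using that by auto
  qed (use that in simp)
  have fin: "finite ?A" by simp
  show ?thesis
  proof
    assume "j < conj_part \<nu> x"
    show "j < length \<nu> \<and> x \<le> \<nu> ! j"
    proof (rule ccontr)
      assume "\<not> ?thesis"
      then have "?A \<subseteq> {..<j}" using down[of _ j] by (auto simp: not_less[symmetric])
      then have "card ?A \<le> j" using card_mono[of "{..<j}" ?A] by simp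
      then show False using \<open>j < conj_part \<nu> x\<close> card by simp
    qed
  next
    assume "j < length \<nu> \<and> x \<le> \<nu> ! j"
    then have "{..j} \<subseteq> ?A" using down[of j] by auto
    then have "card {..j} \<le> card ?A" by (rule card_mono[OF fin])
    then show "j < conj_part \<nu> x" using card by simp
  qed
qed

lemma mem_diagram_iff:
  assumes "is_partition \<nu>"
  shows "(x, j) \<in> diagram \<nu> \<longleftrightarrow> 1 \<le> x \<and> 1 \<le> j \<and> j \<le> conj_part \<nu> x"
  using le_nth_iff_less_conj_part[OF assms, of x "j - 1"]
  by (auto simp: diagram_def)

lemma partition_eqI:
  assumes "is_partition \<nu>" "is_partition \<mu>" "\<And>x. 1 \<le> x \<Longrightarrow> conj_part \<nu> x = conj_part \<mu> x"
  shows "\<nu> = \<mu>"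
proof -
  have len: "length \<kappa> = conj_part \<kappa> 1" if "is_partition \<kappa>" for \<kappa>
  proof -
    have "filter (\<lambda>h. 1 \<le> h) \<kappa> = \<kappa>" using that
      by (auto simp: is_partition_def filter_id_conv Suc_le_eq intro: gr0I)
    then show ?thesis by (simp add: conj_part_eq_length_filter)
  qed
  have nth: "x \<le> \<nu> ! j \<longleftrightarrow> x \<le> \<mu> ! j" if "1 \<le> x" "j < length \<nu>" "j < length \<mu>" for x j
    using le_nth_iff_less_conj_part[OF assms(1) that(1), of j]
      le_nth_iff_less_conj_part[OF assms(2) that(1), of j] assms(3)[OF that(1)] that by auto
  have l: "length \<nu> = length \<mu>" using len[OF assms(1)] len[OF assms(2)] assms(3)[of 1] by simp
  show ?thesis
  proof (rule nth_equalityI[OF l])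
    fix j assume "j < length \<nu>"
    then have "x \<le> \<nu> ! j \<longleftrightarrow> x \<le> \<mu> ! j" for x using nth[of x j] l by (cases x) auto
    then show "\<nu> ! j = \<mu> ! j" by (metis order_antisym order_refl)
  qed
qed

text \<open>Double counting of the boxes in the first m rows. The right-hand side is the dimension
  of N/p^m N for N of type \<nu>.\<close>

lemma sum_conj_part_eq: "(\<Sum>x=1..m. conj_part \<nu> x) = (\<Sum>h\<leftarrow>\<nu>. min h m)"
proof (induction \<nu>)
  case (Cons h \<nu>)
  have "(\<Sum>x=1..m. of_bool (x \<le> h)) = min h m"
  proof -
    have "{1..m} \<inter> {x. x \<le> h} = {1..min h m}" by auto
    then show ?thesis by (simp add: sum_of_bool_eq)
  qed
  moreover have "conj_part (h # \<nu>) x = of_bool (x \<le> h) + conj_part \<nu> x" if "x \<in> {1..m}" for x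
    using that by (simp add: conj_part_eq_length_filter)
  ultimately show ?case using Cons by (simp add: sum.distrib)
qed (simp add: conj_part_eq_length_filter)

lemma sum_conj_part_tableau_union:
  "(\<Sum>x=1..m. conj_part (tableau_union \<Gamma> \<Delta> l) x) =
    (\<Sum>x=1..m. conj_part (\<Gamma> l) x) + (\<Sum>x=1..m. conj_part (\<Delta> l) x)"
  by (simp add: tableau_union_def conj_part_rev_sort conj_part_append sum.distrib)

lemma sum_conj_part_column_tableau:
  "(\<Sum>x=1..m. conj_part (column_tableau e f n l) x) = min (n - card {x \<in> {e..f}. l < x}) m"
  unfolding sum_conj_part_eq by (simp add: column_tableau_def Let_def)

lemma min_exchange:
  fixes n n' h h' m :: nat
  assumes "h \<le> h'" "h' \<le> n'" "n' < n"
  shows "min (n - h) m + min (n' - h') m \<le> min (n - h') m + min (n' - h) m"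
  using assms by linarith

text \<open>The truncation at \<open>m\<close> is concave, and a move replaces the two heights by two heights
  with the same sum lying between them.\<close>

lemma increasing_box_move_dom_le:
  assumes "increasing_box_move \<alpha> \<beta> \<gamma> \<Gamma> \<Gamma>'"
  shows "dom_le \<Gamma> \<Gamma>'"
  unfolding dom_le_def
proof (intro allI impI)
  fix l m :: nat
  obtain \<Delta> e f e' f' n n' where v: "valid_column e f n" "valid_column e' f' n'"
      "valid_column e' f' n" "valid_column e f n'"
    and c: "n > n'" "1 \<le> e" "e \<le> f" "e < e'" "f < f'" "f + e' = f' + e"
    and \<Gamma>: "\<Gamma> = tableau_union (tableau_union \<Delta> (column_tableau e f n)) (column_tableau e' f' n')"
    and \<Gamma>': "\<Gamma>' = tableau_union (tableau_union \<Delta> (column_tableau e' f' n)) (column_tableau e f n')"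
    using assms unfolding increasing_box_move_def by blast
  \<comment> \<open>The two intervals have equal length and the second starts higher, so at least as
    many of its elements exceed l; this is the source of \<open>h \<le> h'\<close>.\<close>
  define h h' where "h = card {x \<in> {e..f}. l < x}" and "h' = card {x \<in> {e'..f'}. l < x}"
  have card: "card {x \<in> {a..b}. l < x} = (if l < a then Suc b - a else b - l)" if "a \<le> b" for a b
  proof -
    have "{x \<in> {a..b}. l < x} = (if l < a then {a..b} else {Suc l..b})" by auto
    then show ?thesis by simp
  qed
  have "h = (if l < e then Suc f - e else f - l)" "h' = (if l < e' then Suc f' - e' else f' - l)"
    using card[of e f] card[of e' f'] c by (simp_all add: h_def h'_def)
  moreover have "Suc f' - e' \<le> n'" using v(2) c by (auto simp: valid_column_def)
  ultimately have hh': "h \<le> h'" and h'n': "h' \<le> n'" using c by (auto split: if_splits)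
  show "(\<Sum>i=1..m. conj_part (\<Gamma> l) i) \<le> (\<Sum>i=1..m. conj_part (\<Gamma>' l) i)"
    unfolding \<Gamma> \<Gamma>' sum_conj_part_tableau_union sum_conj_part_column_tableau
      h_def[symmetric] h'_def[symmetric]
    using min_exchange[OF hh' h'n', of n m] c(1) by linarith
qed

section \<open>Translation between tableaux of strips and words\<close>

text \<open>The box of row x is missing from level l exactly while l is below its entry. Being 0 in
  the nonexistent row 0 matters because \<open>tally\<close> counts from there.\<close>

definition encodes :: "nat list \<Rightarrow> (nat \<Rightarrow> nat) \<Rightarrow> tableau \<Rightarrow> bool" where
  "encodes \<beta> w \<Gamma> \<longleftrightarrow> w 0 = 0 \<and>
    (\<forall>l. \<forall>x\<ge>1. conj_part (\<Gamma> l) x + of_bool (l < w x) = conj_part \<beta> x)"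

text \<open>A box at the end of row x is a corner of the diagram of \<beta> when the next row is
  shorter.\<close>

definition corner_word :: "nat list \<Rightarrow> (nat \<Rightarrow> nat) \<Rightarrow> bool" where
  "corner_word \<beta> w \<longleftrightarrow> w 0 = 0 \<and> (\<forall>x. 0 < w x \<longrightarrow> conj_part \<beta> (Suc x) < conj_part \<beta> x)"

definition has_content :: "nat list \<Rightarrow> (nat \<Rightarrow> nat) \<Rightarrow> bool" where
  "has_content \<alpha> w \<longleftrightarrow> (\<forall>e\<ge>1. card {x. w x = e} = conj_part \<alpha> e)"

lemma sum_conj_part_encodes:
  assumes "encodes \<beta> w \<Gamma>"
  shows "(\<Sum>i=1..m. conj_part (\<Gamma> l) i) + tally w m {l<..} = (\<Sum>i=1..m. conj_part \<beta> i)"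
proof (induction m)
  case 0
  then show ?case using assms by (simp add: encodes_def tally_0)
next
  case (Suc m)
  have "conj_part (\<Gamma> l) (Suc m) + of_bool (l < w (Suc m)) = conj_part \<beta> (Suc m)"
    using assms unfolding encodes_def by simp
  then show ?case using Suc by (simp add: tally_Suc)
qed

text \<open>The boxes missing from the first m rows at level l are those with entry above l. Passing
  to this complement in \<beta> reverses the inequality.\<close>

lemma dom_le_iff_tally:
  assumes "encodes \<beta> w \<Gamma>" "encodes \<beta> v \<Gamma>'"
  shows "dom_le \<Gamma> \<Gamma>' \<longleftrightarrow> (\<forall>m l. tally v m {l<..} \<le> tally w m {l<..})"
proof -
  have "tally v m {l<..} \<le> tally w m {l<..} \<longleftrightarrow>
      (\<Sum>i=1..m. conj_part (\<Gamma> l) i) \<le> (\<Sum>i=1..m. conj_part (\<Gamma>' l) i)" for m l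
    using sum_conj_part_encodes[OF assms(1), of l m] sum_conj_part_encodes[OF assms(2), of l m]
    by linarith
  moreover have "tally v 0 {l<..} \<le> tally w 0 {l<..}" for l
    using assms by (simp add: encodes_def tally_0)
  ultimately have "(\<forall>m l. tally v m {l<..} \<le> tally w m {l<..}) \<longleftrightarrow>
      (\<forall>m l. (\<Sum>i=1..m. conj_part (\<Gamma> l) i) \<le> (\<Sum>i=1..m. conj_part (\<Gamma>' l) i))" by blast
  also have "\<dots> \<longleftrightarrow> dom_le \<Gamma> \<Gamma>'" unfolding dom_le_def
  proof (intro iffI allI impI)
    fix m l
    assume *: "\<forall>l. \<forall>m\<ge>1. (\<Sum>i=1..m. conj_part (\<Gamma> l) i) \<le> (\<Sum>i=1..m. conj_part (\<Gamma>' l) i)"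
    show "(\<Sum>i=1..m. conj_part (\<Gamma> l) i) \<le> (\<Sum>i=1..m. conj_part (\<Gamma>' l) i)"
    proof (cases "m = 0")
      case False
      then have "1 \<le> m" by simp
      then show ?thesis using * by blast
    qed simp
  qed blast
  finally show ?thesis by blast
qed

lemma corner_word_finite: "corner_word \<beta> w \<Longrightarrow> \<exists>M. \<forall>x>M. w x = 0"
proof -
  assume c: "corner_word \<beta> w"
  have "w x = 0" if "x > Max (insert 0 (set \<beta>))" for x
  proof -
    have "filter (\<lambda>h. x \<le> h) \<beta> = []" using that by (auto simp: filter_empty_conv)
    then have "conj_part \<beta> x = 0" by (simp add: conj_part_eq_length_filter)
    then have "\<not> conj_part \<beta> (Suc x) < conj_part \<beta> x" by simp
    then show ?thesis using c unfolding corner_word_def by blast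
  qed
  then show ?thesis by blast
qed

lemma card_row_skew:
  assumes "is_partition \<beta>" "is_partition \<gamma>" "diagram \<gamma> \<subseteq> diagram \<beta>" "1 \<le> x"
  shows "card {j. (x, j) \<in> skew \<beta> \<gamma>} = conj_part \<beta> x - conj_part \<gamma> x"
proof -
  have "{j. (x, j) \<in> skew \<beta> \<gamma>} = {conj_part \<gamma> x<..conj_part \<beta> x}"
    using assms by (auto simp: skew_def mem_diagram_iff)
  then show ?thesis by simp
qed

lemma conj_part_mono: "diagram \<gamma> \<subseteq> diagram \<beta> \<Longrightarrow> conj_part \<gamma> x \<le> conj_part \<beta> x"
proof -
  assume "diagram \<gamma> \<subseteq> diagram \<beta>"
  moreover have "finite {j. (x, j) \<in> diagram \<beta>}"
    by (rule finite_subset[of _ "{..length \<beta>}"]) (auto simp: diagram_def)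
  ultimately show ?thesis unfolding conj_part_def by (intro card_mono) auto
qed

text \<open>If the next row were equally long, the last column of row x would contain boxes of the
  strip in both rows.\<close>

lemma strip_corner:
  assumes \<beta>: "is_partition \<beta>" and \<gamma>: "is_partition \<gamma>" and hv: "horizontal_vertical_strip \<beta> \<gamma>"
    and x: "1 \<le> x" "conj_part \<gamma> x < conj_part \<beta> x"
  shows "conj_part \<beta> (Suc x) < conj_part \<beta> x"
proof (rule ccontr)
  assume neg: "\<not> ?thesis"
  define j where "j = conj_part \<beta> x"
  have "conj_part \<gamma> (Suc x) \<le> conj_part \<gamma> x" using x by (intro conj_part_antimono) auto
  then have "{x, Suc x} \<subseteq> {i. (i, j) \<in> skew \<beta> \<gamma>}"
    using x neg by (auto simp: skew_def mem_diagram_iff \<beta> \<gamma> j_def)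
  moreover have "finite {i. (i, j) \<in> skew \<beta> \<gamma>}"
    by (rule finite_subset[of _ "{..\<beta> ! (j - 1)}"]) (auto simp: skew_def diagram_def)
  ultimately have "card {x, Suc x} \<le> card {i. (i, j) \<in> skew \<beta> \<gamma>}" by (rule card_mono[rotated])
  moreover have "card {i. (i, j) \<in> skew \<beta> \<gamma>} \<le> 1"
    using hv unfolding horizontal_vertical_strip_def by blast
  ultimately show False by simp
qed

lemma entry_boxes_encodes:
  assumes "encodes \<beta> w \<Gamma>" "\<And>l. is_partition (\<Gamma> l)" "1 \<le> e"
  shows "entry_boxes \<Gamma> e = {(x, j). w x = e \<and> j = conj_part \<beta> x}"
proof (rule Set.set_eqI)
  fix xj :: "nat \<times> nat"
  obtain x j where xj: "xj = (x, j)" by (cases xj)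
  have eq: "conj_part (\<Gamma> l) x + of_bool (l < w x) = conj_part \<beta> x" if "1 \<le> x" for l
    using assms(1) that unfolding encodes_def by blast
  show "xj \<in> entry_boxes \<Gamma> e \<longleftrightarrow> xj \<in> {(x, j). w x = e \<and> j = conj_part \<beta> x}"
  proof (cases "1 \<le> x")
    case True
    have "conj_part (\<Gamma> (e - 1)) x < j \<and> 1 \<le> j \<and> j \<le> conj_part (\<Gamma> e) x \<longleftrightarrow> w x = e \<and> j = conj_part \<beta> x"
      using eq[OF True, of e] eq[OF True, of "e - 1"] assms(3)
      by (cases "e < w x"; cases "e - 1 < w x") auto
    then show ?thesis using True by (auto simp: xj entry_boxes_def mem_diagram_iff assms(2))
  next
    case False
    then have "x = 0" by simp
    then show ?thesis using assms(1,3) by (auto simp: xj entry_boxes_def diagram_def encodes_def)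
  qed
qed

lemma card_entry_boxes_right:
  assumes "encodes \<beta> w \<Gamma>" "\<And>l. is_partition (\<Gamma> l)" "1 \<le> e"
  shows "card {(i, j) \<in> entry_boxes \<Gamma> e. c < j} = card {x. w x = e \<and> c < conj_part \<beta> x}"
proof -
  have "{(i, j) \<in> entry_boxes \<Gamma> e. c < j} =
      (\<lambda>x. (x, conj_part \<beta> x)) ` {x. w x = e \<and> c < conj_part \<beta> x}"
    by (auto simp: entry_boxes_encodes[OF assms])
  then show ?thesis by (simp add: card_image inj_on_def)
qed

lemma card_entry_boxes:
  assumes "encodes \<beta> w \<Gamma>" "\<And>l. is_partition (\<Gamma> l)" "1 \<le> e"
  shows "card (entry_boxes \<Gamma> e) = card {x. w x = e}"
proof -
  have "entry_boxes \<Gamma> e = (\<lambda>x. (x, conj_part \<beta> x)) ` {x. w x = e}"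
    by (auto simp: entry_boxes_encodes[OF assms])
  then show ?thesis by (simp add: card_image inj_on_def)
qed

text \<open>Boxes at corners move strictly to the left as the row increases, so those to the right
  of a column fill an initial segment of rows. The column with number
  \<open>conj_part \<beta> (Suc m)\<close> makes this segment end at row m.\<close>

lemma right_of_column_iff:
  assumes c: "corner_word \<beta> w" and "1 \<le> e"
  shows "{x. w x = e \<and> conj_part \<beta> (Suc m) < conj_part \<beta> x} = {x. x \<le> m \<and> w x \<in> {e}}"
proof (intro equalityI subsetI)
  fix x assume x: "x \<in> {x. w x = e \<and> conj_part \<beta> (Suc m) < conj_part \<beta> x}"
  then have "x \<le> m" using conj_part_antimono[of "Suc m" x \<beta>] by (cases "x \<le> m") auto
  then show "x \<in> {x. x \<le> m \<and> w x \<in> {e}}" using x by simp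
next
  fix x assume "x \<in> {x. x \<le> m \<and> w x \<in> {e}}"
  then have x: "x \<le> m" "e = w x" by auto
  have "conj_part \<beta> (Suc m) \<le> conj_part \<beta> (Suc x)" using x by (intro conj_part_antimono) auto
  also have "\<dots> < conj_part \<beta> x" using c x assms(2) unfolding corner_word_def by simp
  finally show "x \<in> {x. w x = e \<and> conj_part \<beta> (Suc m) < conj_part \<beta> x}" using x by simp
qed

lemma LR_tableau_word:
  assumes \<beta>: "is_partition \<beta>" and \<gamma>: "is_partition \<gamma>" and hv: "horizontal_vertical_strip \<beta> \<gamma>"
    and LR: "LR_tableau \<alpha> \<beta> \<gamma> \<Gamma>"
  obtains w where "encodes \<beta> w \<Gamma>" "corner_word \<beta> w" "ballot w" "has_content \<alpha> w"
proof -
  have part: "is_partition (\<Gamma> l)" for l using LR by (auto simp: LR_tableau_def is_tableau_def)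
  have mono1: "conj_part (\<Gamma> l) x \<le> conj_part (\<Gamma> (Suc l)) x" for l x
    using LR by (auto simp: LR_tableau_def is_tableau_def intro: conj_part_mono)
  have mono: "conj_part (\<Gamma> l) x \<le> conj_part (\<Gamma> l') x" if "l \<le> l'" for l l' x
    using lift_Suc_mono_le[of "\<lambda>l. conj_part (\<Gamma> l) x", OF mono1 that] .
  obtain s where s: "\<And>l. s \<le> l \<Longrightarrow> \<Gamma> l = \<beta>" using LR unfolding LR_tableau_def by blast
  have ub: "conj_part (\<Gamma> l) x \<le> conj_part \<beta> x" for l x
    using mono[of l "max l s" x] s[of "max l s"] by simp
  have \<Gamma>0: "\<Gamma> 0 = \<gamma>" using LR by (simp add: LR_tableau_def)
  have lb: "conj_part \<beta> x \<le> Suc (conj_part (\<Gamma> l) x)" if "1 \<le> x" for l x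
  proof -
    have "conj_part \<beta> x - conj_part \<gamma> x \<le> 1"
    proof -
      have "diagram \<gamma> \<subseteq> diagram \<beta>" "card {j. (x, j) \<in> skew \<beta> \<gamma>} \<le> 1"
        using hv unfolding horizontal_vertical_strip_def by blast+
      then show ?thesis using card_row_skew[OF \<beta> \<gamma> _ that] by simp
    qed
    then show ?thesis using mono[of 0 l x] \<Gamma>0 by simp
  qed
  \<comment> \<open>The entry of row x is the level at which the row reaches its final length; for a
    row without a box this is 0.\<close>
  define w where "w x = (if x = 0 then 0 else LEAST l. conj_part (\<Gamma> l) x = conj_part \<beta> x)" for x
  have lt: "l < w x \<longleftrightarrow> conj_part (\<Gamma> l) x \<noteq> conj_part \<beta> x" if "1 \<le> x" for l x
  proof
    assume "l < w x"
    then show "conj_part (\<Gamma> l) x \<noteq> conj_part \<beta> x"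
      using that not_less_Least[of l] unfolding w_def by auto
  next
    assume ne: "conj_part (\<Gamma> l) x \<noteq> conj_part \<beta> x"
    have "conj_part (\<Gamma> (w x)) x = conj_part \<beta> x"
      using that s[of s] LeastI[of "\<lambda>l. conj_part (\<Gamma> l) x = conj_part \<beta> x" s] unfolding w_def by simp
    then show "l < w x" using ne mono[of "w x" l x] ub[of l x] by (cases "w x \<le> l") auto
  qed
  have enc: "encodes \<beta> w \<Gamma>"
    unfolding encodes_def
  proof (intro conjI allI impI)
    fix l x :: nat assume "1 \<le> x"
    then show "conj_part (\<Gamma> l) x + of_bool (l < w x) = conj_part \<beta> x"
      using lt[of x l] lb[of x l] ub[of l x] by (auto)
  qed (simp add: w_def)
  have corner: "corner_word \<beta> w"
    unfolding corner_word_def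
  proof (intro conjI allI impI)
    fix x assume "0 < w x"
    then have "1 \<le> x" "conj_part (\<Gamma> 0) x \<noteq> conj_part \<beta> x"
      using lt[of x 0] by (auto simp: w_def split: if_splits)
    then show "conj_part \<beta> (Suc x) < conj_part \<beta> x"
      using strip_corner[OF \<beta> \<gamma> hv, of x] ub[of 0 x] \<Gamma>0 by simp
  qed (simp add: w_def)
  have "ballot w" unfolding ballot_def
  proof (intro allI impI)
    fix m e :: nat assume e: "1 \<le> e"
    have "card {(i, j) \<in> entry_boxes \<Gamma> (Suc e). conj_part \<beta> (Suc m) < j}
        \<le> card {(i, j) \<in> entry_boxes \<Gamma> e. conj_part \<beta> (Suc m) < j}"
      using LR e unfolding LR_tableau_def by blast
    then show "tally w m {Suc e} \<le> tally w m {e}"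
      using e by (simp add: card_entry_boxes_right[OF enc part] right_of_column_iff[OF corner] tally_def)
  qed
  moreover have "has_content \<alpha> w"
    using LR card_entry_boxes[OF enc part] unfolding has_content_def LR_tableau_def by simp
  ultimately show ?thesis using that enc corner by blast
qed

lemma encodes_unique:
  assumes "encodes \<beta> w \<Gamma>" "encodes \<beta> w \<Gamma>'" "\<And>l. is_partition (\<Gamma> l)" "\<And>l. is_partition (\<Gamma>' l)"
  shows "\<Gamma> = \<Gamma>'"
proof
  fix l
  show "\<Gamma> l = \<Gamma>' l"
  proof (rule partition_eqI[OF assms(3,4)])
    fix x :: nat assume "1 \<le> x"
    then have "conj_part (\<Gamma> l) x + of_bool (l < w x) = conj_part (\<Gamma>' l) x + of_bool (l < w x)"
      using assms(1,2) unfolding encodes_def by simp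
    then show "conj_part (\<Gamma> l) x = conj_part (\<Gamma>' l) x" by simp
  qed
qed

lemma word_LR_tableau:
  assumes \<beta>: "is_partition \<beta>" and part: "\<And>l. is_partition (\<Gamma> l)"
    and enc: "encodes \<beta> w \<Gamma>" and corner: "corner_word \<beta> w" and bal: "ballot w"
    and cont: "has_content \<alpha> w"
  shows "LR_tableau \<alpha> \<beta> (\<Gamma> 0) \<Gamma>"
proof -
  note boxes = entry_boxes_encodes[OF enc part]
  have eq: "conj_part (\<Gamma> l) x + of_bool (l < w x) = conj_part \<beta> x" if "1 \<le> x" for l x
    using enc that unfolding encodes_def by blast
  obtain M where M: "\<And>x. M < x \<Longrightarrow> w x = 0" using corner_word_finite[OF corner] by blast
  define s where "s = Max (w ` {..M})"
  have "w x \<le> s" for x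
    using M[of x] unfolding s_def by (cases "x \<le> M") auto
  then have ws: "\<not> l < w x" if "s \<le> l" for l x using that le_trans not_less by blast
  have lim: "\<Gamma> l = \<beta>" if "s \<le> l" for l
    using eq[of _ l] ws[OF that] by (intro partition_eqI[OF part \<beta>]) simp
  have sub: "diagram (\<Gamma> l) \<subseteq> diagram (\<Gamma> (Suc l))" for l
  proof -
    have le: "conj_part (\<Gamma> l) x \<le> conj_part (\<Gamma> (Suc l)) x" if "1 \<le> x" for x
      using eq[OF that, of l] eq[OF that, of "Suc l"] by (cases "l < w x"; cases "Suc l < w x") auto
    then show ?thesis
    proof (intro subrelI)
      fix x j assume "(x, j) \<in> diagram (\<Gamma> l)"
      then show "(x, j) \<in> diagram (\<Gamma> (Suc l))"
        using le[of x] unfolding mem_diagram_iff[OF part] by linarith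
    qed
  qed
  have cols: "x = x'" if "0 < w x" "0 < w x'" "conj_part \<beta> x = conj_part \<beta> x'" for x x'
  proof -
    have "\<not> y < y'" if "conj_part \<beta> y = conj_part \<beta> y'" "0 < w y" for y y'
    proof -
      have "conj_part \<beta> (Suc y) < conj_part \<beta> y"
        using corner that unfolding corner_word_def by blast
      then have "conj_part \<beta> (Suc y) < conj_part \<beta> y'" by (simp only: that)
      then show ?thesis using conj_part_antimono[of "Suc y" y' \<beta>] by auto
    qed
    from this[of x x'] this[of x' x] show ?thesis using that by auto
  qed
  have lattice: "card {(i, j) \<in> entry_boxes \<Gamma> (Suc e). c < j} \<le> card {(i, j) \<in> entry_boxes \<Gamma> e. c < j}"
    if e: "1 \<le> e" for c e
  proof -
    \<comment> \<open>Here c is an arbitrary column, so the cut is placed at the last row with a box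
      to its right, or at 0 if there is none.\<close>
    define m where "m = Max (insert 0 {x. 0 < w x \<and> c < conj_part \<beta> x})"
    have fin: "finite {x. 0 < w x \<and> c < conj_part \<beta> x}"
    proof (rule finite_subset)
      show "{x. 0 < w x \<and> c < conj_part \<beta> x} \<subseteq> {..M}"
      proof
        fix x assume "x \<in> {x. 0 < w x \<and> c < conj_part \<beta> x}"
        then show "x \<in> {..M}" using M[of x] by (cases "M < x") auto
      qed
    qed simp
    have "x \<le> m \<longleftrightarrow> c < conj_part \<beta> x" if "0 < w x" for x
    proof
      assume "c < conj_part \<beta> x"
      then show "x \<le> m" unfolding m_def using that fin by (intro Max_ge) auto
    next
      assume "x \<le> m"
      have x0: "1 \<le> x" using that corner by (cases x) (auto simp: corner_word_def)
      have "m \<in> insert 0 {x. 0 < w x \<and> c < conj_part \<beta> x}"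
        unfolding m_def using fin by (intro Max_in) auto
      then have "c < conj_part \<beta> m" using x0 \<open>x \<le> m\<close> by auto
      also have "\<dots> \<le> conj_part \<beta> x" by (rule conj_part_antimono[OF x0 \<open>x \<le> m\<close>])
      finally show "c < conj_part \<beta> x" .
    qed
    then have "{x. w x = e' \<and> c < conj_part \<beta> x} = {x. x \<le> m \<and> w x \<in> {e'}}" if "1 \<le> e'" for e'
      using that by auto
    then have "card {(i, j) \<in> entry_boxes \<Gamma> e'. c < j} = tally w m {e'}" if "1 \<le> e'" for e'
      using that by (simp add: card_entry_boxes_right[OF enc part] tally_def)
    then show ?thesis using bal e unfolding ballot_def by simp
  qed
  have "\<forall>l\<ge>s. \<Gamma> l = \<Gamma> s" using lim by simp
  then have "is_tableau \<Gamma>" unfolding is_tableau_def using part sub by blast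
  moreover have "\<exists>s. \<forall>l\<ge>s. \<Gamma> l = \<beta>" using lim by blast
  moreover have "\<forall>e\<ge>1. card (entry_boxes \<Gamma> e) = conj_part \<alpha> e"
    using cont card_entry_boxes[OF enc part] unfolding has_content_def by simp
  moreover have "e < e'" if "1 \<le> e" "1 \<le> e'" "(i, j) \<in> entry_boxes \<Gamma> e"
    "(i', j) \<in> entry_boxes \<Gamma> e'" "i < i'" for i i' j e e'
    using that cols[of i i'] boxes[of e] boxes[of e'] by auto
  moreover have "e \<le> e'" if "1 \<le> e" "1 \<le> e'" "(i, j) \<in> entry_boxes \<Gamma> e"
    "(i, j') \<in> entry_boxes \<Gamma> e'" for i j j' e e'
    using that boxes[of e] boxes[of e'] by auto
  ultimately show ?thesis unfolding LR_tableau_def using lattice by blast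
qed

section \<open>The tableau of a word, column by column\<close>

text \<open>Columns are indexed from 0. Among the columns of one length only the last ends in a
  corner, hence the test on \<open>Suc j\<close>.\<close>

definition box_entry :: "nat list \<Rightarrow> (nat \<Rightarrow> nat) \<Rightarrow> nat \<Rightarrow> nat" where
  "box_entry \<beta> w j = (if Suc j = conj_part \<beta> (\<beta> ! j) then w (\<beta> ! j) else 0)"

definition column_height :: "nat list \<Rightarrow> (nat \<Rightarrow> nat) \<Rightarrow> nat \<Rightarrow> nat \<Rightarrow> nat" where
  "column_height \<beta> w l j = \<beta> ! j - of_bool (l < box_entry \<beta> w j)"

definition tableau_of :: "nat list \<Rightarrow> (nat \<Rightarrow> nat) \<Rightarrow> tableau" where
  "tableau_of \<beta> w l = filter ((<) 0) (map (column_height \<beta> w l) [0..<length \<beta>])"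

lemma corner_column:
  assumes "is_partition \<beta>" "corner_word \<beta> w" "0 < w x"
  shows "conj_part \<beta> x - 1 < length \<beta>" "\<beta> ! (conj_part \<beta> x - 1) = x" "1 \<le> conj_part \<beta> x" "1 \<le> x"
proof -
  show x: "1 \<le> x" using assms by (cases x) (auto simp: corner_word_def)
  have c: "conj_part \<beta> (Suc x) < conj_part \<beta> x" using assms unfolding corner_word_def by blast
  then show 1: "1 \<le> conj_part \<beta> x" by simp
  show "conj_part \<beta> x - 1 < length \<beta>" "\<beta> ! (conj_part \<beta> x - 1) = x"
    using le_nth_iff_less_conj_part[OF assms(1) x, of "conj_part \<beta> x - 1"]
      le_nth_iff_less_conj_part[OF assms(1), of "Suc x" "conj_part \<beta> x - 1"] c by auto
qed

lemma box_entry_corner: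
  assumes "is_partition \<beta>" "corner_word \<beta> w" "0 < w x"
  shows "box_entry \<beta> w (conj_part \<beta> x - 1) = w x"
  using corner_column[OF assms] by (simp add: box_entry_def)

lemma conj_part_tableau_of:
  assumes "1 \<le> x"
  shows "conj_part (tableau_of \<beta> w l) x = (\<Sum>j<length \<beta>. of_bool (x \<le> column_height \<beta> w l j))"
proof -
  have "conj_part (tableau_of \<beta> w l) x = length (filter (\<lambda>h. x \<le> h) (map (column_height \<beta> w l) [0..<length \<beta>]))"
    using assms by (auto simp: conj_part_eq_length_filter tableau_of_def intro!: arg_cong[of _ _ length] filter_cong)
  also have "\<dots> = card {j. j < length \<beta> \<and> x \<le> column_height \<beta> w l j}"
    by (simp add: length_filter_conv_card cong: conj_cong)
  also have "\<dots> = (\<Sum>j<length \<beta>. of_bool (x \<le> column_height \<beta> w l j))"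
  proof -
    have "{..<length \<beta>} \<inter> {j. x \<le> column_height \<beta> w l j} = {j. j < length \<beta> \<and> x \<le> column_height \<beta> w l j}" by auto
    then show ?thesis by (simp add: sum_of_bool_eq)
  qed
  finally show ?thesis .
qed

lemma encodes_tableau_of:
  assumes \<beta>: "is_partition \<beta>" and corner: "corner_word \<beta> w"
  shows "encodes \<beta> w (tableau_of \<beta> w)"
  unfolding encodes_def
proof (intro conjI allI impI)
  fix l x :: nat assume x: "1 \<le> x"
  let ?h = "column_height \<beta> w l"
  \<comment> \<open>The only column whose truncation changes row x is the one that ends at the
    corner of that row.\<close>
  have split: "of_bool (x \<le> \<beta> ! j) = of_bool (x \<le> ?h j) + (of_bool (l < w x \<and> j = conj_part \<beta> x - 1) :: nat)"
    if "j < length \<beta>" for j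
    using corner_column[OF \<beta> corner, of x] x
    by (cases "x = \<beta> ! j") (auto simp: column_height_def box_entry_def)
  have "conj_part \<beta> x = (\<Sum>j<length \<beta>. of_bool (x \<le> \<beta> ! j))"
  proof -
    have "{..<length \<beta>} \<inter> {j. x \<le> \<beta> ! j} = {j. j < length \<beta> \<and> x \<le> \<beta> ! j}" by auto
    then show ?thesis using x by (simp add: conj_part_eq_length_filter length_filter_conv_card sum_of_bool_eq)
  qed
  also have "\<dots> = (\<Sum>j<length \<beta>. of_bool (x \<le> ?h j)) + (\<Sum>j<length \<beta>. of_bool (l < w x \<and> j = conj_part \<beta> x - 1))"
    by (simp add: split sum.distrib)
  also have "(\<Sum>j<length \<beta>. of_bool (l < w x \<and> j = conj_part \<beta> x - 1)) = (of_bool (l < w x) :: nat)"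
    using corner_column[OF \<beta> corner, of x] by (cases "l < w x") (simp_all add: of_bool_def)
  finally show "conj_part (tableau_of \<beta> w l) x + of_bool (l < w x) = conj_part \<beta> x"
    using conj_part_tableau_of[OF x] by simp
qed (use corner in \<open>simp add: corner_word_def\<close>)

text \<open>Among columns of equal length only the last can be shortened; otherwise the lengths
  differ by at least one, which is as much as can be lost.\<close>

lemma column_height_antimono:
  assumes \<beta>: "is_partition \<beta>" and j: "j < j'" "j' < length \<beta>"
  shows "column_height \<beta> w l j' \<le> column_height \<beta> w l j"
proof -
  have ge: "\<beta> ! j' \<le> \<beta> ! j" using assms by (auto simp: is_partition_def sorted_wrt_iff_nth_less)
  show ?thesis
  proof (cases "\<beta> ! j' = \<beta> ! j")
    case True
    have "1 \<le> \<beta> ! j" using partition_nth_pos[OF \<beta>, of j] j by simp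
    then have "j' < conj_part \<beta> (\<beta> ! j)"
      using le_nth_iff_less_conj_part[OF \<beta>, of "\<beta> ! j" j'] True j by simp
    then show ?thesis using True j by (simp add: column_height_def box_entry_def)
  next
    case False
    then show ?thesis using ge by (auto simp: column_height_def)
  qed
qed

lemma is_partition_tableau_of: "is_partition \<beta> \<Longrightarrow> is_partition (tableau_of \<beta> w l)"
proof -
  assume "is_partition \<beta>"
  then have "sorted_wrt (\<ge>) (map (column_height \<beta> w l) [0..<length \<beta>])"
    by (simp add: sorted_wrt_iff_nth_less column_height_antimono)
  then have "sorted_wrt (\<ge>) (tableau_of \<beta> w l)"
    unfolding tableau_of_def by (rule sorted_wrt_filter)
  then show ?thesis by (simp add: is_partition_def tableau_of_def)
qed

lemma is_partition_tableau_union: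
  assumes "0 \<notin> set (\<Gamma> l)" "0 \<notin> set (\<Delta> l)"
  shows "is_partition (tableau_union \<Gamma> \<Delta> l)"
proof -
  have "sorted_wrt (\<le>) (sort (\<Gamma> l @ \<Delta> l))" by simp
  then have "sorted_wrt (\<ge>) (rev (sort (\<Gamma> l @ \<Delta> l)))" by (simp only: sorted_wrt_rev)
  then show ?thesis using assms by (simp add: is_partition_def tableau_union_def)
qed

lemma conj_part_tableau_union:
  "conj_part (tableau_union \<Gamma> \<Delta> l) x = conj_part (\<Gamma> l) x + conj_part (\<Delta> l) x"
  by (simp add: tableau_union_def conj_part_rev_sort conj_part_append)

lemma column_tableau_single:
  assumes "1 \<le> e"
  shows "column_tableau e e n l = (if n - of_bool (l < e) = 0 then [] else [n - of_bool (l < e)])"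
proof -
  have "{x \<in> {e..e}. l < x} = (if l < e then {e} else {})" by auto
  then show ?thesis by (simp add: column_tableau_def Let_def)
qed

lemma conj_part_column_tableau_single:
  "1 \<le> e \<Longrightarrow> 1 \<le> x \<Longrightarrow> conj_part (column_tableau e e n l) x = of_bool (x \<le> n - of_bool (l < e))"
  by (simp add: column_tableau_single conj_part_eq_length_filter)

text \<open>Every column of a strip carries at most one entry a, so it is C(a,a) or, without a box,
  C(1,0). Heights 0 are excluded so that later unions are again partitions.\<close>

lemma union_of_columns_ex:
  assumes \<beta>: "is_partition \<beta>" and "S \<subseteq> {..<length \<beta>}"
  shows "\<exists>\<Delta>. union_of_columns \<Delta> \<and> (\<forall>l. 0 \<notin> set (\<Delta> l)) \<and>
    (\<forall>l. \<forall>x\<ge>1. conj_part (\<Delta> l) x = (\<Sum>j\<in>S. of_bool (x \<le> column_height \<beta> w l j)))"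
proof -
  have "finite S" using assms(2) finite_subset by blast
  then show ?thesis using assms(2)
  proof (induction S rule: finite_induct)
    case empty
    show ?case by (rule exI[of _ "\<lambda>_. []"]) (auto intro: union_of_columns.empty simp: conj_part_eq_length_filter)
  next
    case (insert j S)
    obtain \<Delta> where \<Delta>: "union_of_columns \<Delta>" "\<And>l. 0 \<notin> set (\<Delta> l)"
      "\<And>l x. 1 \<le> x \<Longrightarrow> conj_part (\<Delta> l) x = (\<Sum>j\<in>S. of_bool (x \<le> column_height \<beta> w l j))"
      using insert.IH insert.prems by (meson insert_subset)
    define a where "a = box_entry \<beta> w j"
    define C where "C = (if a = 0 then column_tableau 1 0 (\<beta> ! j) else column_tableau a a (\<beta> ! j))"
    have pos: "1 \<le> \<beta> ! j" using insert.prems partition_nth_pos[OF \<beta>, of j] by simp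
    have C: "C l = (if column_height \<beta> w l j = 0 then [] else [column_height \<beta> w l j])" for l
      using column_tableau_single[of a "\<beta> ! j" l]
      by (auto simp: C_def column_height_def a_def[symmetric] column_tableau_def Let_def)
    have U: "union_of_columns (tableau_union \<Delta> C)"
    proof (cases "a = 0")
      case True
      then show ?thesis unfolding C_def using pos union_of_columns.column[OF \<Delta>(1), of 1 0 "\<beta> ! j"]
        by (simp add: valid_column_def)
    next
      case False
      then show ?thesis unfolding C_def using pos union_of_columns.column[OF \<Delta>(1), of a a "\<beta> ! j"]
        by (simp add: valid_column_def)
    qed
    have "0 \<notin> set (tableau_union \<Delta> C l)" for l
      using \<Delta>(2) C[of l] by (auto simp: tableau_union_def)
    moreover have "conj_part (tableau_union \<Delta> C l) x = (\<Sum>j\<in>insert j S. of_bool (x \<le> column_height \<beta> w l j))"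
      if "1 \<le> x" for l x
    proof -
      have "conj_part (C l) x = of_bool (x \<le> column_height \<beta> w l j)"
        using that by (simp add: C conj_part_eq_length_filter)
      then show ?thesis using insert.hyps
        unfolding conj_part_tableau_union \<Delta>(3)[OF that] by (simp del: sum_of_bool_eq)
    qed
    ultimately show ?case using U by (intro exI[of _ "tableau_union \<Delta> C"]) simp
  qed
qed

section \<open>Exchanges of entries\<close>

text \<open>The clause on the rows between p and j serves the geometric family: it keeps the
  occurrence numbers of all other boxes.\<close>

definition word_exchange :: "(nat \<Rightarrow> nat) \<Rightarrow> (nat \<Rightarrow> nat) \<Rightarrow> bool" where
  "word_exchange w w' \<longleftrightarrow> ballot w \<and> ballot w' \<and>
    (\<exists>p j. p < j \<and> 0 < w j \<and> w j < w p \<and> w' = transpose_word p j w \<and>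
      (\<forall>x. p < x \<longrightarrow> x < j \<longrightarrow> w x \<noteq> w p \<and> w x \<noteq> w j))"

lemma word_exchangeE:
  assumes "word_exchange w w'"
  obtains p j where "ballot w" "ballot w'" "p < j" "0 < w j" "w j < w p" "w' = transpose_word p j w"
    "\<And>x. p < x \<Longrightarrow> x < j \<Longrightarrow> w x \<noteq> w p \<and> w x \<noteq> w j"
  using assms unfolding word_exchange_def by blast

lemma transpose_word_eq_0_iff: "0 < w j \<Longrightarrow> w j < w p \<Longrightarrow> transpose_word p j w x = 0 \<longleftrightarrow> w x = 0"
  by (auto simp: transpose_word_def)

lemma tally_transpose_total: "p < j \<Longrightarrow> j \<le> M \<Longrightarrow> tally (transpose_word p j w) M E = tally w M E"
  using tally_transpose[of p j w M E] by simp

text \<open>The termination measure for sequences of exchanges: the larger entry moves to a later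
  row, which has smaller weight.\<close>

lemma sum_transpose_word:
  assumes "p < j" "j \<le> M" "w j < w p"
  shows "(\<Sum>x\<le>M. (M - x) * transpose_word p j w x) < (\<Sum>x\<le>M. (M - x) * w x)"
proof -
  let ?A = "{..M} - {p} - {j}"
  have split: "(\<Sum>x\<le>M. (M - x) * u x) = (M - p) * u p + ((M - j) * u j + (\<Sum>x\<in>?A. (M - x) * u x))" for u :: "nat \<Rightarrow> nat"
    using assms by (subst sum.remove[of _ p], simp, simp, subst sum.remove[of _ j]) auto
  have "(M - p) * w j + (M - j) * w p < (M - p) * w p + (M - j) * w j"
  proof -
    obtain a b where "M - p = M - j + a" "0 < a" "w p = w j + b" "0 < b"
      using assms by (metis add_diff_inverse_nat diff_less_mono2 le_add_diff_inverse less_imp_le_nat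
          not_less order_less_le_trans zero_less_diff)
    then show ?thesis by (simp add: algebra_simps)
  qed
  moreover have "(\<Sum>x\<in>?A. (M - x) * transpose_word p j w x) = (\<Sum>x\<in>?A. (M - x) * w x)"
    by (rule sum.cong) (auto simp: transpose_word_def)
  moreover have "transpose_word p j w p = w j" "transpose_word p j w j = w p"
    using assms by (auto simp: transpose_word_def)
  ultimately show ?thesis unfolding split by simp
qed

lemma word_exchanges:
  assumes "ballot w" "ballot v"
    and "\<And>x. w x = 0 \<longleftrightarrow> v x = 0" and "\<And>x. M < x \<Longrightarrow> w x = 0"
    and "\<And>E. 0 \<notin> E \<Longrightarrow> tally w M E = tally v M E"
    and "\<And>m l. tally v m {l<..} \<le> tally w m {l<..}"
  shows "word_exchange\<^sup>*\<^sup>* w v"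
  using assms
proof (induction "\<Sum>x\<le>M. (M - x) * w x" arbitrary: w rule: less_induct)
  case less
  show ?case
  proof (cases "w = v")
    case False
    obtain p j where pj: "p < j" "j \<le> M" "0 < w j" "w j < w p"
      "\<And>x. p < x \<Longrightarrow> x < j \<Longrightarrow> w x \<noteq> w p \<and> w x \<noteq> w j"
      and bal: "ballot (transpose_word p j w)"
      and dom: "\<And>m l. tally v m {l<..} \<le> tally (transpose_word p j w) m {l<..}"
      using ballot_exchange[OF less.prems False] by metis
    have "word_exchange w (transpose_word p j w)"
      unfolding word_exchange_def using pj less.prems(1) bal by blast
    moreover have "word_exchange\<^sup>*\<^sup>* (transpose_word p j w) v"
    proof (rule less.hyps)
      show "(\<Sum>x\<le>M. (M - x) * transpose_word p j w x) < (\<Sum>x\<le>M. (M - x) * w x)"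
        by (rule sum_transpose_word[where w=w, OF pj(1,2,4)])
      show "transpose_word p j w x = 0 \<longleftrightarrow> v x = 0" for x
        using transpose_word_eq_0_iff[where w=w, OF pj(3,4)] less.prems(3) by blast
      show "transpose_word p j w x = 0" if "M < x" for x
        using transpose_word_eq_0_iff[where w=w, OF pj(3,4)] less.prems(4) that by blast
      show "tally (transpose_word p j w) M E = tally v M E" if "0 \<notin> E" for E
        using tally_transpose_total[OF pj(1,2)] less.prems(5)[OF that] by metis
    qed (use bal dom less.prems(2) in auto)
    ultimately show ?thesis by (rule converse_rtranclp_into_rtranclp)
  qed simp
qed

section \<open>From exchanges of words to exchanges of tableaux\<close>

definition tableau_exchange :: "nat list \<Rightarrow> nat list \<Rightarrow> nat list \<Rightarrow> tableau \<Rightarrow> tableau \<Rightarrow> bool" where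
  "tableau_exchange \<alpha> \<beta> \<gamma> \<Gamma> \<Gamma>' \<longleftrightarrow> LR_tableau \<alpha> \<beta> \<gamma> \<Gamma> \<and> LR_tableau \<alpha> \<beta> \<gamma> \<Gamma>' \<and>
    (\<exists>w w'. word_exchange w w' \<and> corner_word \<beta> w \<and> has_content \<alpha> w \<and>
      corner_word \<beta> w' \<and> has_content \<alpha> w' \<and> \<Gamma> = tableau_of \<beta> w \<and> \<Gamma>' = tableau_of \<beta> w')"

lemma card_entries_eq_tally:
  assumes "\<And>x. M < x \<Longrightarrow> w x = (0::nat)" "1 \<le> e"
  shows "card {x. w x = e} = tally w M {e}"
proof -
  have "{x. w x = e} = {x. x \<le> M \<and> w x \<in> {e}}"
    using assms by (auto simp: not_less[symmetric])
  then show ?thesis by (simp add: tally_def)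
qed

lemma tally_eq_sum:
  assumes "\<And>x. x \<le> m \<Longrightarrow> w x \<le> B"
  shows "tally w m E = (\<Sum>e\<in>E \<inter> {..B}. tally w m {e})"
  using assms
proof (induction m)
  case 0
  have "(\<Sum>e\<in>E \<inter> {..B}. of_bool (w 0 \<in> {e})) = (of_bool (w 0 \<in> E) :: nat)"
    using 0[of 0] by (simp add: of_bool_def)
  then show ?case by (simp add: tally_0)
next
  case (Suc m)
  have "(\<Sum>e\<in>E \<inter> {..B}. of_bool (w (Suc m) \<in> {e})) = (of_bool (w (Suc m) \<in> E) :: nat)"
    using Suc.prems[of "Suc m"] by (simp add: of_bool_def)
  then show ?case using Suc by (simp add: tally_Suc sum.distrib)
qed

lemma tally_eq_of_content:
  assumes M: "\<And>x. M < x \<Longrightarrow> w x = (0::nat)" "\<And>x. M < x \<Longrightarrow> v x = 0"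
    and c: "has_content \<alpha> w" "has_content \<alpha> v" and E: "0 \<notin> E"
  shows "tally w M E = tally v M E"
proof -
  define B where "B = (\<Sum>x\<le>M. w x + v x)"
  have B: "w x \<le> B" "v x \<le> B" if "x \<le> M" for x
    using that member_le_sum[of x "{..M}" "\<lambda>x. w x + v x"] unfolding B_def by auto
  have "tally w M {e} = tally v M {e}" if "e \<in> E \<inter> {..B}" for e
  proof -
    have "1 \<le> e" using that E by (cases e) auto
    then show ?thesis
      using c card_entries_eq_tally[of M w e, OF M(1)] card_entries_eq_tally[of M v e, OF M(2)]
      unfolding has_content_def by simp
  qed
  then show ?thesis using tally_eq_sum[of M w B E] tally_eq_sum[of M v B E] B by simp
qed

lemma word_exchange_invariants:
  assumes ex: "word_exchange w w'" and corner: "corner_word \<beta> w" and content: "has_content \<alpha> w"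
  shows "corner_word \<beta> w'" "has_content \<alpha> w'" "w' x = 0 \<longleftrightarrow> w x = 0"
proof -
  obtain p j where pj: "p < j" "0 < w j" "w j < w p" and w': "w' = transpose_word p j w"
    using ex by (rule word_exchangeE)
  note supp = transpose_word_eq_0_iff[where w=w, OF pj(2,3), folded w']
  show "w' x = 0 \<longleftrightarrow> w x = 0" by (rule supp)
  show "corner_word \<beta> w'" using corner supp unfolding corner_word_def by (metis gr0I less_numeral_extra(3))
  obtain M where M: "\<And>x. M < x \<Longrightarrow> w x = 0" using corner_word_finite[OF corner] by blast
  have "j \<le> M" using M[of j] pj by (cases "M < j") auto
  then show "has_content \<alpha> w'"
    using content card_entries_eq_tally[of M w, OF M] card_entries_eq_tally[of M w'] supp M
      tally_transpose_total[OF pj(1), of M w]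
    unfolding has_content_def w' by simp
qed

lemma LR_tableau_of:
  assumes \<beta>: "is_partition \<beta>" and \<gamma>: "is_partition \<gamma>"
    and w: "corner_word \<beta> w" "ballot w" "has_content \<alpha> w"
    and supp: "\<And>x. 1 \<le> x \<Longrightarrow> conj_part \<gamma> x + of_bool (0 < w x) = conj_part \<beta> x"
  shows "LR_tableau \<alpha> \<beta> \<gamma> (tableau_of \<beta> w)"
proof -
  have "tableau_of \<beta> w 0 = \<gamma>"
  proof (rule partition_eqI[OF is_partition_tableau_of[OF \<beta>] \<gamma>])
    fix x :: nat assume x: "1 \<le> x"
    then have "conj_part (tableau_of \<beta> w 0) x + of_bool (0 < w x) = conj_part \<beta> x"
      using encodes_tableau_of[OF \<beta> w(1)] unfolding encodes_def by blast
    then show "conj_part (tableau_of \<beta> w 0) x = conj_part \<gamma> x" using supp[OF x] by linarith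
  qed
  then show ?thesis
    using word_LR_tableau[OF \<beta> is_partition_tableau_of[OF \<beta>] encodes_tableau_of[OF \<beta> w(1)] w] by simp
qed

lemma dom_le_tableau_exchanges:
  assumes \<beta>: "is_partition \<beta>" and \<gamma>: "is_partition \<gamma>" and hv: "horizontal_vertical_strip \<beta> \<gamma>"
    and LR: "LR_tableau \<alpha> \<beta> \<gamma> \<Gamma>" "LR_tableau \<alpha> \<beta> \<gamma> \<Gamma>'" and dom: "dom_le \<Gamma> \<Gamma>'"
  shows "(tableau_exchange \<alpha> \<beta> \<gamma>)\<^sup>*\<^sup>* \<Gamma> \<Gamma>'"
proof -
  have part: "is_partition (\<Gamma> l)" "is_partition (\<Gamma>' l)" for l
    using LR by (auto simp: LR_tableau_def is_tableau_def)
  have \<Gamma>0: "\<Gamma> 0 = \<gamma>" "\<Gamma>' 0 = \<gamma>" using LR by (auto simp: LR_tableau_def)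
  obtain w where w: "encodes \<beta> w \<Gamma>" "corner_word \<beta> w" "ballot w" "has_content \<alpha> w"
    using LR_tableau_word[OF \<beta> \<gamma> hv LR(1)] .
  obtain v where v: "encodes \<beta> v \<Gamma>'" "corner_word \<beta> v" "ballot v" "has_content \<alpha> v"
    using LR_tableau_word[OF \<beta> \<gamma> hv LR(2)] .
  have sw: "conj_part \<gamma> x + of_bool (0 < w x) = conj_part \<beta> x" if "1 \<le> x" for x
    using w(1) that \<Gamma>0 unfolding encodes_def by metis
  have sv: "conj_part \<gamma> x + of_bool (0 < v x) = conj_part \<beta> x" if "1 \<le> x" for x
    using v(1) that \<Gamma>0 unfolding encodes_def by metis
  have \<Gamma>: "\<Gamma> = tableau_of \<beta> w"
    using encodes_unique[OF w(1) encodes_tableau_of[OF \<beta> w(2)] part(1) is_partition_tableau_of[OF \<beta>]] .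
  have \<Gamma>': "\<Gamma>' = tableau_of \<beta> v"
    using encodes_unique[OF v(1) encodes_tableau_of[OF \<beta> v(2)] part(2) is_partition_tableau_of[OF \<beta>]] .
  have supp: "w x = 0 \<longleftrightarrow> v x = 0" for x
  proof (cases "x = 0")
    case True
    then show ?thesis using w(2) v(2) by (simp add: corner_word_def)
  next
    case False
    then have "of_bool (0 < w x) = (of_bool (0 < v x) :: nat)" using sw[of x] sv[of x] by simp
    then show ?thesis by (cases "w x = 0"; cases "v x = 0") simp_all
  qed
  obtain M where M: "\<And>x. M < x \<Longrightarrow> w x = 0" using corner_word_finite[OF w(2)] by blast
  have ex: "word_exchange\<^sup>*\<^sup>* w v"
  proof (rule word_exchanges[OF w(3) v(3) supp M])
    show "tally w M E = tally v M E" if "0 \<notin> E" for E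
      by (rule tally_eq_of_content[OF M _ w(4) v(4) that]) (use M supp in auto)
    show "tally v m {l<..} \<le> tally w m {l<..}" for m l
      using dom dom_le_iff_tally[OF w(1) v(1)] by blast
  qed
  \<comment> \<open>Corners, content and support are carried along because every intermediate word
    has to give an LR-tableau of the same type; equal support keeps the partition at level 0 equal
    to \<gamma>.\<close>
  have "(tableau_exchange \<alpha> \<beta> \<gamma>)\<^sup>*\<^sup>* (tableau_of \<beta> w) (tableau_of \<beta> v) \<and>
      corner_word \<beta> v \<and> has_content \<alpha> v \<and> (\<forall>x. v x = 0 \<longleftrightarrow> w x = 0)"
    using ex
  proof (induction rule: rtranclp_induct)
    case base
    then show ?case using w by simp
  next
    case (step y z)
    have y: "corner_word \<beta> y" "has_content \<alpha> y" "\<And>x. y x = 0 \<longleftrightarrow> w x = 0" using step.IH by auto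
    note inv = word_exchange_invariants[OF step.hyps(2) y(1,2)]
    have bal: "ballot y" "ballot z" using step.hyps(2) unfolding word_exchange_def by auto
    have "LR_tableau \<alpha> \<beta> \<gamma> (tableau_of \<beta> y)"
      using sw y(3) by (intro LR_tableau_of[OF \<beta> \<gamma> y(1) bal(1) y(2)]) (simp only: neq0_conv[symmetric])
    moreover have "LR_tableau \<alpha> \<beta> \<gamma> (tableau_of \<beta> z)"
      using sw y(3) inv(3) by (intro LR_tableau_of[OF \<beta> \<gamma> inv(1) bal(2) inv(2)]) (simp only: neq0_conv[symmetric])
    ultimately have "tableau_exchange \<alpha> \<beta> \<gamma> (tableau_of \<beta> y) (tableau_of \<beta> z)"
      unfolding tableau_exchange_def using step.hyps(2) y inv by blast
    with step.IH have "(tableau_exchange \<alpha> \<beta> \<gamma>)\<^sup>*\<^sup>* (tableau_of \<beta> w) (tableau_of \<beta> z)"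
      by (blast intro: rtranclp.rtrancl_into_rtrancl)
    then show ?case using inv y(3) by blast
  qed
  then show ?thesis using \<Gamma> \<Gamma>' by simp
qed

text \<open>The move has one entry per column: \<open>e = f = w j\<close> in the longer column n = j
  and \<open>e' = f' = w p\<close> in the column n' = p. All other columns form the common part
  \<Delta>.\<close>

lemma tableau_exchange_increasing_box_move:
  assumes \<beta>: "is_partition \<beta>" and "tableau_exchange \<alpha> \<beta> \<gamma> \<Gamma> \<Gamma>'"
  shows "increasing_box_move \<alpha> \<beta> \<gamma> \<Gamma> \<Gamma>'"
proof -
  obtain w w' where ex: "word_exchange w w'" and corner: "corner_word \<beta> w" "corner_word \<beta> w'"
    and \<Gamma>: "\<Gamma> = tableau_of \<beta> w" and \<Gamma>': "\<Gamma>' = tableau_of \<beta> w'"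
    and LR: "LR_tableau \<alpha> \<beta> \<gamma> \<Gamma>" "LR_tableau \<alpha> \<beta> \<gamma> \<Gamma>'"
    using assms(2) unfolding tableau_exchange_def by blast
  obtain p j where pj: "p < j" "0 < w j" "w j < w p" and w': "w' = transpose_word p j w"
    using ex by (rule word_exchangeE)
  define a b where "a = conj_part \<beta> p - 1" and "b = conj_part \<beta> j - 1"
  have wp: "0 < w p" using pj by simp
  have w'pj: "w' p = w j" "w' j = w p" using pj by (auto simp: w' transpose_word_def)
  have a: "a < length \<beta>" "\<beta> ! a = p" "1 \<le> p" using corner_column[OF \<beta> corner(1) wp] by (auto simp: a_def)
  have b: "b < length \<beta>" "\<beta> ! b = j" "1 \<le> j" using corner_column[OF \<beta> corner(1) pj(2)] by (auto simp: b_def)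
  have ab: "a \<noteq> b" using a b pj by auto
  define S where "S = {..<length \<beta>} - {a, b}"
  obtain \<Delta> where \<Delta>: "union_of_columns \<Delta>" "\<And>l. 0 \<notin> set (\<Delta> l)"
    "\<And>l x. 1 \<le> x \<Longrightarrow> conj_part (\<Delta> l) x = (\<Sum>i\<in>S. of_bool (x \<le> column_height \<beta> w l i))"
    using union_of_columns_ex[OF \<beta>, of S w] unfolding S_def by blast
  have entries: "box_entry \<beta> w a = w p" "box_entry \<beta> w b = w j"
    "box_entry \<beta> w' a = w j" "box_entry \<beta> w' b = w p"
    using box_entry_corner[OF \<beta> corner(1) wp] box_entry_corner[OF \<beta> corner(1) pj(2)]
      box_entry_corner[OF \<beta> corner(2), of p] box_entry_corner[OF \<beta> corner(2), of j] w'pj wp pj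
    by (simp_all add: a_def b_def)
  have same: "column_height \<beta> w' l i = column_height \<beta> w l i" if "i \<in> S" for l i
  proof -
    have "box_entry \<beta> w' i = box_entry \<beta> w i"
      using that a_def b_def by (auto simp: box_entry_def S_def w' transpose_word_def)
    then show ?thesis by (simp add: column_height_def)
  qed
  have sum_split: "(\<Sum>i<length \<beta>. g i) = (\<Sum>i\<in>S. g i) + g a + (g b :: nat)" for g
  proof -
    have "{..<length \<beta>} = insert a (insert b S)" "finite S" "a \<notin> S" "b \<notin> S"
      using a b by (auto simp: S_def)
    then show ?thesis using ab by simp
  qed
  define T where "T u = tableau_union (tableau_union \<Delta> (column_tableau (u j) (u j) j)) (column_tableau (u p) (u p) p)" for u
  have eq: "tableau_of \<beta> u = T u"
    if u: "0 < u p" "0 < u j" "box_entry \<beta> u a = u p" "box_entry \<beta> u b = u j"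
      and same: "\<And>l i. i \<in> S \<Longrightarrow> column_height \<beta> u l i = column_height \<beta> w l i" for u
  proof
    fix l
    have nz: "0 \<notin> set (column_tableau e f n l)" for e f n
      by (simp add: column_tableau_def Let_def)
    have "0 \<notin> set (tableau_union \<Delta> (column_tableau (u j) (u j) j) l)"
      using \<Delta>(2)[of l] nz by (simp add: tableau_union_def)
    then have part: "is_partition (T u l)"
      unfolding T_def using nz by (rule is_partition_tableau_union)
    show "tableau_of \<beta> u l = T u l"
    proof (rule partition_eqI[OF is_partition_tableau_of[OF \<beta>] part])
      fix x :: nat assume x: "1 \<le> x"
      have "column_height \<beta> u l a = p - of_bool (l < u p)" "column_height \<beta> u l b = j - of_bool (l < u j)"
        using a b u by (simp_all add: column_height_def)
      then show "conj_part (tableau_of \<beta> u l) x = conj_part (T u l) x"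
        unfolding T_def conj_part_tableau_of[OF x] conj_part_tableau_union \<Delta>(3)[OF x] sum_split
        using u x by (simp add: conj_part_column_tableau_single same del: sum_of_bool_eq)
    qed
  qed
  have G: "\<Gamma> = tableau_union (tableau_union \<Delta> (column_tableau (w j) (w j) j)) (column_tableau (w p) (w p) p)"
    unfolding \<Gamma> using wp pj entries eq[of w] by (simp add: T_def)
  have G': "\<Gamma>' = tableau_union (tableau_union \<Delta> (column_tableau (w p) (w p) j)) (column_tableau (w j) (w j) p)"
    unfolding \<Gamma>' using wp pj entries same eq[of w'] w'pj by (simp add: T_def)
  have valid: "valid_column e e n" if "0 < e" "1 \<le> n" for e n
    using that by (auto simp: valid_column_def)
  have "union_of_columns \<Delta> \<and> valid_column (w j) (w j) j \<and> valid_column (w p) (w p) p \<and>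
      valid_column (w p) (w p) j \<and> valid_column (w j) (w j) p \<and>
      j > p \<and> 1 \<le> w j \<and> w j \<le> w j \<and> w j < w p \<and> w j < w p \<and> w j + w p = w p + w j"
    using \<Delta>(1) valid[OF wp a(3)] valid[OF wp b(3)] valid[OF pj(2) a(3)] valid[OF pj(2) b(3)] pj by simp
  then show ?thesis
    unfolding increasing_box_move_def using LR G G' by blast
qed

section \<open>Finite length modules as quotients of free modules\<close>

lemma fps_X_power_dvd_iff: "fps_X ^ b dvd (f :: 'k::field fps) \<longleftrightarrow> (\<forall>n<b. fps_nth f n = 0)"
proof
  assume "fps_X ^ b dvd f"
  then show "\<forall>n<b. fps_nth f n = 0" by (auto simp: dvd_def fps_X_power_mult_nth)
next
  assume "\<forall>n<b. fps_nth f n = 0"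
  then have "f = fps_X ^ b * fps_shift b f" by (simp add: fps_eq_iff fps_X_power_mult_nth)
  then show "fps_X ^ b dvd f" by (rule dvdI)
qed

definition fps_coset :: "nat \<Rightarrow> 'k::field fps \<Rightarrow> 'k fps set" where
  "fps_coset b u = {v. fps_X ^ b dvd v - u}"

lemma fps_coset_eq: "PIdl\<^bsub>\<Lambda>\<^esub> (fps_X ^ b) +>\<^bsub>regular_module\<^esub> u = fps_coset b (u :: 'k::field fps)"
proof -
  have I: "PIdl\<^bsub>(\<Lambda> :: 'k fps ring)\<^esub> (fps_X ^ b) = {x. fps_X ^ b dvd x}"
    by (auto simp: cgenideal_def Lambda_def dvd_def mult.commute)
  have "(\<exists>h. fps_X ^ b dvd h \<and> v = h + u) \<longleftrightarrow> fps_X ^ b dvd v - u" for v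
    by (metis add_diff_cancel_right' diff_add_cancel)
  then show ?thesis
    unfolding I a_r_coset_def' fps_coset_def regular_module_def by auto
qed

lemma fps_coset_eq_iff: "fps_coset b u = fps_coset b v \<longleftrightarrow> fps_X ^ b dvd u - v"
proof
  assume "fps_coset b u = fps_coset b v"
  moreover have "u \<in> fps_coset b u" by (simp add: fps_coset_def)
  ultimately show "fps_X ^ b dvd u - v" by (simp add: fps_coset_def)
next
  assume "fps_X ^ b dvd u - v"
  then have "fps_X ^ b dvd w - u \<longleftrightarrow> fps_X ^ b dvd w - v" for w
    using dvd_add_right_iff[of "fps_X ^ b" "u - v" "w - u"] by (simp add: algebra_simps)
  then show "fps_coset b u = fps_coset b v" by (simp add: fps_coset_def)
qed

lemma cyclic_module_simps:
  fixes u v r :: "'k::field fps"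
  shows "carrier (cyclic_module b :: ('k fps, 'k fps set) module) = range (fps_coset b)"
    and "fps_coset b u \<oplus>\<^bsub>cyclic_module b\<^esub> fps_coset b v = fps_coset b (u + v)"
    and "r \<odot>\<^bsub>cyclic_module b\<^esub> fps_coset b u = fps_coset b (r * u)"
    and "\<zero>\<^bsub>cyclic_module b :: ('k fps, 'k fps set) module\<^esub> = fps_coset b 0"
proof -
  have reg: "carrier (regular_module :: ('k fps, 'k fps) module) = UNIV" by (simp add: regular_module_def)
  show "carrier (cyclic_module b :: ('k fps, 'k fps set) module) = range (fps_coset b)"
    by (auto simp: cyclic_module_def quotient_module_def A_RCOSETS_def' fps_coset_eq reg)
  have "\<exists>h\<in>fps_coset b u. \<exists>k\<in>fps_coset b v. w = h + k" if "w \<in> fps_coset b (u + v)" for w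
    using that by (intro bexI[of _ u] bexI[of _ "w - u"]) (auto simp: fps_coset_def algebra_simps)
  moreover have "h + k \<in> fps_coset b (u + v)" if "h \<in> fps_coset b u" "k \<in> fps_coset b v" for h k
    using that dvd_add[of "fps_X ^ b" "h - u" "k - v"] by (simp add: fps_coset_def algebra_simps)
  ultimately show "fps_coset b u \<oplus>\<^bsub>cyclic_module b\<^esub> fps_coset b v = fps_coset b (u + v)"
    by (auto simp: cyclic_module_def quotient_module_def set_add_def' regular_module_def)
  have "fps_coset b (r * x) = fps_coset b (r * u)" if "x \<in> fps_coset b u" for x
  proof -
    have "fps_X ^ b dvd r * (x - u)" using that by (simp add: fps_coset_def)
    then show ?thesis unfolding fps_coset_eq_iff by (simp add: algebra_simps)
  qed
  moreover have "u \<in> fps_coset b u" by (simp add: fps_coset_def)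
  ultimately have "(\<Union>x\<in>fps_coset b u. fps_coset b (r * x)) = fps_coset b (r * u)" by blast
  moreover have "r \<odot>\<^bsub>regular_module\<^esub> x = r * x" for x by (simp add: regular_module_def)
  ultimately show "r \<odot>\<^bsub>cyclic_module b\<^esub> fps_coset b u = fps_coset b (r * u)"
    by (simp add: cyclic_module_def quotient_module_def fps_coset_eq)
  have "PIdl\<^bsub>(\<Lambda> :: 'k fps ring)\<^esub> (fps_X ^ b) = fps_coset b 0"
    by (auto simp: cgenideal_def Lambda_def dvd_def mult.commute fps_coset_def)
  then show "\<zero>\<^bsub>cyclic_module b :: ('k fps, 'k fps set) module\<^esub> = fps_coset b 0"
    by (simp add: cyclic_module_def quotient_module_def)
qed

text \<open>Computations take place with families of power series; values at indices beyond the
  length of \<beta> are irrelevant, and \<open>cong_mod\<close> ignores them.\<close>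

definition elt :: "nat list \<Rightarrow> (nat \<Rightarrow> 'k::field fps) \<Rightarrow> nat \<Rightarrow> 'k fps set" where
  "elt \<beta> u = (\<lambda>i\<in>{..<length \<beta>}. fps_coset (\<beta> ! i) (u i))"

definition cong_mod :: "nat list \<Rightarrow> (nat \<Rightarrow> 'k::field fps) \<Rightarrow> (nat \<Rightarrow> 'k fps) \<Rightarrow> bool" where
  "cong_mod \<beta> u v \<longleftrightarrow> (\<forall>i<length \<beta>. fps_X ^ (\<beta> ! i) dvd u i - v i)"

lemma elt_eq_iff: "elt \<beta> u = elt \<beta> v \<longleftrightarrow> cong_mod \<beta> u v"
  by (auto simp: elt_def cong_mod_def fun_eq_iff restrict_def fps_coset_eq_iff[symmetric])

lemma elt_eqI: "cong_mod \<beta> u v \<Longrightarrow> elt \<beta> u = elt \<beta> v"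
  by (simp add: elt_eq_iff)

lemma N_mod_simps:
  fixes u v :: "nat \<Rightarrow> 'k::field fps"
  shows carrier_N_mod: "carrier (N_mod \<beta> :: ('k fps, nat \<Rightarrow> 'k fps set) module) = range (elt \<beta>)"
    and elt_add: "elt \<beta> u \<oplus>\<^bsub>N_mod \<beta>\<^esub> elt \<beta> v = elt \<beta> (\<lambda>i. u i + v i)"
    and elt_smult: "r \<odot>\<^bsub>N_mod \<beta>\<^esub> elt \<beta> u = elt \<beta> (\<lambda>i. r * u i)"
    and elt_zero: "\<zero>\<^bsub>N_mod \<beta> :: ('k fps, nat \<Rightarrow> 'k fps set) module\<^esub> = elt \<beta> (\<lambda>_. 0)"
proof -
  have "x \<in> range (elt \<beta>)" if x: "x \<in> (\<Pi>\<^sub>E i\<in>{..<length \<beta>}. range (fps_coset (\<beta> ! i)))"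
    for x :: "nat \<Rightarrow> 'k fps set"
  proof -
    have "\<forall>i\<in>{..<length \<beta>}. \<exists>u. x i = fps_coset (\<beta> ! i) u" using x by (auto simp: PiE_iff)
    then obtain u where u: "\<forall>i\<in>{..<length \<beta>}. x i = fps_coset (\<beta> ! i) (u i)" by metis
    have "x = elt \<beta> u" using x u by (auto simp: elt_def PiE_iff fun_eq_iff extensional_def)
    then show ?thesis by blast
  qed
  moreover have "carrier (N_mod \<beta> :: ('k fps, nat \<Rightarrow> 'k fps set) module) =
      (\<Pi>\<^sub>E i\<in>{..<length \<beta>}. range (fps_coset (\<beta> ! i)))"
    by (auto simp: N_mod_def direct_sum_def cyclic_module_simps PiE_iff)
  ultimately show "carrier (N_mod \<beta> :: ('k fps, nat \<Rightarrow> 'k fps set) module) = range (elt \<beta>)"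
    by (auto simp: elt_def)
qed (auto simp: N_mod_def direct_sum_def elt_def fun_eq_iff cyclic_module_simps)

lemma elt_in_carrier [simp]: "elt \<beta> u \<in> carrier (N_mod \<beta>)"
  by (simp add: carrier_N_mod)

lemma cong_mod_refl [simp]: "cong_mod \<beta> u u"
  by (simp add: cong_mod_def)

lemma cong_mod_sym: "cong_mod \<beta> u v \<Longrightarrow> cong_mod \<beta> v u"
  by (simp add: elt_eq_iff[symmetric])

lemma cong_mod_trans: "cong_mod \<beta> u v \<Longrightarrow> cong_mod \<beta> v w \<Longrightarrow> cong_mod \<beta> u w"
  by (simp add: elt_eq_iff[symmetric])

lemma cong_mod_add: "cong_mod \<beta> u u' \<Longrightarrow> cong_mod \<beta> v v' \<Longrightarrow> cong_mod \<beta> (\<lambda>i. u i + v i) (\<lambda>i. u' i + v' i)"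
  by (simp add: elt_eq_iff[symmetric] elt_add[symmetric])

lemma cong_mod_smult: "cong_mod \<beta> u u' \<Longrightarrow> cong_mod \<beta> (\<lambda>i. r * u i) (\<lambda>i. r * u' i)"
  by (simp add: elt_eq_iff[symmetric] elt_smult[symmetric])

lemma cong_mod_zero_iff: "cong_mod \<beta> u (\<lambda>_. 0) \<longleftrightarrow> (\<forall>i<length \<beta>. \<forall>n<\<beta> ! i. fps_nth (u i) n = 0)"
  by (simp add: cong_mod_def fps_X_power_dvd_iff)

lemma cong_mod_diff: "cong_mod \<beta> (\<lambda>i. u i - v i) (\<lambda>_. 0) \<longleftrightarrow> cong_mod \<beta> u v"
  by (simp add: cong_mod_def)

text \<open>Submodules of \<open>N_mod \<beta>\<close> are described by their preimages in the free module.\<close>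

definition lattice_mod :: "nat list \<Rightarrow> (nat \<Rightarrow> 'k::field fps) set \<Rightarrow> bool" where
  "lattice_mod \<beta> K \<longleftrightarrow> (\<forall>u\<in>K. \<forall>v\<in>K. (\<lambda>i. u i + v i) \<in> K) \<and>
    (\<forall>r. \<forall>u\<in>K. (\<lambda>i. r * u i) \<in> K) \<and> (\<forall>u. cong_mod \<beta> u (\<lambda>_. 0) \<longrightarrow> u \<in> K)"

lemma lattice_mod_add: "lattice_mod \<beta> K \<Longrightarrow> u \<in> K \<Longrightarrow> v \<in> K \<Longrightarrow> (\<lambda>i. u i + v i) \<in> K"
  unfolding lattice_mod_def by blast

lemma lattice_mod_smult: "lattice_mod \<beta> K \<Longrightarrow> u \<in> K \<Longrightarrow> (\<lambda>i. r * u i) \<in> K"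
  unfolding lattice_mod_def by blast

lemma lattice_mod_zero: "lattice_mod \<beta> K \<Longrightarrow> cong_mod \<beta> u (\<lambda>_. 0) \<Longrightarrow> u \<in> K"
  unfolding lattice_mod_def by blast

lemma lattice_mod_0: "lattice_mod \<beta> K \<Longrightarrow> (\<lambda>_. 0) \<in> K"
  by (rule lattice_mod_zero) auto

lemma lattice_mod_diff: "lattice_mod \<beta> K \<Longrightarrow> u \<in> K \<Longrightarrow> v \<in> K \<Longrightarrow> (\<lambda>i. u i - v i) \<in> K"
  using lattice_mod_add[of \<beta> K u "\<lambda>i. - 1 * v i"] lattice_mod_smult[of \<beta> K v "- 1"] by simp

lemma lattice_mod_sum:
  assumes "lattice_mod \<beta> K" "finite S" "\<And>j. j \<in> S \<Longrightarrow> f j \<in> K"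
  shows "(\<lambda>i. \<Sum>j\<in>S. f j i) \<in> K"
  using assms(2,3)
  by (induction S rule: finite_induct) (auto intro: lattice_mod_0[OF assms(1)] lattice_mod_add[OF assms(1)])

lemma lattice_mod_cong: "lattice_mod \<beta> K \<Longrightarrow> u \<in> K \<Longrightarrow> cong_mod \<beta> v u \<Longrightarrow> v \<in> K"
  using lattice_mod_add[of \<beta> K u "\<lambda>i. v i - u i"] lattice_mod_zero[of \<beta> K "\<lambda>i. v i - u i"]
  by (simp add: cong_mod_diff)

lemma submodule_image_elt:
  fixes K :: "(nat \<Rightarrow> 'k::field fps) set"
  assumes "lattice_mod \<beta> K"
  shows "submodule (elt \<beta> ` K) \<Lambda> (N_mod \<beta>)"
proof -
  interpret Module.module "\<Lambda> :: 'k fps ring" "N_mod \<beta>" by (rule module_N_mod)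
  show ?thesis
  proof (rule submoduleI)
    show "elt \<beta> ` K \<subseteq> carrier (N_mod \<beta>)" by auto
    show "\<zero>\<^bsub>N_mod \<beta>\<^esub> \<in> elt \<beta> ` K" using lattice_mod_0[OF assms] by (auto simp: elt_zero)
    show "a \<oplus>\<^bsub>N_mod \<beta>\<^esub> b \<in> elt \<beta> ` K" if "a \<in> elt \<beta> ` K" "b \<in> elt \<beta> ` K" for a b
      using that lattice_mod_add[OF assms] by (auto simp: elt_add)
    show "a \<odot>\<^bsub>N_mod \<beta>\<^esub> x \<in> elt \<beta> ` K" if "x \<in> elt \<beta> ` K" for a x
      using that lattice_mod_smult[OF assms] by (auto simp: elt_smult)
    show "\<ominus>\<^bsub>N_mod \<beta>\<^esub> a \<in> elt \<beta> ` K" if a: "a \<in> elt \<beta> ` K" for a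
    proof -
      obtain u where u: "u \<in> K" "a = elt \<beta> u" using a by blast
      have "elt \<beta> (\<lambda>i. - 1 * u i) \<oplus>\<^bsub>N_mod \<beta>\<^esub> a = \<zero>\<^bsub>N_mod \<beta>\<^esub>" by (simp add: u elt_add elt_zero)
      then have "\<ominus>\<^bsub>N_mod \<beta>\<^esub> a = elt \<beta> (\<lambda>i. - 1 * u i)"
        by (intro M.minus_equality) (auto simp: u)
      then show ?thesis using lattice_mod_smult[OF assms u(1)] by blast
    qed
  qed
qed

definition residue_class :: "nat list \<Rightarrow> (nat \<Rightarrow> 'k::field fps) set \<Rightarrow> (nat \<Rightarrow> 'k fps) \<Rightarrow> (nat \<Rightarrow> 'k fps set) set" where
  "residue_class \<beta> K u = elt \<beta> ` {v. (\<lambda>i. v i - u i) \<in> K}"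

lemma quotient_N_mod_simps:
  fixes K :: "(nat \<Rightarrow> 'k::field fps) set"
  assumes K: "lattice_mod \<beta> K"
  defines "Q \<equiv> quotient_module (N_mod \<beta>) (elt \<beta> ` K)"
  shows carrier_quotient_N_mod: "carrier Q = range (residue_class \<beta> K)"
    and residue_class_add: "residue_class \<beta> K u \<oplus>\<^bsub>Q\<^esub> residue_class \<beta> K v = residue_class \<beta> K (\<lambda>i. u i + v i)"
    and residue_class_smult: "r \<odot>\<^bsub>Q\<^esub> residue_class \<beta> K u = residue_class \<beta> K (\<lambda>i. r * u i)"
    and residue_class_eq_iff: "residue_class \<beta> K u = residue_class \<beta> K v \<longleftrightarrow> (\<lambda>i. u i - v i) \<in> K"
proof -
  interpret Module.module "\<Lambda> :: 'k fps ring" "N_mod \<beta>" by (rule module_N_mod)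
  interpret S: submodule "elt \<beta> ` K" "\<Lambda> :: 'k fps ring" "N_mod \<beta>" by (rule submodule_image_elt[OF K])
  interpret A: abelian_subgroup "elt \<beta> ` K" "N_mod \<beta>"
    by (rule abelian_subgroupI3) (simp_all add: additive_subgroup.intro S.subgroup_axioms M.abelian_group_axioms)
  have res: "residue_class \<beta> K u = elt \<beta> ` K +>\<^bsub>N_mod \<beta>\<^esub> elt \<beta> u" for u
  proof -
    have "elt \<beta> v \<in> elt \<beta> ` K +>\<^bsub>N_mod \<beta>\<^esub> elt \<beta> u" if "(\<lambda>i. v i - u i) \<in> K" for v
      using that unfolding a_r_coset_def' by (auto simp: elt_add intro!: exI[of _ "\<lambda>i. v i - u i"] bexI[of _ "\<lambda>i. v i - u i"])
    moreover have "elt \<beta> k \<oplus>\<^bsub>N_mod \<beta>\<^esub> elt \<beta> u \<in> residue_class \<beta> K u" if "k \<in> K" for k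
      using that unfolding residue_class_def by (auto simp: elt_add)
    ultimately show ?thesis unfolding residue_class_def a_r_coset_def' by auto
  qed
  show "carrier Q = range (residue_class \<beta> K)"
    unfolding res Q_def quotient_module_def A_RCOSETS_def' by (auto simp: carrier_N_mod)
  show "residue_class \<beta> K u \<oplus>\<^bsub>Q\<^esub> residue_class \<beta> K v = residue_class \<beta> K (\<lambda>i. u i + v i)"
    unfolding res Q_def by (simp add: quotient_module_def A.a_rcos_sum elt_add)
  show "r \<odot>\<^bsub>Q\<^esub> residue_class \<beta> K u = residue_class \<beta> K (\<lambda>i. r * u i)"
    unfolding res Q_def
    by (subst quotient_module_smult[OF module_N_mod submodule_image_elt[OF K]]) (auto simp: elt_smult Lambda_def)
  show "residue_class \<beta> K u = residue_class \<beta> K v \<longleftrightarrow> (\<lambda>i. u i - v i) \<in> K"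
  proof
    assume eq: "residue_class \<beta> K u = residue_class \<beta> K v"
    have "elt \<beta> u \<in> residue_class \<beta> K u"
      unfolding residue_class_def using lattice_mod_0[OF K] by auto
    then have "elt \<beta> u \<in> residue_class \<beta> K v" unfolding eq .
    then obtain u' where u': "cong_mod \<beta> u u'" "(\<lambda>i. u' i - v i) \<in> K"
      unfolding residue_class_def by (auto simp: elt_eq_iff)
    then show "(\<lambda>i. u i - v i) \<in> K"
      using lattice_mod_cong[OF K u'(2), of "\<lambda>i. u i - v i"] by (simp add: cong_mod_def)
  next
    assume uv: "(\<lambda>i. u i - v i) \<in> K"
    have "(\<lambda>i. w i - u i) \<in> K \<longleftrightarrow> (\<lambda>i. w i - v i) \<in> K" for w
      using lattice_mod_add[OF K uv, of "\<lambda>i. w i - u i"] lattice_mod_diff[OF K _ uv, of "\<lambda>i. w i - v i"]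
      by (auto simp: algebra_simps)
    then show "residue_class \<beta> K u = residue_class \<beta> K v" unfolding residue_class_def by simp
  qed
qed

section \<open>Linear combinations and bases of quotients\<close>

text \<open>Row c of the matrix is the image of the c-th generator.\<close>

definition lin :: "nat list \<Rightarrow> (nat \<Rightarrow> nat \<Rightarrow> 'k::field fps) \<Rightarrow> (nat \<Rightarrow> 'k fps) \<Rightarrow> nat \<Rightarrow> 'k fps" where
  "lin \<alpha> g u i = (\<Sum>c<length \<alpha>. u c * g c i)"

lemma lin_add: "lin \<alpha> g (\<lambda>c. u c + v c) i = lin \<alpha> g u i + lin \<alpha> g v i"
  by (simp add: lin_def algebra_simps sum.distrib)

lemma lin_diff: "lin \<alpha> g (\<lambda>c. u c - v c) i = lin \<alpha> g u i - lin \<alpha> g v i"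
  by (simp add: lin_def algebra_simps sum_subtractf)

lemma lin_smult: "lin \<alpha> g (\<lambda>c. r * u c) i = r * lin \<alpha> g u i"
  by (simp add: lin_def algebra_simps sum_distrib_left)

lemma lin_zero: "lin \<alpha> g (\<lambda>c. 0) i = 0"
  by (simp add: lin_def)

lemma lin_unit: "c < length \<alpha> \<Longrightarrow> lin \<alpha> g (\<lambda>c'. if c' = c then r else 0) i = r * g c i"
proof -
  assume "c < length \<alpha>"
  moreover have "(\<Sum>c'<length \<alpha>. (if c' = c then r else 0) * g c' i) = (\<Sum>c'<length \<alpha>. if c' = c then r * g c' i else 0)"
    by (rule sum.cong) auto
  ultimately show ?thesis by (simp add: lin_def)
qed

lemma lin_units: "lin \<alpha> (\<lambda>c c'. if c' = c then 1 else 0) u i = (if i < length \<alpha> then u i else 0)"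
proof -
  have "(\<Sum>c<length \<alpha>. u c * (if i = c then 1 else 0)) = (\<Sum>c<length \<alpha>. if c = i then u c else 0)"
    by (rule sum.cong) auto
  then show ?thesis by (simp add: lin_def)
qed

lemma additive_on_sum:
  fixes \<phi> :: "(nat \<Rightarrow> 'k::field fps) \<Rightarrow> nat \<Rightarrow> 'k fps set"
  assumes add: "\<And>u v. \<phi> (\<lambda>i. u i + v i) = \<phi> u \<oplus>\<^bsub>N_mod \<beta>\<^esub> \<phi> v"
    and smult: "\<And>r u. \<phi> (\<lambda>i. r * u i) = r \<odot>\<^bsub>N_mod \<beta>\<^esub> \<phi> u"
    and h: "\<And>c. c < length \<alpha> \<Longrightarrow> \<phi> (h c) = elt \<beta> (g c)"
    and zero: "\<phi> (\<lambda>_. 0) = elt \<beta> (\<lambda>_. 0)"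
  shows "\<phi> (lin \<alpha> h u) = elt \<beta> (lin \<alpha> g u)"
proof -
  have "\<phi> (\<lambda>i. \<Sum>c<k. u c * h c i) = elt \<beta> (\<lambda>i. \<Sum>c<k. u c * g c i)" if "k \<le> length \<alpha>" for k
    using that by (induction k) (simp_all add: zero add smult h elt_smult elt_add)
  from this[of "length \<alpha>"] show ?thesis by (simp add: lin_def[abs_def])
qed

text \<open>The relations of \<open>N_mod \<alpha>\<close> are generated by the powers of p that
  kill the generators, so it suffices that these go to K. This yields the well-definedness of maps
  given by matrices.\<close>

lemma cong_mod_lin:
  assumes "\<And>c. c < length \<alpha> \<Longrightarrow> (\<lambda>i. fps_X ^ (\<alpha> ! c) * g c i) \<in> K" "lattice_mod \<beta> K" "cong_mod \<alpha> u (\<lambda>_. 0)"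
  shows "lin \<alpha> g u \<in> K"
proof -
  have "(\<lambda>i. \<Sum>c\<in>{..<length \<alpha>}. u c * g c i) \<in> K"
  proof (rule lattice_mod_sum[OF assms(2)])
    fix c assume c: "c \<in> {..<length \<alpha>}"
    then obtain r where "u c = fps_X ^ (\<alpha> ! c) * r" using assms(3) by (auto simp: cong_mod_def dvd_def)
    then show "(\<lambda>i. u c * g c i) \<in> K"
      using lattice_mod_smult[OF assms(2) assms(1)[of c], of r] c by (simp add: mult.assoc mult.left_commute)
  qed simp
  then show ?thesis by (simp add: lin_def[abs_def])
qed

lemma lattice_mod_cong_zero: "lattice_mod \<beta> {u. cong_mod \<beta> u (\<lambda>_. 0)}"
  unfolding lattice_mod_def cong_mod_def by (auto intro: dvd_add)

text \<open>A basis of the quotient is a family of lifts of the generators of \<open>N_mod \<nu>\<close>.\<close>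

definition quotient_basis :: "nat list \<Rightarrow> (nat \<Rightarrow> 'k::field fps) set \<Rightarrow> (nat \<Rightarrow> nat \<Rightarrow> 'k fps) \<Rightarrow> bool" where
  "quotient_basis \<nu> K h \<longleftrightarrow>
    (\<forall>j<length \<nu>. (\<lambda>i. fps_X ^ (\<nu> ! j) * h j i) \<in> K) \<and>
    (\<forall>v. \<exists>r. (\<lambda>i. v i - lin \<nu> h r i) \<in> K) \<and>
    (\<forall>r. lin \<nu> h r \<in> K \<longrightarrow> cong_mod \<nu> r (\<lambda>_. 0))"

text \<open>From here on types are statements about power series instead of cosets of cosets. One
  direction lifts the standard generators through an isomorphism, the other sends a class to its
  coordinates, which are unique modulo the relations.\<close>

lemma has_type_quotient_iff:
  fixes K :: "(nat \<Rightarrow> 'k::field fps) set"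
  assumes K: "lattice_mod \<beta> K"
  shows "has_type (quotient_module (N_mod \<beta>) (elt \<beta> ` K)) \<nu> \<longleftrightarrow> (\<exists>h. quotient_basis \<nu> K h)"
proof
  let ?Q = "quotient_module (N_mod \<beta>) (elt \<beta> ` K)"
  let ?q = "residue_class \<beta> K"
  note Q = quotient_N_mod_simps[OF K]
  assume "has_type ?Q \<nu>"
  then obtain h where hom: "h \<in> Hom_Lambda ?Q (N_mod \<nu>)" and bij: "bij_betw h (carrier ?Q) (carrier (N_mod \<nu>))"
    unfolding has_type_def module_isomorphic_def by blast
  define \<phi> where "\<phi> u = h (?q u)" for u
  have qc: "?q u \<in> carrier ?Q" for u by (simp add: Q(1))
  have add: "\<phi> (\<lambda>i. u i + v i) = \<phi> u \<oplus>\<^bsub>N_mod \<nu>\<^esub> \<phi> v" for u v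
    using hom qc unfolding \<phi>_def Hom_Lambda_def linear_maps_def Q(2)[symmetric] by blast
  have smult: "\<phi> (\<lambda>i. r * u i) = r \<odot>\<^bsub>N_mod \<nu>\<^esub> \<phi> u" for r u
    using hom qc unfolding \<phi>_def Hom_Lambda_def linear_maps_def Q(3)[symmetric] by blast
  have surj: "\<exists>u. \<phi> u = elt \<nu> r" for r
  proof -
    have "elt \<nu> r \<in> h ` carrier ?Q" using bij_betw_imp_surj_on[OF bij] by simp
    then show ?thesis unfolding \<phi>_def Q(1) by auto
  qed
  have inj: "\<phi> u = \<phi> v \<longleftrightarrow> (\<lambda>i. u i - v i) \<in> K" for u v
    using inj_on_eq_iff[OF bij_betw_imp_inj_on[OF bij] qc qc] Q(4) unfolding \<phi>_def by blast
  have "\<phi> u \<in> carrier (N_mod \<nu>)" for u using bij_betw_imp_surj_on[OF bij] qc unfolding \<phi>_def by blast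
  then obtain z where "\<phi> (\<lambda>_. 0) = elt \<nu> z" unfolding carrier_N_mod by blast
  \<comment> \<open>Preservation of zero is not part of \<open>linear_maps\<close>; it follows from
    linearity at the scalar 0.\<close>
  then have zero: "\<phi> (\<lambda>_. 0) = elt \<nu> (\<lambda>_. 0)" using smult[of 0 "\<lambda>_. 0"] by (simp add: elt_smult)
  define e where "e c = (\<lambda>c'. if c' = c then 1 else 0 :: 'k fps)" for c :: nat
  have "\<forall>c. \<exists>u. \<phi> u = elt \<nu> (e c)" using surj by blast
  from choice[OF this] obtain b where b: "\<And>c. \<phi> (b c) = elt \<nu> (e c)" by blast
  have "lin \<nu> e r i = (if i < length \<nu> then r i else 0)" for r i
    unfolding e_def by (rule lin_units)
  then have le: "elt \<nu> (lin \<nu> e r) = elt \<nu> r" for r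
    by (intro elt_eqI) (simp add: cong_mod_def)
  have lin: "\<phi> (lin \<nu> b r) = elt \<nu> r" for r
    using additive_on_sum[of \<phi> \<nu> \<nu> b e, OF add smult b zero] le by simp
  have mem: "u \<in> K \<longleftrightarrow> \<phi> u = elt \<nu> (\<lambda>_. 0)" for u using inj[of u "\<lambda>_. 0"] zero by simp
  have "quotient_basis \<nu> K b" unfolding quotient_basis_def
  proof (intro conjI allI impI)
    fix j assume "j < length \<nu>"
    have "\<phi> (\<lambda>i. fps_X ^ (\<nu> ! j) * b j i) = elt \<nu> (\<lambda>c. fps_X ^ (\<nu> ! j) * e j c)"
      by (simp add: smult b elt_smult)
    also have "\<dots> = elt \<nu> (\<lambda>_. 0)" by (intro elt_eqI) (auto simp: cong_mod_def e_def)
    finally show "(\<lambda>i. fps_X ^ (\<nu> ! j) * b j i) \<in> K" by (simp add: mem)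
  next
    fix v
    have "\<phi> v \<in> carrier (N_mod \<nu>)" by fact
    then obtain r where "\<phi> v = elt \<nu> r" unfolding carrier_N_mod by blast
    then show "\<exists>r. (\<lambda>i. v i - lin \<nu> b r i) \<in> K" using lin[of r] inj[of v "lin \<nu> b r"] by auto
  next
    fix r assume "lin \<nu> b r \<in> K"
    then show "cong_mod \<nu> r (\<lambda>_. 0)" using lin[of r] mem by (simp add: elt_eq_iff)
  qed
  then show "\<exists>h. quotient_basis \<nu> K h" by blast
next
  let ?Q = "quotient_module (N_mod \<beta>) (elt \<beta> ` K)"
  let ?q = "residue_class \<beta> K"
  note Q = quotient_N_mod_simps[OF K]
  assume "\<exists>h. quotient_basis \<nu> K h"
  then obtain b where b: "\<And>j. j < length \<nu> \<Longrightarrow> (\<lambda>i. fps_X ^ (\<nu> ! j) * b j i) \<in> K"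
    and span: "\<And>v. \<exists>r. (\<lambda>i. v i - lin \<nu> b r i) \<in> K"
    and ind: "\<And>r. lin \<nu> b r \<in> K \<Longrightarrow> cong_mod \<nu> r (\<lambda>_. 0)" unfolding quotient_basis_def by blast
  obtain R where R: "\<And>v. (\<lambda>i. v i - lin \<nu> b (R v) i) \<in> K" using span by metis
  have uniq: "elt \<nu> r = elt \<nu> s" if "(\<lambda>i. u i - lin \<nu> b r i) \<in> K" "(\<lambda>i. v i - lin \<nu> b s i) \<in> K"
    "(\<lambda>i. u i - v i) \<in> K" for u v r s
  proof -
    have "(\<lambda>i. (v i - lin \<nu> b s i) - (u i - lin \<nu> b r i) + (u i - v i)) \<in> K"
      by (intro lattice_mod_add[OF K] lattice_mod_diff[OF K] that)
    then have "lin \<nu> b (\<lambda>c. r c - s c) \<in> K" by (simp add: lin_diff[abs_def])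
    then have "cong_mod \<nu> (\<lambda>c. r c - s c) (\<lambda>_. 0)" by (rule ind)
    then show ?thesis by (simp add: elt_eq_iff cong_mod_diff)
  qed
  \<comment> \<open>Both the representative of the class and its coordinates are chosen;
    \<open>uniq\<close> shows that the value depends on neither choice.\<close>
  define h where "h = (\<lambda>C\<in>carrier ?Q. elt \<nu> (R (SOME v. C = ?q v)))"
  have h: "h (?q v) = elt \<nu> r" if "(\<lambda>i. v i - lin \<nu> b r i) \<in> K" for v r
  proof -
    have "?q v = ?q (SOME v'. ?q v = ?q v')" by (rule someI[of "\<lambda>v'. ?q v = ?q v'"]) simp
    then have "(\<lambda>i. v i - (SOME v'. ?q v = ?q v') i) \<in> K" unfolding Q(4) .
    then have "elt \<nu> r = elt \<nu> (R (SOME v'. ?q v = ?q v'))" by (rule uniq[OF that R])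
    then show ?thesis by (simp add: h_def Q(1))
  qed
  have "h \<in> Hom_Lambda ?Q (N_mod \<nu>)"
    unfolding Hom_Lambda_def linear_maps_def
  proof (intro CollectI conjI ballI)
    show "h \<in> carrier ?Q \<rightarrow>\<^sub>E carrier (N_mod \<nu>)" by (simp add: h_def)
  next
    fix C D assume "C \<in> carrier ?Q" "D \<in> carrier ?Q"
    then obtain u v where uv: "C = ?q u" "D = ?q v" unfolding Q(1) by blast
    have "h (?q (\<lambda>i. u i + v i)) = elt \<nu> (\<lambda>c. R u c + R v c)"
      by (rule h) (use lattice_mod_add[OF K R[of u] R[of v]] in \<open>simp add: lin_add algebra_simps\<close>)
    then show "h (C \<oplus>\<^bsub>?Q\<^esub> D) = h C \<oplus>\<^bsub>N_mod \<nu>\<^esub> h D"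
      unfolding uv Q(2) by (simp add: h[OF R] elt_add)
  next
    fix s C assume "C \<in> carrier ?Q"
    then obtain u where u: "C = ?q u" unfolding Q(1) by blast
    have "h (?q (\<lambda>i. s * u i)) = elt \<nu> (\<lambda>c. s * R u c)"
      by (rule h) (use lattice_mod_smult[OF K R[of u], of s] in \<open>simp add: lin_smult algebra_simps\<close>)
    then show "h (s \<odot>\<^bsub>?Q\<^esub> C) = s \<odot>\<^bsub>N_mod \<nu>\<^esub> h C"
      unfolding u Q(3) by (simp add: h[OF R] elt_smult)
  qed
  moreover have "bij_betw h (carrier ?Q) (carrier (N_mod \<nu>))"
    unfolding bij_betw_def
  proof
    show "inj_on h (carrier ?Q)"
    proof (rule inj_onI)
      fix C D assume "C \<in> carrier ?Q" "D \<in> carrier ?Q" and eq: "h C = h D"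
      then obtain u v where uv: "C = ?q u" "D = ?q v" unfolding Q(1) by blast
      have "cong_mod \<nu> (R u) (R v)" using eq unfolding uv h[OF R] elt_eq_iff .
      then have "lin \<nu> b (\<lambda>c. R u c - R v c) \<in> K"
        by (intro cong_mod_lin[OF b K]) (auto simp: cong_mod_diff)
      then have "(\<lambda>i. (u i - lin \<nu> b (R u) i) - (v i - lin \<nu> b (R v) i) + lin \<nu> b (\<lambda>c. R u c - R v c) i) \<in> K"
        by (intro lattice_mod_add[OF K] lattice_mod_diff[OF K] R)
      then have "(\<lambda>i. u i - v i) \<in> K" by (simp add: lin_diff)
      then show "C = D" unfolding uv Q(4) .
    qed
    show "h ` carrier ?Q = carrier (N_mod \<nu>)"
    proof
      show "h ` carrier ?Q \<subseteq> carrier (N_mod \<nu>)" by (auto simp: h_def)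
      show "carrier (N_mod \<nu>) \<subseteq> h ` carrier ?Q"
      proof
        fix x assume "x \<in> carrier (N_mod \<nu> :: ('k fps, nat \<Rightarrow> 'k fps set) module)"
        then obtain r where r: "x = elt \<nu> r" unfolding carrier_N_mod by blast
        have "h (?q (lin \<nu> b r)) = x" unfolding r by (rule h) (simp add: lattice_mod_0[OF K])
        then show "x \<in> h ` carrier ?Q" unfolding Q(1) by blast
      qed
    qed
  qed
  ultimately show "has_type ?Q \<nu>" unfolding has_type_def module_isomorphic_def by blast
qed

section \<open>Homomorphisms as matrices\<close>

definition compatible_matrix :: "nat list \<Rightarrow> nat list \<Rightarrow> (nat \<Rightarrow> nat \<Rightarrow> 'k::field fps) \<Rightarrow> bool" where
  "compatible_matrix \<alpha> \<beta> g \<longleftrightarrow> (\<forall>c<length \<alpha>. \<forall>i<length \<beta>. fps_X ^ (\<beta> ! i) dvd fps_X ^ (\<alpha> ! c) * g c i)"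

text \<open>For a compatible matrix the choice of representative does not matter. The restriction to
  the carrier matches the extensional functions in \<open>Hom_Lambda\<close>, so that homomorphisms
  equal some \<open>hom_of\<close> literally.\<close>

definition hom_of :: "nat list \<Rightarrow> nat list \<Rightarrow> (nat \<Rightarrow> nat \<Rightarrow> 'k::field fps) \<Rightarrow>
    (nat \<Rightarrow> 'k fps set) \<Rightarrow> nat \<Rightarrow> 'k fps set" where
  "hom_of \<alpha> \<beta> g = (\<lambda>x\<in>carrier (N_mod \<alpha>). elt \<beta> (lin \<alpha> g (SOME u. x = elt \<alpha> u)))"

lemma hom_of_elt:
  assumes "compatible_matrix \<alpha> \<beta> g"
  shows "hom_of \<alpha> \<beta> g (elt \<alpha> u) = elt \<beta> (lin \<alpha> g u)"
proof -
  define v where "v = (SOME v. elt \<alpha> u = elt \<alpha> v)"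
  have "elt \<alpha> u = elt \<alpha> v" unfolding v_def by (rule someI[of "\<lambda>v. elt \<alpha> u = elt \<alpha> v"]) simp
  then have "cong_mod \<alpha> (\<lambda>c. v c - u c) (\<lambda>_. 0)" by (metis cong_mod_diff elt_eq_iff)
  then have "lin \<alpha> g (\<lambda>c. v c - u c) \<in> {u. cong_mod \<beta> u (\<lambda>_. 0)}"
    by (rule cong_mod_lin[OF _ lattice_mod_cong_zero, rotated])
      (use assms in \<open>auto simp: compatible_matrix_def cong_mod_def\<close>)
  then have "cong_mod \<beta> (lin \<alpha> g v) (lin \<alpha> g u)" by (simp add: lin_diff[abs_def] cong_mod_diff)
  then have "elt \<beta> (lin \<alpha> g v) = elt \<beta> (lin \<alpha> g u)" by (rule elt_eqI)
  moreover have "hom_of \<alpha> \<beta> g (elt \<alpha> u) = elt \<beta> (lin \<alpha> g v)"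
    unfolding hom_of_def v_def by simp
  ultimately show ?thesis by simp
qed

lemma hom_of_in_Hom_Lambda:
  assumes "compatible_matrix \<alpha> \<beta> g"
  shows "hom_of \<alpha> \<beta> g \<in> Hom_Lambda (N_mod \<alpha>) (N_mod \<beta>)"
  unfolding Hom_Lambda_def linear_maps_def
proof (intro CollectI conjI ballI)
  show "hom_of \<alpha> \<beta> g \<in> carrier (N_mod \<alpha>) \<rightarrow>\<^sub>E carrier (N_mod \<beta>)" by (simp add: hom_of_def)
qed (auto simp: carrier_N_mod elt_add elt_smult hom_of_elt[OF assms] lin_add[abs_def] lin_smult[abs_def])

lemma Hom_Lambda_hom_of:
  fixes f :: "(nat \<Rightarrow> 'k::field fps set) \<Rightarrow> nat \<Rightarrow> 'k fps set"
  assumes "f \<in> Hom_Lambda (N_mod \<alpha>) (N_mod \<beta>)"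
  obtains g where "compatible_matrix \<alpha> \<beta> g" "f = hom_of \<alpha> \<beta> g"
proof -
  have add: "f (elt \<alpha> (\<lambda>i. u i + v i)) = f (elt \<alpha> u) \<oplus>\<^bsub>N_mod \<beta>\<^esub> f (elt \<alpha> v)" for u v
    using assms unfolding Hom_Lambda_def linear_maps_def elt_add[symmetric] by auto
  have smult: "f (elt \<alpha> (\<lambda>i. r * u i)) = r \<odot>\<^bsub>N_mod \<beta>\<^esub> f (elt \<alpha> u)" for r u
    using assms unfolding Hom_Lambda_def linear_maps_def elt_smult[symmetric] by auto
  have ext: "f \<in> carrier (N_mod \<alpha>) \<rightarrow>\<^sub>E carrier (N_mod \<beta>)"
    using assms unfolding Hom_Lambda_def linear_maps_def by auto
  then have "f (elt \<alpha> u) \<in> carrier (N_mod \<beta>)" for u by (auto simp: PiE_iff)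
  then have ex: "\<exists>v. f (elt \<alpha> u) = elt \<beta> v" for u unfolding carrier_N_mod by blast
  define e where "e c = (\<lambda>c'. if c' = c then 1 else 0 :: 'k fps)" for c :: nat
  have "\<forall>c. \<exists>v. f (elt \<alpha> (e c)) = elt \<beta> v" using ex by blast
  from choice[OF this] obtain g where g: "\<And>c. f (elt \<alpha> (e c)) = elt \<beta> (g c)" by blast
  have zero: "f (elt \<alpha> (\<lambda>_. 0)) = elt \<beta> (\<lambda>_. 0)"
    using smult[of 0 "\<lambda>_. 0"] ex[of "\<lambda>_. 0"] by (auto simp: elt_smult)
  have "lin \<alpha> e r i = (if i < length \<alpha> then r i else 0)" for r i
    unfolding e_def by (rule lin_units)
  then have "elt \<alpha> (lin \<alpha> e r) = elt \<alpha> r" for r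
    by (intro elt_eqI) (simp add: cong_mod_def)
  then have f: "f (elt \<alpha> u) = elt \<beta> (lin \<alpha> g u)" for u
    using additive_on_sum[of "\<lambda>u. f (elt \<alpha> u)" \<beta> \<alpha> e g, OF add smult g zero] by metis
  have comp: "compatible_matrix \<alpha> \<beta> g"
    unfolding compatible_matrix_def
  proof (intro allI impI)
    fix c i assume ci: "c < length \<alpha>" "i < length \<beta>"
    have "elt \<alpha> (\<lambda>c'. fps_X ^ (\<alpha> ! c) * e c c') = elt \<alpha> (\<lambda>_. 0)"
      by (intro elt_eqI) (auto simp: cong_mod_def e_def)
    then have "elt \<beta> (\<lambda>i. fps_X ^ (\<alpha> ! c) * g c i) = elt \<beta> (\<lambda>_. 0)"
      using smult[of "fps_X ^ (\<alpha> ! c)" "e c"] g[of c] zero by (simp add: elt_smult)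
    then show "fps_X ^ (\<beta> ! i) dvd fps_X ^ (\<alpha> ! c) * g c i" using ci by (simp add: elt_eq_iff cong_mod_def)
  qed
  moreover have "f = hom_of \<alpha> \<beta> g"
  proof
    fix x show "f x = hom_of \<alpha> \<beta> g x"
    proof (cases "x \<in> carrier (N_mod \<alpha> :: ('k fps, nat \<Rightarrow> 'k fps set) module)")
      case True
      then show ?thesis by (auto simp: carrier_N_mod f hom_of_elt[OF comp])
    next
      case False
      then show ?thesis using ext by (auto simp: hom_of_def PiE_iff extensional_def)
    qed
  qed
  ultimately show ?thesis by (rule that)
qed

text \<open>The preimage, in the free module, of p^l A for the image A of the map with matrix
  g.\<close>

definition power_image_lattice ::
  "nat list \<Rightarrow> nat list \<Rightarrow> (nat \<Rightarrow> nat \<Rightarrow> 'k::field fps) \<Rightarrow> nat \<Rightarrow> (nat \<Rightarrow> 'k fps) set" where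
  "power_image_lattice \<alpha> \<beta> g l = {v. \<exists>u. cong_mod \<beta> v (\<lambda>i. fps_X ^ l * lin \<alpha> g u i)}"

lemma lattice_mod_power_image:
  fixes g :: "nat \<Rightarrow> nat \<Rightarrow> 'k::field fps"
  shows "lattice_mod \<beta> (power_image_lattice \<alpha> \<beta> g l)"
proof -
  let ?f = "\<lambda>a i. fps_X ^ l * lin \<alpha> g a i"
  have "\<exists>c. cong_mod \<beta> (\<lambda>i. u i + v i) (?f c)" if "cong_mod \<beta> u (?f a)" "cong_mod \<beta> v (?f b)" for u v a b
    using cong_mod_add[OF that] by (intro exI[of _ "\<lambda>c. a c + b c"]) (simp add: lin_add distrib_left)
  moreover have "\<exists>c. cong_mod \<beta> (\<lambda>i. r * u i) (?f c)" if "cong_mod \<beta> u (?f a)" for r u a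
    using cong_mod_smult[OF that, of r] by (intro exI[of _ "\<lambda>c. r * a c"]) (simp add: lin_smult mult.left_commute)
  moreover have "\<exists>c. cong_mod \<beta> u (?f c)" if "cong_mod \<beta> u (\<lambda>_. 0)" for u
    using that by (intro exI[of _ "\<lambda>_. 0"]) (simp add: lin_zero)
  ultimately show ?thesis unfolding lattice_mod_def power_image_lattice_def by blast
qed

lemma p_power_image_hom_of:
  assumes "compatible_matrix \<alpha> \<beta> g"
  shows "p_power_image (N_mod \<beta>) l (hom_of \<alpha> \<beta> g ` carrier (N_mod \<alpha>)) = elt \<beta> ` power_image_lattice \<alpha> \<beta> g l"
proof -
  have "p_power_image (N_mod \<beta>) l (hom_of \<alpha> \<beta> g ` carrier (N_mod \<alpha>)) =
      range (\<lambda>u. elt \<beta> (\<lambda>i. fps_X ^ l * lin \<alpha> g u i))"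
    unfolding p_power_image_def carrier_N_mod by (simp add: image_image hom_of_elt[OF assms] elt_smult)
  also have "\<dots> = elt \<beta> ` power_image_lattice \<alpha> \<beta> g l"
    unfolding power_image_lattice_def by (auto simp: elt_eq_iff image_iff simp flip: elt_eq_iff)
  finally show ?thesis .
qed

lemma image_hom_of:
  assumes "compatible_matrix \<alpha> \<beta> g"
  shows "hom_of \<alpha> \<beta> g ` carrier (N_mod \<alpha>) = elt \<beta> ` power_image_lattice \<alpha> \<beta> g 0"
  unfolding p_power_image_hom_of[OF assms, symmetric] p_power_image_def carrier_N_mod
  by (simp add: image_image hom_of_elt[OF assms] elt_smult)

section \<open>Counting dimensions\<close>

lemma fps_mult_nth_truncated:
  assumes "\<And>n. N \<le> n \<Longrightarrow> fps_nth f n = (0 :: 'k::field)"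
  shows "fps_nth (f * y) m = (\<Sum>n<N. fps_nth f n * fps_nth (fps_X ^ n * y) m)"
proof -
  have "f = (\<Sum>n<N. fps_const (fps_nth f n) * fps_X ^ n)"
  proof (rule fps_ext)
    fix k
    have "fps_nth (\<Sum>n<N. fps_const (fps_nth f n) * fps_X ^ n) k = (\<Sum>n<N. if n = k then fps_nth f n else 0)"
      unfolding fps_sum_nth by (intro sum.cong) auto
    also have "\<dots> = fps_nth f k" using assms[of k] by simp
    finally show "fps_nth f k = fps_nth (\<Sum>n<N. fps_const (fps_nth f n) * fps_X ^ n) k" by simp
  qed
  then have "f * y = (\<Sum>n<N. fps_const (fps_nth f n) * (fps_X ^ n * y))"
    by (metis (no_types, lifting) mult.assoc sum.cong sum_distrib_right)
  then show ?thesis by (simp add: fps_sum_nth)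
qed

text \<open>The pair (i, n) stands for p^n times the i-th generator; these elements form a k-basis
  of \<open>N_mod \<beta>\<close>.\<close>

definition list_index_set :: "nat list \<Rightarrow> (nat \<times> nat) set" where
  "list_index_set \<beta> = Sigma {..<length \<beta>} (\<lambda>i. {..<\<beta> ! i})"

lemma finite_list_index_set [simp]: "finite (list_index_set \<beta>)"
  by (simp add: list_index_set_def)

lemma card_list_index_set: "card (list_index_set \<beta>) = sum_list \<beta>"
  by (simp add: list_index_set_def sum_list_sum_nth lessThan_atLeast0)

text \<open>This passes from coefficients in \<Lambda> to coefficients in k: a combination of the
  vectors h_j with truncated power series is a finite k-combination of the shifts p^n h_j.\<close>

lemma lin_nth_sum:
  assumes "\<And>j n. j < length \<nu> \<Longrightarrow> \<nu> ! j \<le> n \<Longrightarrow> fps_nth (r j) n = 0"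
  shows "fps_nth (lin \<nu> h r i) m =
    (\<Sum>(j, n)\<in>list_index_set \<nu>. fps_nth (r j) n * fps_nth (fps_X ^ n * h j i) m)"
proof -
  have "fps_nth (lin \<nu> h r i) m = (\<Sum>j<length \<nu>. \<Sum>n<\<nu> ! j. fps_nth (r j) n * fps_nth (fps_X ^ n * h j i) m)"
    unfolding lin_def fps_sum_nth by (intro sum.cong refl fps_mult_nth_truncated assms) auto
  then show ?thesis by (simp add: list_index_set_def sum.Sigma)
qed

lemma dvd_fps_X_power_diff_cutoff: "fps_X ^ n dvd f - fps_cutoff n (f :: 'k::field fps)"
  by (simp add: fps_X_power_dvd_iff)

text \<open>The multiple of the c-th generator by p to the power \<open>\<alpha> ! c\<close> is
  zero, so after multiplication by p^l only the first \<open>\<alpha> ! c - l\<close> coefficients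
  of u_c count.\<close>

lemma power_image_lattice_cutoff:
  fixes g :: "nat \<Rightarrow> nat \<Rightarrow> 'k::field fps"
  assumes "compatible_matrix \<alpha> \<beta> g"
  shows "cong_mod \<beta> (\<lambda>i. fps_X ^ l * lin \<alpha> g u i)
    (\<lambda>i. fps_X ^ l * lin \<alpha> g (\<lambda>c. fps_cutoff (\<alpha> ! c - l) (u c)) i)"
proof -
  have "cong_mod \<alpha> (\<lambda>c. fps_X ^ l * (u c - fps_cutoff (\<alpha> ! c - l) (u c))) (\<lambda>_. 0)"
    unfolding cong_mod_def
  proof (intro allI impI)
    fix c assume "c < length \<alpha>"
    have "fps_X ^ (l + (\<alpha> ! c - l)) dvd fps_X ^ l * (u c - fps_cutoff (\<alpha> ! c - l) (u c))"
      unfolding power_add by (intro mult_dvd_mono dvd_refl dvd_fps_X_power_diff_cutoff)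
    moreover have "fps_X ^ (\<alpha> ! c) dvd (fps_X :: 'k fps) ^ (l + (\<alpha> ! c - l))" by (rule le_imp_power_dvd) simp
    ultimately show "fps_X ^ (\<alpha> ! c) dvd fps_X ^ l * (u c - fps_cutoff (\<alpha> ! c - l) (u c)) - 0"
      using dvd_trans by simp
  qed
  then have "lin \<alpha> g (\<lambda>c. fps_X ^ l * (u c - fps_cutoff (\<alpha> ! c - l) (u c))) \<in> {u. cong_mod \<beta> u (\<lambda>_. 0)}"
    by (rule cong_mod_lin[OF _ lattice_mod_cong_zero, rotated])
      (use assms in \<open>auto simp: compatible_matrix_def cong_mod_def\<close>)
  then show ?thesis
    by (simp add: cong_mod_def lin_smult lin_diff right_diff_distrib)
qed

text \<open>The dimension count: a family of \<open>sum_list \<beta>\<close> vectors spanning \<open>N_mod \<beta>\<close> over the field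
  is independent.\<close>

lemma quotient_basisI:
  fixes g h :: "nat \<Rightarrow> nat \<Rightarrow> 'k::field fps" and l :: nat
  assumes comp: "compatible_matrix \<alpha> \<beta> g"
  defines "K \<equiv> power_image_lattice \<alpha> \<beta> g l"
  assumes gen: "\<And>j. j < length \<nu> \<Longrightarrow> (\<lambda>i. fps_X ^ (\<nu> ! j) * h j i) \<in> K"
    and span: "\<And>v. \<exists>r. (\<lambda>i. v i - lin \<nu> h r i) \<in> K"
    and count: "sum_list \<nu> + (\<Sum>c<length \<alpha>. \<alpha> ! c - l) \<le> sum_list \<beta>"
  shows "quotient_basis \<nu> K h"
    and "cong_mod \<beta> (\<lambda>i. fps_X ^ l * lin \<alpha> g u i) (\<lambda>_. 0) \<Longrightarrow> c < length \<alpha> \<Longrightarrow> n < \<alpha> ! c - l \<Longrightarrow>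
      fps_nth (u c) n = 0"
proof -
  have K: "lattice_mod \<beta> K" unfolding K_def by (rule lattice_mod_power_image)
  \<comment> \<open>Truncated subtraction is intended: generator c contributes the vectors p^(l+n)
    g_c with n < \<alpha>_c - l to the multiples of p^l, hence none if \<alpha>_c \<le> l.\<close>
  define A where "A = map (\<lambda>a. a - l) \<alpha>"
  have len: "length A = length \<alpha>" by (simp add: A_def)
  define J where "J = list_index_set \<nu> <+> list_index_set A"
  define z where "z k im = (case (k, im) of (Inl (j, n), (i, m)) \<Rightarrow> fps_nth (fps_X ^ n * h j i) m
      | (Inr (c, n), (i, m)) \<Rightarrow> fps_nth (fps_X ^ n * (fps_X ^ l * g c i)) m)"
    for k :: "nat \<times> nat + nat \<times> nat" and im :: "nat \<times> nat"
  define coef where "coef r a k = (case k of Inl (j, n) \<Rightarrow> fps_nth (r j) n | Inr (c, n) \<Rightarrow> fps_nth (a c) n)"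
    for r a :: "nat \<Rightarrow> 'k fps" and k
  have finJ: "finite J" by (simp add: J_def)
  have "sum_list A = (\<Sum>c<length \<alpha>. \<alpha> ! c - l)"
    by (simp add: A_def sum_list_sum_nth lessThan_atLeast0)
  then have cardJ: "card J \<le> card (list_index_set \<beta>)"
    using count by (simp add: J_def card_Plus card_list_index_set)
  define trunc where "trunc \<mu> r \<longleftrightarrow> (\<forall>j<length \<mu>. \<forall>n\<ge>\<mu> ! j. fps_nth (r j) n = 0)"
    for \<mu> and r :: "nat \<Rightarrow> 'k fps"
  have comb: "(\<Sum>k\<in>J. coef r a k * z k (i, m)) = fps_nth (lin \<nu> h r i + fps_X ^ l * lin \<alpha> g a i) m"
    if "trunc \<nu> r" "trunc A a" for r a i m
  proof -
    have "fps_X ^ l * lin \<alpha> g a i = lin A (\<lambda>c i. fps_X ^ l * g c i) a i"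
      by (simp add: lin_def len sum_distrib_left algebra_simps)
    moreover have "fps_nth (lin A (\<lambda>c i. fps_X ^ l * g c i) a i) m =
        (\<Sum>(c, n)\<in>list_index_set A. fps_nth (a c) n * fps_nth (fps_X ^ n * (fps_X ^ l * g c i)) m)"
      by (rule lin_nth_sum) (use that in \<open>auto simp: trunc_def\<close>)
    moreover have "fps_nth (lin \<nu> h r i) m =
        (\<Sum>(j, n)\<in>list_index_set \<nu>. fps_nth (r j) n * fps_nth (fps_X ^ n * h j i) m)"
      by (rule lin_nth_sum) (use that in \<open>auto simp: trunc_def\<close>)
    ultimately show ?thesis
      unfolding J_def by (simp add: sum.Plus coef_def z_def case_prod_unfold)
  qed
  define cut where "cut \<mu> r = (\<lambda>j. fps_cutoff (\<mu> ! j) (r j))" for \<mu> and r :: "nat \<Rightarrow> 'k fps"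
  have trunc_cut: "trunc \<mu> (cut \<mu> r)" for \<mu> r by (simp add: trunc_def cut_def)
  have cutA: "cong_mod \<beta> (\<lambda>i. fps_X ^ l * lin \<alpha> g a i) (\<lambda>i. fps_X ^ l * lin \<alpha> g (cut A a) i)" for a
  proof -
    have "lin \<alpha> g (cut A a) = lin \<alpha> g (\<lambda>c. fps_cutoff (\<alpha> ! c - l) (a c))"
      by (intro ext) (simp add: lin_def cut_def A_def)
    then show ?thesis using power_image_lattice_cutoff[OF comp] by metis
  qed
  have memK: "\<exists>a. cong_mod \<beta> v (\<lambda>i. fps_X ^ l * lin \<alpha> g (cut A a) i)" if "v \<in> K" for v
  proof -
    obtain a where "cong_mod \<beta> v (\<lambda>i. fps_X ^ l * lin \<alpha> g a i)"
      using \<open>v \<in> K\<close> unfolding K_def power_image_lattice_def by blast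
    then show ?thesis using cutA[of a] by (metis elt_eq_iff)
  qed
  have cut_lin: "(\<lambda>i. lin \<nu> h r i - lin \<nu> h (cut \<nu> r) i) \<in> K" for r
  proof -
    have "lin \<nu> h (\<lambda>j. r j - cut \<nu> r j) \<in> K"
      by (rule cong_mod_lin[OF gen K]) (auto simp: cong_mod_def cut_def dvd_fps_X_power_diff_cutoff)
    then show ?thesis by (simp add: lin_diff[abs_def])
  qed
  have spanJ: "\<exists>b. \<forall>im\<in>list_index_set \<beta>. u im = (\<Sum>k\<in>J. b k * z k im)" for u :: "nat \<times> nat \<Rightarrow> 'k"
  proof -
    define v where "v i = Abs_fps (\<lambda>m. u (i, m))" for i
    obtain r where r: "(\<lambda>i. v i - lin \<nu> h r i) \<in> K" using span by blast
    have "(\<lambda>i. (v i - lin \<nu> h r i) + (lin \<nu> h r i - lin \<nu> h (cut \<nu> r) i)) \<in> K"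
      by (rule lattice_mod_add[OF K r cut_lin])
    then obtain a where a: "cong_mod \<beta> (\<lambda>i. v i - lin \<nu> h (cut \<nu> r) i) (\<lambda>i. fps_X ^ l * lin \<alpha> g (cut A a) i)"
      using memK by auto
    have "u (i, m) = (\<Sum>k\<in>J. coef (cut \<nu> r) (cut A a) k * z k (i, m))" if "i < length \<beta>" "m < \<beta> ! i" for i m
    proof -
      have "fps_nth (v i - lin \<nu> h (cut \<nu> r) i - fps_X ^ l * lin \<alpha> g (cut A a) i) m = 0"
        using a that unfolding cong_mod_def fps_X_power_dvd_iff by blast
      then show ?thesis unfolding comb[OF trunc_cut trunc_cut] by (simp add: v_def diff_eq_eq add.commute)
    qed
    then show ?thesis
      by (intro exI[of _ "coef (cut \<nu> r) (cut A a)"]) (auto simp: list_index_set_def)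
  qed
  \<comment> \<open>The two families together span and are no larger than the dimension, hence are
    independent. The r-part gives the basis of the quotient, the a-part the second
    conclusion.\<close>
  have indJ: "(\<forall>j<length \<nu>. \<forall>n<\<nu> ! j. fps_nth (r j) n = 0) \<and> (\<forall>c<length \<alpha>. \<forall>n<\<alpha> ! c - l. fps_nth (a c) n = 0)"
    if "trunc \<nu> r" "trunc A a" and zero: "cong_mod \<beta> (\<lambda>i. lin \<nu> h r i + fps_X ^ l * lin \<alpha> g a i) (\<lambda>_. 0)" for r a
  proof -
    have z0: "(\<Sum>k\<in>J. coef r a k * z k im) = 0" if "im \<in> list_index_set \<beta>" for im
    proof -
      obtain i m where im: "im = (i, m)" "i < length \<beta>" "m < \<beta> ! i" using \<open>im \<in> _\<close> by (auto simp: list_index_set_def)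
      then have "fps_nth (lin \<nu> h r i + fps_X ^ l * lin \<alpha> g a i) m = 0"
        using zero unfolding cong_mod_zero_iff by blast
      then show ?thesis unfolding im comb[OF \<open>trunc \<nu> r\<close> \<open>trunc A a\<close>] .
    qed
    have "coef r a k = 0" if "k \<in> J" for k
      by (rule spanning_family_independent[OF finite_list_index_set finJ cardJ spanJ z0 that])
    then have 1: "coef r a (Inl jn) = 0" if "jn \<in> list_index_set \<nu>" for jn using that by (auto simp: J_def)
    have 2: "coef r a (Inr jn) = 0" if "jn \<in> list_index_set A" for jn
      using that \<open>\<And>k. k \<in> J \<Longrightarrow> coef r a k = 0\<close> by (auto simp: J_def)
    show ?thesis using 1 2 by (auto simp: list_index_set_def coef_def A_def)
  qed
  show "quotient_basis \<nu> K h" unfolding quotient_basis_def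
  proof (intro conjI allI impI)
    fix r assume "lin \<nu> h r \<in> K"
    then have "(\<lambda>i. lin \<nu> h r i - (lin \<nu> h r i - lin \<nu> h (cut \<nu> r) i)) \<in> K"
      using cut_lin by (rule lattice_mod_diff[OF K])
    then obtain a where "cong_mod \<beta> (lin \<nu> h (cut \<nu> r)) (\<lambda>i. fps_X ^ l * lin \<alpha> g (cut A a) i)"
      using memK by auto
    then have "cong_mod \<beta> (\<lambda>i. lin \<nu> h (cut \<nu> r) i + fps_X ^ l * lin \<alpha> g (\<lambda>c. - 1 * cut A a c) i) (\<lambda>_. 0)"
      unfolding lin_smult by (simp add: cong_mod_def)
    moreover have "trunc A (\<lambda>c. - 1 * cut A a c)" using trunc_cut[of A a] by (simp add: trunc_def)
    ultimately have "\<forall>j<length \<nu>. \<forall>n<\<nu> ! j. fps_nth (cut \<nu> r j) n = 0"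
      using indJ[OF trunc_cut] by blast
    then show "cong_mod \<nu> r (\<lambda>_. 0)" unfolding cong_mod_zero_iff by (simp add: cut_def)
  qed (use gen span in blast)+
  show "fps_nth (u c) n = 0"
    if zero: "cong_mod \<beta> (\<lambda>i. fps_X ^ l * lin \<alpha> g u i) (\<lambda>_. 0)" and "c < length \<alpha>" "n < \<alpha> ! c - l"
  proof -
    have "cong_mod \<beta> (\<lambda>i. lin \<nu> h (\<lambda>_. 0) i + fps_X ^ l * lin \<alpha> g (cut A u) i) (\<lambda>_. 0)"
      using cong_mod_trans[OF cong_mod_sym[OF cutA[of u]] zero] by (simp add: lin_zero)
    moreover have "trunc \<nu> (\<lambda>_. 0)" by (simp add: trunc_def)
    ultimately have "fps_nth (cut A u c) n = 0" using indJ trunc_cut that by blast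
    then show ?thesis using that by (simp add: cut_def A_def)
  qed
qed

section \<open>Tableaux read off from witnesses of boxes\<close>

lemma filter_pos_eq_takeWhile:
  "sorted_wrt (\<ge>) xs \<Longrightarrow> filter ((<) 0) xs = takeWhile ((<) (0::nat)) xs"
  by (induction xs) (auto simp: filter_empty_conv)

text \<open>The heights decrease, so removing zeros only cuts off a tail. Parts keep the index of
  their column in \<beta>, and one indexing serves all levels.\<close>

lemma tableau_of_nth:
  assumes \<beta>: "is_partition \<beta>"
  shows "length (tableau_of \<beta> w l) \<le> length \<beta>"
    and "j < length (tableau_of \<beta> w l) \<Longrightarrow> tableau_of \<beta> w l ! j = column_height \<beta> w l j"
    and "length (tableau_of \<beta> w l) \<le> j \<Longrightarrow> j < length \<beta> \<Longrightarrow> column_height \<beta> w l j = 0"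
proof -
  let ?xs = "map (column_height \<beta> w l) [0..<length \<beta>]"
  have "sorted_wrt (\<ge>) ?xs" by (simp add: sorted_wrt_iff_nth_less column_height_antimono[OF \<beta>])
  then have tab: "tableau_of \<beta> w l = takeWhile ((<) 0) ?xs"
    unfolding tableau_of_def by (rule filter_pos_eq_takeWhile)
  show len: "length (tableau_of \<beta> w l) \<le> length \<beta>"
    using length_takeWhile_le[of "(<) 0" ?xs] unfolding tab by simp
  show "tableau_of \<beta> w l ! j = column_height \<beta> w l j" if j: "j < length (tableau_of \<beta> w l)"
    using takeWhile_nth[of j "(<) 0" ?xs] j len unfolding tab by simp
  show "column_height \<beta> w l j = 0" if j: "length (tableau_of \<beta> w l) \<le> j" "j < length \<beta>"
  proof -
    let ?n = "length (tableau_of \<beta> w l)"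
    have "\<not> 0 < ?xs ! ?n"
      using nth_length_takeWhile[of "(<) 0" ?xs] j unfolding tab by simp
    then have "column_height \<beta> w l ?n = 0" using j by simp
    moreover have "column_height \<beta> w l j \<le> column_height \<beta> w l ?n"
      using column_height_antimono[OF \<beta>, of ?n j] j by (cases "?n = j") auto
    ultimately show ?thesis by simp
  qed
qed

text \<open>The combinatorial form of dim B/p^l A + dim p^l A = dim B: the boxes missing at level l
  have entries above l, and by the content there are as many of them as boxes of \<alpha> below row
  l.\<close>

lemma sum_list_tableau_of:
  assumes \<beta>: "is_partition \<beta>" and corner: "corner_word \<beta> w" and content: "has_content \<alpha> w"
  shows "sum_list (tableau_of \<beta> w l) + (\<Sum>c<length \<alpha>. \<alpha> ! c - l) = sum_list \<beta>"
proof -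
  obtain M0 where M0: "\<And>x. M0 < x \<Longrightarrow> w x = 0" using corner_word_finite[OF corner] by blast
  \<comment> \<open>Large enough to bound all rows, entries and sizes involved, so that sums up to M
    are totals.\<close>
  define M where "M = M0 + sum_list \<beta> + sum_list \<alpha> + sum_list (tableau_of \<beta> w l) + l + (\<Sum>x\<le>M0. w x)"
  have supp: "w x = 0" if "M < x" for x using M0[of x] that by (simp add: M_def)
  have wM: "w x \<le> M" for x
    using M0[of x] member_le_sum[of x "{..M0}" w] by (cases "x \<le> M0") (auto simp: M_def)
  have tot: "(\<Sum>x=1..M. conj_part \<nu> x) = sum_list \<nu>" if "sum_list \<nu> \<le> M" for \<nu>
  proof -
    have "min h M = h" if "h \<in> set \<nu>" for h
      using member_le_sum_list[OF that] \<open>sum_list \<nu> \<le> M\<close> by simp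
    then have "map (\<lambda>h. min h M) \<nu> = \<nu>" by (simp add: map_idI)
    then show ?thesis unfolding sum_conj_part_eq by simp
  qed
  have 1: "sum_list (tableau_of \<beta> w l) + tally w M {l<..} = sum_list \<beta>"
    using sum_conj_part_encodes[OF encodes_tableau_of[OF \<beta> corner], of l M]
      tot[of \<beta>] tot[of "tableau_of \<beta> w l"] by (simp add: M_def)
  have "(\<Sum>c<length \<alpha>. \<alpha> ! c - l) + (\<Sum>x=1..l. conj_part \<alpha> x) = (\<Sum>x=1..M. conj_part \<alpha> x)"
  proof -
    have "(\<Sum>c<length \<alpha>. \<alpha> ! c - l) + (\<Sum>h\<leftarrow>\<alpha>. min h l) = sum_list \<alpha>"
      by (simp add: sum_list_sum_nth lessThan_atLeast0 sum.distrib[symmetric])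
        (intro sum.cong, auto)
    then show ?thesis using tot[of \<alpha>] sum_conj_part_eq[of \<alpha> l] by (simp add: M_def)
  qed
  moreover have "(\<Sum>x=1..M. conj_part \<alpha> x) = (\<Sum>x=1..l. conj_part \<alpha> x) + (\<Sum>x\<in>{l<..M}. conj_part \<alpha> x)"
  proof -
    have "{1..M} = {1..l} \<union> {l<..M}" by (auto simp: M_def)
    moreover have "{1..l} \<inter> {l<..M} = {}" by auto
    ultimately show ?thesis using sum.union_disjoint[of "{1..l}" "{l<..M}" "conj_part \<alpha>"] by simp
  qed
  moreover have "(\<Sum>x\<in>{l<..M}. conj_part \<alpha> x) = tally w M {l<..}"
  proof -
    have "conj_part \<alpha> e = tally w M {e}" if "e \<in> {l<..M}" for e
      using that content card_entries_eq_tally[of M w e, OF supp] unfolding has_content_def by simp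
    then have "(\<Sum>x\<in>{l<..M}. conj_part \<alpha> x) = (\<Sum>e\<in>{l<..M}. tally w M {e})" by (rule sum.cong[OF refl])
    moreover have "{l<..M} = {l<..} \<inter> {..M}" by auto
    moreover have "(\<Sum>e\<in>{l<..} \<inter> {..M}. tally w M {e}) = tally w M {l<..}"
      by (rule tally_eq_sum[symmetric]) (rule wM)
    ultimately show ?thesis by simp
  qed
  ultimately show ?thesis using 1 by linarith
qed

lemma lin_mem_power_image_lattice: "lin \<alpha> g u \<in> power_image_lattice \<alpha> \<beta> g 0"
  unfolding power_image_lattice_def by (auto intro: exI[of _ u])

text \<open>Column \<open>i\<close> of the result is supported on the boxes of the word, with entries indexed by rows.\<close>

definition column_matrix :: "nat list \<Rightarrow> (nat \<Rightarrow> nat) \<Rightarrow> (nat \<Rightarrow> nat \<Rightarrow> 'k::field fps) \<Rightarrow> nat \<Rightarrow> nat \<Rightarrow> 'k fps" where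
  "column_matrix \<beta> w M c i = (if 0 < box_entry \<beta> w i then M c (\<beta> ! i) else 0)"

lemma box_entry_pos:
  assumes "0 < box_entry \<beta> w i"
  shows "box_entry \<beta> w i = w (\<beta> ! i)" "0 < w (\<beta> ! i)" "i = conj_part \<beta> (\<beta> ! i) - 1"
  using assms by (auto simp: box_entry_def split: if_splits)

lemma lin_column_matrix:
  "lin \<alpha> (column_matrix \<beta> w M) u i =
    (if 0 < box_entry \<beta> w i then (\<Sum>c<length \<alpha>. u c * M c (\<beta> ! i)) else 0)"
  by (simp add: lin_def column_matrix_def)

text \<open>Here \<open>z x'\<close> is the component in the column that ends with the box of row
  x'. This column has length x', so divisibility by p^x' means that the component is zero. Dividing
  z by p^(x-1) leaves a unit in row x and otherwise only components in longer columns, which makes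
  the witnesses triangular.\<close>

definition box_witness :: "(nat \<Rightarrow> nat) \<Rightarrow> nat \<Rightarrow> (nat \<Rightarrow> 'k::field fps) \<Rightarrow> bool" where
  "box_witness w x z \<longleftrightarrow> (\<exists>y. fps_nth y 0 \<noteq> 0 \<and> z x = fps_X ^ (x - 1) * y) \<and>
    (\<forall>x'. 0 < w x' \<longrightarrow> x' \<noteq> x \<longrightarrow> fps_X ^ x' dvd z x' \<or> x < x' \<and> fps_X ^ (x - 1) dvd z x')"

text \<open>Each box of entry \<open>e\<close> in row \<open>x\<close> is witnessed by an element of \<open>p\<^sup>e\<^sup>-\<^sup>1 A\<close> of height
  exactly \<open>x - 1\<close>. Such elements span as many composition factors as \<open>A\<close> has, so they determine
  the tableau.\<close>

lemma VV_tableau_column_matrix: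
  fixes M :: "nat \<Rightarrow> nat \<Rightarrow> 'k::field fps"
  assumes \<beta>: "is_partition \<beta>" and corner: "corner_word \<beta> w" and content: "has_content \<alpha> w"
    and compat: "\<And>c x. c < length \<alpha> \<Longrightarrow> 0 < w x \<Longrightarrow> fps_X ^ x dvd fps_X ^ (\<alpha> ! c) * M c x"
    and wit: "\<And>x. 0 < w x \<Longrightarrow> \<exists>u. box_witness w x (\<lambda>x'. fps_X ^ (w x - 1) * (\<Sum>c<length \<alpha>. u c * M c x'))"
  shows "hom_of \<alpha> \<beta> (column_matrix \<beta> w M) \<in> VV_tableau \<alpha> \<beta> (tableau_of \<beta> w 0) (tableau_of \<beta> w)"
proof -
  let ?g = "column_matrix \<beta> w M"
  have comp: "compatible_matrix \<alpha> \<beta> ?g"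
    using compat box_entry_pos by (auto simp: compatible_matrix_def column_matrix_def)
  \<comment> \<open>A witness divided by p^(x-1), where x is the length of column k. It has a unit
    constant term in column k and is zero in every other column that is not longer.\<close>
  define lifts where "lifts k y \<longleftrightarrow>
      (\<exists>u. cong_mod \<beta> (\<lambda>i. fps_X ^ (\<beta> ! k - 1) * y i) (\<lambda>i. fps_X ^ (w (\<beta> ! k) - 1) * lin \<alpha> ?g u i)) \<and>
      fps_nth (y k) 0 \<noteq> 0 \<and> (\<forall>i<length \<beta>. i \<noteq> k \<longrightarrow> \<beta> ! i \<le> \<beta> ! k \<longrightarrow> y i = 0)" for k y
  have ex: "\<exists>y. lifts k y"
    if k: "0 < box_entry \<beta> w k" for k
  proof -
    define x where "x = \<beta> ! k"
    note kx = box_entry_pos[OF k, folded x_def]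
    obtain u where u: "box_witness w x (\<lambda>x'. fps_X ^ (w x - 1) * (\<Sum>c<length \<alpha>. u c * M c x'))"
      using wit[OF kx(2)] by blast
    define z where "z x' = fps_X ^ (w x - 1) * (\<Sum>c<length \<alpha>. u c * M c x')" for x'
    obtain y where y: "fps_nth y 0 \<noteq> 0" "z x = fps_X ^ (x - 1) * y"
      and oth: "\<And>x'. 0 < w x' \<Longrightarrow> x' \<noteq> x \<Longrightarrow> fps_X ^ x' dvd z x' \<or> x < x' \<and> fps_X ^ (x - 1) dvd z x'"
      using u unfolding box_witness_def z_def[symmetric] by blast
    \<comment> \<open>The quotient is set to 0 where the component is already trivial, so that the
      vanishing of Y in the other columns that are not longer holds exactly and not only modulo the
      relations.\<close>
    have "\<forall>x'. \<exists>q. 0 < w x' \<longrightarrow> x' \<noteq> x \<longrightarrow> (fps_X ^ x' dvd z x' \<and> q = 0) \<or> (x < x' \<and> z x' = fps_X ^ (x - 1) * q)"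
      using oth unfolding dvd_def by metis
    then obtain q where q: "\<And>x'. 0 < w x' \<Longrightarrow> x' \<noteq> x \<Longrightarrow>
        (fps_X ^ x' dvd z x' \<and> q x' = 0) \<or> (x < x' \<and> z x' = fps_X ^ (x - 1) * q x')" by metis
    define Y where "Y i = (if 0 < box_entry \<beta> w i then (if \<beta> ! i = x then y else q (\<beta> ! i)) else 0)" for i
    have same: "i = k" if "0 < box_entry \<beta> w i" "\<beta> ! i = x" for i
      using box_entry_pos(3)[OF that(1)] kx(3) that(2) by simp
    have "cong_mod \<beta> (\<lambda>i. fps_X ^ (x - 1) * Y i) (\<lambda>i. fps_X ^ (w x - 1) * lin \<alpha> ?g u i)"
      unfolding cong_mod_def
    proof (intro allI impI)
      fix i
      have "fps_X ^ (\<beta> ! i) dvd fps_X ^ (x - 1) * Y i - z (\<beta> ! i)" if b: "0 < box_entry \<beta> w i"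
      proof (cases "\<beta> ! i = x")
        case True
        then show ?thesis using y b by (simp add: Y_def)
      next
        case False
        then show ?thesis using q[OF box_entry_pos(2)[OF b] False] b by (auto simp: Y_def)
      qed
      then show "fps_X ^ (\<beta> ! i) dvd fps_X ^ (x - 1) * Y i - fps_X ^ (w x - 1) * lin \<alpha> ?g u i"
        by (cases "0 < box_entry \<beta> w i") (simp_all add: lin_column_matrix z_def Y_def)
    qed
    moreover have "fps_nth (Y k) 0 \<noteq> 0" using y k by (simp add: Y_def x_def)
    moreover have "Y i = 0" if "i \<noteq> k" "\<beta> ! i \<le> x" for i
    proof (cases "0 < box_entry \<beta> w i")
      case True
      then have "\<beta> ! i \<noteq> x" using same that by blast
      then show ?thesis using q[OF box_entry_pos(2)[OF True]] that by (auto simp: Y_def)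
    qed (simp add: Y_def)
    ultimately show ?thesis unfolding lifts_def x_def by blast
  qed
  define Y where "Y k = (SOME y. lifts k y)" for k
  have Y: "lifts k (Y k)" if "0 < box_entry \<beta> w k" for k
    unfolding Y_def by (rule someI_ex[OF ex[OF that]])
  have main: "\<exists>h. quotient_basis (tableau_of \<beta> w l) (power_image_lattice \<alpha> \<beta> ?g l) h \<and>
      (\<forall>u c n. cong_mod \<beta> (\<lambda>i. fps_X ^ l * lin \<alpha> ?g u i) (\<lambda>_. 0) \<longrightarrow> c < length \<alpha> \<longrightarrow> n < \<alpha> ! c - l \<longrightarrow>
        fps_nth (u c) n = 0)" for l
  proof -
    let ?\<nu> = "tableau_of \<beta> w l" and ?K = "power_image_lattice \<alpha> \<beta> ?g l"
    have K: "lattice_mod \<beta> ?K" by (rule lattice_mod_power_image)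
    define e where "e k = (\<lambda>i. if i = k then 1 else 0 :: 'k fps)" for k :: nat
    \<comment> \<open>A column shortened at level l takes its witness instead of the unit vector:
      the multiple by p^(x-1) lies in p^(w x - 1) A, hence in p^l A because l < \<open>w x\<close>.
      The same witnesses serve every level.\<close>
    define h where "h k = (if l < box_entry \<beta> w k then Y k else e k)" for k
    have hK: "(\<lambda>i. fps_X ^ column_height \<beta> w l k * h k i) \<in> ?K" if "k < length \<beta>" for k
    proof (cases "l < box_entry \<beta> w k")
      case True
      then have k: "0 < box_entry \<beta> w k" by simp
      obtain u where u: "cong_mod \<beta> (\<lambda>i. fps_X ^ (\<beta> ! k - 1) * Y k i) (\<lambda>i. fps_X ^ (w (\<beta> ! k) - 1) * lin \<alpha> ?g u i)"
        using Y[OF k] unfolding lifts_def by blast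
      have "w (\<beta> ! k) - 1 = l + (w (\<beta> ! k) - 1 - l)" using True box_entry_pos(1)[OF k] by simp
      then have "fps_X ^ (w (\<beta> ! k) - 1) = (fps_X :: 'k fps) ^ l * fps_X ^ (w (\<beta> ! k) - 1 - l)"
        by (metis power_add)
      then have "(\<lambda>i. fps_X ^ (w (\<beta> ! k) - 1) * lin \<alpha> ?g u i) =
          (\<lambda>i. fps_X ^ l * lin \<alpha> ?g (\<lambda>c. fps_X ^ (w (\<beta> ! k) - 1 - l) * u c) i)"
        unfolding lin_smult by (simp add: mult.assoc)
      then have "(\<lambda>i. fps_X ^ (\<beta> ! k - 1) * Y k i) \<in> ?K"
        using u unfolding power_image_lattice_def by auto
      then show ?thesis using True by (simp add: h_def column_height_def)
    next
      case False
      then have "cong_mod \<beta> (\<lambda>i. fps_X ^ column_height \<beta> w l k * h k i) (\<lambda>_. 0)"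
        using that by (auto simp: cong_mod_def h_def e_def column_height_def)
      then show ?thesis by (rule lattice_mod_zero[OF K])
    qed
    let ?S = "power_image_lattice \<beta> \<beta> h 0"
    have S: "lattice_mod \<beta> ?S" by (rule lattice_mod_power_image)
    have hS: "h k \<in> ?S" if "k < length \<beta>" for k
    proof -
      have "lin \<beta> h (\<lambda>c. if c = k then 1 else 0) = h k" using lin_unit[OF that, of h 1] by auto
      then show ?thesis using lin_mem_power_image_lattice by metis
    qed
    \<comment> \<open>Ordered by column length, the passage from unit vectors to h is triangular
      with units on the diagonal; it is inverted starting with the longest columns.\<close>
    have eS: "e k \<in> ?S" if "k < length \<beta>" for k
      using that
    proof (induction "sum_list \<beta> - \<beta> ! k" arbitrary: k rule: less_induct)
      case less
      show ?case
      proof (cases "l < box_entry \<beta> w k")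
        case True
        then have k: "0 < box_entry \<beta> w k" by simp
        have Yk: "fps_nth (Y k k) 0 \<noteq> 0" "\<And>i. i < length \<beta> \<Longrightarrow> i \<noteq> k \<Longrightarrow> \<beta> ! i \<le> \<beta> ! k \<Longrightarrow> Y k i = 0"
          using Y[OF k] unfolding lifts_def by blast+
        define T where "T = {i. i < length \<beta> \<and> \<beta> ! k < \<beta> ! i}"
        have "(\<lambda>i. \<Sum>j\<in>T. Y k j * e j i) \<in> ?S"
        proof (rule lattice_mod_sum[OF S])
          fix j assume "j \<in> T"
          then have j: "j < length \<beta>" "\<beta> ! k < \<beta> ! j" by (auto simp: T_def)
          moreover have "\<beta> ! j \<le> sum_list \<beta>" using j by (simp add: elem_le_sum_list)
          ultimately have "e j \<in> ?S" by (intro less.hyps) auto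
          then show "(\<lambda>i. Y k j * e j i) \<in> ?S" by (rule lattice_mod_smult[OF S])
        qed (simp add: T_def)
        then have "(\<lambda>i. h k i - (\<Sum>j\<in>T. Y k j * e j i)) \<in> ?S"
          by (rule lattice_mod_diff[OF S hS[OF less.prems]])
        then have "(\<lambda>i. inverse (Y k k) * (h k i - (\<Sum>j\<in>T. Y k j * e j i))) \<in> ?S"
          by (rule lattice_mod_smult[OF S])
        moreover have "cong_mod \<beta> (e k) (\<lambda>i. inverse (Y k k) * (h k i - (\<Sum>j\<in>T. Y k j * e j i)))"
          unfolding cong_mod_def
        proof (intro allI impI)
          fix i assume i: "i < length \<beta>"
          have "(\<Sum>j\<in>T. Y k j * e j i) = (\<Sum>j\<in>T. if j = i then Y k j else 0)"
            by (rule sum.cong) (auto simp: e_def)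
          also have "\<dots> = (if i \<in> T then Y k i else 0)" by (simp add: T_def)
          finally have sT: "(\<Sum>j\<in>T. Y k j * e j i) = (if i \<in> T then Y k i else 0)" .
          have "Y k i = 0" if "i \<notin> T" "i \<noteq> k" using Yk(2)[OF i] that i by (auto simp: T_def)
          then have "h k i - (\<Sum>j\<in>T. Y k j * e j i) = (if i = k then Y k k else 0)"
            unfolding sT using True by (auto simp: h_def T_def)
          then show "fps_X ^ (\<beta> ! i) dvd e k i - inverse (Y k k) * (h k i - (\<Sum>j\<in>T. Y k j * e j i))"
            using inverse_mult_eq_1[OF Yk(1)] by (simp add: e_def)
        qed
        ultimately show ?thesis by (rule lattice_mod_cong[OF S])
      next
        case False
        then show ?thesis using hS[OF less.prems] by (simp add: h_def)
      qed
    qed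
    have len: "length ?\<nu> \<le> length \<beta>" by (rule tableau_of_nth(1)[OF \<beta>])
    have span: "\<exists>r. (\<lambda>i. v i - lin ?\<nu> h r i) \<in> ?K" for v
    proof -
      have "(\<lambda>i. \<Sum>k<length \<beta>. v k * e k i) \<in> ?S"
        by (intro lattice_mod_sum[OF S] lattice_mod_smult[OF S] eS) auto
      moreover have "cong_mod \<beta> v (\<lambda>i. \<Sum>k<length \<beta>. v k * e k i)"
        using lin_units[of \<beta> v] by (simp add: cong_mod_def lin_def e_def)
      ultimately have "v \<in> ?S" by (rule lattice_mod_cong[OF S])
      then obtain r where r: "cong_mod \<beta> v (lin \<beta> h r)" by (auto simp: power_image_lattice_def)
      have "(\<lambda>i. \<Sum>k\<in>{length ?\<nu>..<length \<beta>}. r k * h k i) \<in> ?K"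
      proof (rule lattice_mod_sum[OF K])
        fix k assume k: "k \<in> {length ?\<nu>..<length \<beta>}"
        then have "column_height \<beta> w l k = 0" using tableau_of_nth(3)[OF \<beta>, of w l k] by simp
        then have "h k \<in> ?K" using hK[of k] k by simp
        then show "(\<lambda>i. r k * h k i) \<in> ?K" by (rule lattice_mod_smult[OF K])
      qed simp
      moreover have "cong_mod \<beta> (\<lambda>i. v i - lin ?\<nu> h r i) (\<lambda>i. \<Sum>k\<in>{length ?\<nu>..<length \<beta>}. r k * h k i)"
      proof -
        have "lin \<beta> h r i = lin ?\<nu> h r i + (\<Sum>k\<in>{length ?\<nu>..<length \<beta>}. r k * h k i)" for i
        proof -
          have "{..<length \<beta>} = {..<length ?\<nu>} \<union> {length ?\<nu>..<length \<beta>}" using len by auto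
          moreover have "{..<length ?\<nu>} \<inter> {length ?\<nu>..<length \<beta>} = {}" by auto
          ultimately show ?thesis unfolding lin_def by (simp add: sum.union_disjoint)
        qed
        then show ?thesis using r by (simp add: cong_mod_def algebra_simps)
      qed
      ultimately have "(\<lambda>i. v i - lin ?\<nu> h r i) \<in> ?K" by (rule lattice_mod_cong[OF K])
      then show ?thesis by blast
    qed
    have gen: "(\<lambda>i. fps_X ^ (?\<nu> ! j) * h j i) \<in> ?K" if "j < length ?\<nu>" for j
      using hK[of j] tableau_of_nth(2)[OF \<beta> that] that len by simp
    have count: "sum_list ?\<nu> + (\<Sum>c<length \<alpha>. \<alpha> ! c - l) \<le> sum_list \<beta>"
      using sum_list_tableau_of[OF \<beta> corner content, of l] by simp
    show ?thesis using quotient_basisI[OF comp gen span count] by blast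
  qed
  have ht: "has_type (quotient_module (N_mod \<beta>) (p_power_image (N_mod \<beta>) l (hom_of \<alpha> \<beta> ?g ` carrier (N_mod \<alpha>)))) (tableau_of \<beta> w l)" for l
    unfolding p_power_image_hom_of[OF comp] has_type_quotient_iff[OF lattice_mod_power_image] using main by blast
  have "inj_on (hom_of \<alpha> \<beta> ?g) (carrier (N_mod \<alpha>))"
  proof (rule inj_onI)
    fix a b assume "a \<in> carrier (N_mod \<alpha> :: ('k fps, nat \<Rightarrow> 'k fps set) module)"
      "b \<in> carrier (N_mod \<alpha> :: ('k fps, nat \<Rightarrow> 'k fps set) module)"
      and eq: "hom_of \<alpha> \<beta> ?g a = hom_of \<alpha> \<beta> ?g b"
    then obtain u v where uv: "a = elt \<alpha> u" "b = elt \<alpha> v" unfolding carrier_N_mod by blast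
    have "cong_mod \<beta> (lin \<alpha> ?g u) (lin \<alpha> ?g v)" using eq unfolding uv hom_of_elt[OF comp] elt_eq_iff .
    \<comment> \<open>Injectivity is the second conclusion of the dimension count at l = 0.\<close>
    then have "cong_mod \<beta> (\<lambda>i. fps_X ^ 0 * lin \<alpha> ?g (\<lambda>c. u c - v c) i) (\<lambda>_. 0)"
      by (simp add: lin_diff cong_mod_diff)
    then have "\<forall>c<length \<alpha>. \<forall>n<\<alpha> ! c - 0. fps_nth (u c - v c) n = 0" using main[of 0] by blast
    then have "cong_mod \<alpha> (\<lambda>c. u c - v c) (\<lambda>_. 0)" unfolding cong_mod_zero_iff by simp
    then show "a = b" unfolding uv elt_eq_iff cong_mod_diff .
  qed
  moreover have "module_isomorphic (quotient_module (N_mod \<beta>) (hom_of \<alpha> \<beta> ?g ` carrier (N_mod \<alpha>))) (N_mod (tableau_of \<beta> w 0))"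
    using ht[of 0, unfolded p_power_image_hom_of[OF comp]] unfolding has_type_def image_hom_of[OF comp] .
  ultimately show ?thesis
    unfolding VV_tableau_def VV_def embedding_has_tableau_def using ht hom_of_in_Hom_Lambda[OF comp] by blast
qed

section \<open>A one-parameter family for an exchange\<close>

text \<open>Occurrences count from 1, generators from 0: the box in row x belongs to the chain of
  generator \<open>occurrence u x - 1\<close>.\<close>

definition occurrence :: "(nat \<Rightarrow> nat) \<Rightarrow> nat \<Rightarrow> nat" where
  "occurrence u x = tally u x {u x}"

lemma occurrence_pos: "1 \<le> occurrence u x"
  by (cases x) (simp_all add: occurrence_def tally_0 tally_Suc)

lemma occurrence_le:
  assumes "u x = s" "occurrence u x \<le> tally u m {s}"
  shows "x \<le> m"
proof (rule ccontr)
  assume "\<not> x \<le> m"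
  then obtain y where y: "x = Suc y" "m \<le> y" by (cases x) auto
  then have "tally u m {s} \<le> tally u y {s}" by (intro tally_mono)
  then show False using assms y by (simp add: occurrence_def tally_Suc)
qed

lemma occurrence_inj: "u x = u y \<Longrightarrow> occurrence u x = occurrence u y \<Longrightarrow> x = y"
  using occurrence_le[of u x "u y" y] occurrence_le[of u y "u x" x] by (simp add: occurrence_def)

lemma occurrence_exists:
  assumes "1 \<le> k" "k \<le> tally u m {s}"
  obtains x where "x \<le> m" "u x = s" "occurrence u x = k"
proof -
  define x where "x = (LEAST x. k \<le> tally u x {s})"
  have x: "k \<le> tally u x {s}" "x \<le> m"
    using LeastI[of "\<lambda>x. k \<le> tally u x {s}" m] Least_le[of "\<lambda>x. k \<le> tally u x {s}" m] assms(2)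
    unfolding x_def by auto
  have min: "tally u y {s} < k" if "y < x" for y
    using not_less_Least[of y "\<lambda>x. k \<le> tally u x {s}"] that unfolding x_def by simp
  have "u x = s \<and> tally u x {s} = k"
  proof (cases x)
    case 0
    then show ?thesis using x assms(1) by (cases "u 0 = s") (auto simp: tally_0)
  next
    case (Suc y)
    then show ?thesis using x min[of y] by (cases "u (Suc y) = s") (auto simp: tally_Suc)
  qed
  then show ?thesis using that x by (auto simp: occurrence_def)
qed

text \<open>The lattice condition places the c-th occurrence of s' above the c-th occurrence of s' +
  1. Descending from \<open>u y\<close> to s costs at least one row per step.\<close>

lemma chain_increasing:
  assumes bal: "ballot u" and x: "u x = s" "1 \<le> s" and "s < u y" "occurrence u y = occurrence u x"
  shows "x < y \<and> x + u y \<le> y + s"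
  using assms(4,5)
proof (induction "u y" arbitrary: y rule: less_induct)
  case less
  obtain s' where s': "u y = Suc s'" using less.prems by (cases "u y") auto
  have ss': "s \<le> s'" using less.prems s' by simp
  have "tally u y {Suc s'} \<le> tally u y {s'}" using bal x ss' unfolding ballot_def by simp
  then have le: "occurrence u x \<le> tally u y {s'}" using less.prems s' by (simp add: occurrence_def)
  obtain z where z: "z \<le> y" "u z = s'" "occurrence u z = occurrence u x"
    by (rule occurrence_exists[OF occurrence_pos le])
  have zy: "z < y" using z s' by (cases "z = y") auto
  show ?case
  proof (cases "s = s'")
    case True
    have "u z = u x" unfolding z(2) x(1) True ..
    then have "z = x" using z(3) by (rule occurrence_inj)
    then show ?thesis using zy s' True by simp
  next
    case False
    then have "x < z \<and> x + u z \<le> z + s" using less.hyps[of z] z s' ss' by simp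
    then show ?thesis using zy z s' by simp
  qed
qed

text \<open>The chain of the box begins with an entry 1 in a row at least 1. Hence the exponents
  \<open>x - u x\<close> used below are not truncated.\<close>

lemma entry_le_row:
  assumes bal: "ballot u" and u0: "u 0 = 0" and x: "1 \<le> u x"
  shows "u x \<le> x"
proof (cases "u x = 1")
  case True
  then show ?thesis using u0 by (cases x) auto
next
  case False
  have le: "occurrence u x \<le> tally u x {1}"
    using ballot_antimono[OF bal, of 1 "u x" x] x by (simp add: occurrence_def)
  obtain z where z: "u z = 1" "occurrence u z = occurrence u x"
    by (rule occurrence_exists[OF occurrence_pos le])
  have "1 \<le> z" using z u0 by (cases z) auto
  moreover have "z + u x \<le> x + 1" using chain_increasing[OF bal z(1), of x] z(2) False x by simp
  ultimately show ?thesis by simp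
qed

text \<open>If an entry e occurs at least c times, then column c of \<alpha> has length at least e.
  Thus the generator of the chain exists, and its order is large enough for a well-defined
  map.\<close>

lemma occurrence_bound:
  assumes \<alpha>: "is_partition \<alpha>" and corner: "corner_word \<beta> u" and content: "has_content \<alpha> u" and x: "1 \<le> u x"
  shows "occurrence u x - 1 < length \<alpha> \<and> u x \<le> \<alpha> ! (occurrence u x - 1)"
proof -
  obtain M where M: "\<And>y. M < y \<Longrightarrow> u y = 0" using corner_word_finite[OF corner] by blast
  have "{y. u y = u x} \<subseteq> {..M}"
  proof
    fix y assume "y \<in> {y. u y = u x}"
    then show "y \<in> {..M}" using M[of y] x by (cases "M < y") auto
  qed
  then have "finite {y. u y = u x}" by (rule finite_subset) simp
  then have "occurrence u x \<le> card {y. u y = u x}"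
    unfolding occurrence_def tally_def by (intro card_mono) auto
  then have "occurrence u x - 1 < conj_part \<alpha> (u x)"
    using content x occurrence_pos[of u x] unfolding has_content_def by simp
  then show ?thesis using le_nth_iff_less_conj_part[OF \<alpha> x] by blast
qed

text \<open>This verifies \<open>box_witness\<close> for p^(s-1) times the chain through x. Members
  with a smaller entry are killed because s - 1 \<ge> \<open>u y\<close>; members with a larger
  entry lie in longer columns and, by \<open>chain_increasing\<close>, keep a factor
  p^(x-1).\<close>

lemma chain_term:
  assumes bal: "ballot u" and u0: "u 0 = 0" and x: "u x = s" "1 \<le> s"
    and y: "1 \<le> u y" "y \<noteq> x" "occurrence u y = occurrence u x"
  shows "fps_X ^ y dvd (fps_X :: 'k::field fps) ^ (s - 1) * fps_X ^ (y - u y) \<or>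
    x < y \<and> fps_X ^ (x - 1) dvd (fps_X :: 'k fps) ^ (s - 1) * fps_X ^ (y - u y)"
proof -
  have le: "u y \<le> y" by (rule entry_le_row[OF bal u0 y(1)])
  have ne: "u y \<noteq> s" using occurrence_inj[of u y x] y x by auto
  show ?thesis
  proof (cases "u y < s")
    case True
    then have "y \<le> s - 1 + (y - u y)" using le by simp
    then show ?thesis unfolding power_add[symmetric] by (intro disjI1 le_imp_power_dvd)
  next
    case False
    then have "x < y \<and> x + u y \<le> y + s" using chain_increasing[OF bal x, of y] ne y by simp
    then have "x < y" "x - 1 \<le> s - 1 + (y - u y)" using le x by auto
    then show ?thesis unfolding power_add[symmetric] by (intro disjI2 conjI le_imp_power_dvd)
  qed
qed

lemma sum_unit_coeff:
  "k \<ge> 1 \<Longrightarrow> k - 1 < n \<Longrightarrow> (\<Sum>c<n. (if Suc c = k then r else 0) * f c) = r * (f (k - 1) :: 'k::field fps)"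
proof -
  assume k: "k \<ge> 1" "k - 1 < n"
  have "(\<Sum>c<n. (if Suc c = k then r else 0) * f c) = (\<Sum>c<n. if c = k - 1 then r * f c else 0)"
    using k by (intro sum.cong) auto
  then show ?thesis using k by simp
qed

text \<open>The \<open>c\<close>-th generator of \<open>A\<close> is sent to the sum of the basis vectors belonging to the
  \<open>(c+1)\<close>-st occurrences of the entries \<open>1, 2, \<dots>\<close> of the word \<open>v\<close>. For \<open>t \<noteq> 0\<close> the additional
  term makes the two generators through the boxes \<open>p\<close> and \<open>j\<close> interchange their tails.\<close>

definition exchange_matrix :: "nat \<Rightarrow> nat \<Rightarrow> (nat \<Rightarrow> nat) \<Rightarrow> 'k::field \<Rightarrow> nat \<Rightarrow> nat \<Rightarrow> 'k fps" where
  "exchange_matrix p j v t c x = (if occurrence v x = Suc c then fps_X ^ (x - v x) else 0) +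
    (if x = p \<and> Suc c = occurrence v j then fps_const t * fps_X ^ (p - v j) else 0)"

text \<open>Put d = \<open>w p\<close> and e = \<open>w j\<close>; then v has e in row p and d in
  row j, in two different chains. For t = 0 every box of v is witnessed by its own chain. For t
  \<noteq> 0 the generator of the chain through j also has the term t p^(p-d) in row p and so
  witnesses d there; clearing row p from the other generator by means of it leaves a witness of e in
  row j.\<close>

lemma word_exchange_family:
  fixes t :: "'k::field"
  assumes \<alpha>: "is_partition \<alpha>" and \<beta>: "is_partition \<beta>"
    and corner: "corner_word \<beta> w" and content: "has_content \<alpha> w"
    and balw: "ballot w" and balv: "ballot v"
    and pj: "p < j" "0 < w j" "w j < w p" and v: "v = transpose_word p j w"
    and between: "\<And>x. p < x \<Longrightarrow> x < j \<Longrightarrow> w x \<noteq> w p \<and> w x \<noteq> w j"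
  defines "g \<equiv> \<lambda>t::'k. column_matrix \<beta> v (exchange_matrix p j v t)"
  shows "compatible_matrix \<alpha> \<beta> (g t)"
    and "hom_of \<alpha> \<beta> (g 0) \<in> VV_tableau \<alpha> \<beta> (tableau_of \<beta> v 0) (tableau_of \<beta> v)"
    and "t \<noteq> 0 \<Longrightarrow> hom_of \<alpha> \<beta> (g t) \<in> VV_tableau \<alpha> \<beta> (tableau_of \<beta> w 0) (tableau_of \<beta> w)"
proof -
  let ?X = "fps_X :: 'k fps"
  have ex: "word_exchange w v" unfolding word_exchange_def using balw balv pj v between by blast
  note inv = word_exchange_invariants[OF ex corner content]
  have w0: "w 0 = 0" and v0: "v 0 = 0" using corner inv(1) by (simp_all add: corner_word_def)
  have vp: "v p = w j" and vj: "v j = w p" using pj by (auto simp: v transpose_word_def)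
  have vx: "v x = w x" if "x \<noteq> p" "x \<noteq> j" for x using that by (simp add: v transpose_word_def)
  have supp: "0 < v x \<longleftrightarrow> 0 < w x" for x using inv(3)[of x] by (cases "v x = 0") auto
  note tr = tally_transpose[OF pj(1), of w, folded v]
  have occ_same: "occurrence v x = occurrence w x" if x: "x \<noteq> p" "x \<noteq> j" for x
  proof (cases "p \<le> x \<and> x < j")
    case True
    then have "w x \<noteq> w p \<and> w x \<noteq> w j" using between[of x] x by simp
    then show ?thesis using tr[of x "{w x}"] vx[OF x] by (simp add: occurrence_def)
  next
    case False
    then show ?thesis using tr[of x "{w x}"] vx[OF x] by (cases "p \<le> x") (auto simp: occurrence_def)
  qed
  obtain j' where j': "j = Suc j'" "p \<le> j'" using pj(1) by (cases j) auto
  have cst: "tally w j' E = tally w p E" if "w p \<notin> E \<or> w j \<notin> E" "E = {w p} \<or> E = {w j}" for E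
    by (rule tally_const) (use between j' that in auto)
  have occ_j: "occurrence v p = occurrence w j"
    using tr[of p "{w j}"] cst[of "{w j}"] pj j' by (simp add: occurrence_def vp tally_Suc)
  have occ_p: "occurrence v j = occurrence w p"
  proof -
    have "tally v j {w p} = tally w j {w p}" using tr[of j "{w p}"] pj by simp
    also have "\<dots> = tally w p {w p}" using cst[of "{w p}"] pj j' by (simp add: tally_Suc)
    finally show ?thesis by (simp add: occurrence_def vj)
  qed
  \<comment> \<open>If the chains coincided, \<open>chain_increasing\<close> for w would give j < p,
    since p carries the larger entry of w.\<close>
  have occ_ne: "occurrence v p \<noteq> occurrence v j"
    using chain_increasing[OF balw refl, of j p] pj occ_j occ_p by auto
  have pd: "w p \<le> p" using entry_le_row[OF balw w0, of p] pj by simp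
  have pe: "w j \<le> p" using pd pj by simp
  have jd: "w p \<le> j" using pd pj by simp
  have bw: "occurrence w x - 1 < length \<alpha> \<and> w x \<le> \<alpha> ! (occurrence w x - 1)" if "0 < w x" for x
    using occurrence_bound[OF \<alpha> corner content, of x] that by simp
  have bv: "occurrence v x - 1 < length \<alpha> \<and> v x \<le> \<alpha> ! (occurrence v x - 1)" if "0 < v x" for x
    using occurrence_bound[OF \<alpha> inv(1,2), of x] that by simp
  have compat: "fps_X ^ x dvd fps_X ^ (\<alpha> ! c) * exchange_matrix p j v t c x" if "c < length \<alpha>" "0 < v x" for c x and t :: 'k
  proof -
    have "?X ^ x dvd ?X ^ (\<alpha> ! c) * (if occurrence v x = Suc c then ?X ^ (x - v x) else 0)"
    proof (cases "occurrence v x = Suc c")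
      case True
      then have "v x \<le> \<alpha> ! c" using bv[OF that(2)] by simp
      then have "x \<le> \<alpha> ! c + (x - v x)" by linarith
      then show ?thesis using True by (simp add: power_add[symmetric] le_imp_power_dvd)
    qed simp
    \<comment> \<open>The extra term is bounded through w instead of v: its chain number is
      \<open>occurrence w p\<close>, so the order of the generator is at least
      \<open>w p\<close>.\<close>
    moreover have "?X ^ x dvd ?X ^ (\<alpha> ! c) * (if x = p \<and> Suc c = occurrence v j then fps_const t * ?X ^ (p - v j) else 0)"
    proof (cases "x = p \<and> Suc c = occurrence v j")
      case True
      then have "occurrence w p = Suc c" using occ_p by simp
      then have "w p \<le> \<alpha> ! c" using bw[of p] pj by simp
      then have "p \<le> \<alpha> ! c + (p - w p)" by linarith
      then have "?X ^ x dvd fps_const t * (?X ^ (\<alpha> ! c) * ?X ^ (p - v j))"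
        using True vj by (simp add: power_add[symmetric] le_imp_power_dvd)
      then show ?thesis using True by (simp add: mult.left_commute)
    next
      case False
      then show ?thesis by (simp only: if_False mult_zero_right dvd_0_right)
    qed
    ultimately show ?thesis unfolding exchange_matrix_def distrib_left by (rule dvd_add)
  qed
  show "compatible_matrix \<alpha> \<beta> (g t)"
    unfolding compatible_matrix_def g_def column_matrix_def
    using compat box_entry_pos(2)[of \<beta> v] by auto
  show "hom_of \<alpha> \<beta> (g 0) \<in> VV_tableau \<alpha> \<beta> (tableau_of \<beta> v 0) (tableau_of \<beta> v)"
    unfolding g_def
  proof (rule VV_tableau_column_matrix[OF \<beta> inv(1,2) compat])
    fix x assume x: "0 < v x"
    \<comment> \<open>For t = 0 the witness is the single generator whose chain passes through
      x.\<close>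
    define k where "k = occurrence v x"
    have k: "1 \<le> k" "k - 1 < length \<alpha>" using occurrence_pos bv[OF x] by (auto simp: k_def)
    have M: "exchange_matrix p j v 0 (k - 1) x' = (if occurrence v x' = k then ?X ^ (x' - v x') else 0)" for x'
      using k by (simp add: exchange_matrix_def)
    have S: "(\<Sum>c<length \<alpha>. (if Suc c = k then 1 else 0) * exchange_matrix p j v 0 c x') =
        (if occurrence v x' = k then ?X ^ (x' - v x') else 0)" for x'
      unfolding sum_unit_coeff[OF k] M mult_1 ..
    have "?X ^ (v x - 1) * ?X ^ (x - v x) = ?X ^ (x - 1) * 1"
      using entry_le_row[OF balv v0, of x] x by (simp add: power_add[symmetric])
    then have "?X ^ (v x - 1) * (\<Sum>c<length \<alpha>. (if Suc c = k then 1 else 0) * exchange_matrix p j v 0 c x) = ?X ^ (x - 1) * 1"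
      unfolding S by (simp add: k_def)
    moreover have "?X ^ x' dvd ?X ^ (v x - 1) * (\<Sum>c<length \<alpha>. (if Suc c = k then 1 else 0) * exchange_matrix p j v 0 c x') \<or>
        x < x' \<and> ?X ^ (x - 1) dvd ?X ^ (v x - 1) * (\<Sum>c<length \<alpha>. (if Suc c = k then 1 else 0) * exchange_matrix p j v 0 c x')"
      if "0 < v x'" "x' \<noteq> x" for x'
      unfolding S using chain_term[OF balv v0 refl, of x x', where 'k='k] x that by (simp add: k_def)
    moreover have "fps_nth (1 :: 'k fps) 0 \<noteq> 0" by simp
    ultimately show "\<exists>u. box_witness v x (\<lambda>x'. ?X ^ (v x - 1) * (\<Sum>c<length \<alpha>. u c * exchange_matrix p j v 0 c x'))"
      unfolding box_witness_def by (intro exI[of _ "\<lambda>c. if Suc c = k then 1 else 0"]) blast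
  qed
  \<comment> \<open>\<open>column_matrix\<close> depends on the word only through its support, which
    v and w share; hence the same map can be compared with w.\<close>
  have gw: "g t = column_matrix \<beta> w (exchange_matrix p j v t)"
  proof -
    have "0 < box_entry \<beta> v i \<longleftrightarrow> 0 < box_entry \<beta> w i" for i
      using supp[of "\<beta> ! i"] by (cases "Suc i = conj_part \<beta> (\<beta> ! i)") (simp_all add: box_entry_def)
    then show ?thesis unfolding g_def by (intro ext) (simp only: column_matrix_def)
  qed
  show "hom_of \<alpha> \<beta> (g t) \<in> VV_tableau \<alpha> \<beta> (tableau_of \<beta> w 0) (tableau_of \<beta> w)" if t: "t \<noteq> 0"
    unfolding gw
  proof (rule VV_tableau_column_matrix[OF \<beta> corner content compat])
    show "0 < v x" if "0 < w x" for x using that supp by blast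
    let ?M = "exchange_matrix p j v t"
    fix x assume x: "0 < w x"
    define A where "A k x' = (if occurrence v x' = k then ?X ^ (x' - v x') else 0)" for k x'
    define B where "B k x' = (if x' = p \<and> k = occurrence v j then fps_const t * ?X ^ (p - w p) else 0)" for k x'
    have M: "?M (k - 1) x' = A k x' + B k x'" if "1 \<le> k" for k x'
      using that by (simp add: exchange_matrix_def A_def B_def vj)
    have S: "(\<Sum>c<length \<alpha>. (if Suc c = k then r else 0) * ?M c x') = r * (A k x' + B k x')"
      if "1 \<le> k" "k - 1 < length \<alpha>" for k r x'
      using sum_unit_coeff[OF that, of r "\<lambda>c. ?M c x'"] M[OF that(1)] by simp
    have kj: "1 \<le> occurrence v j" "occurrence v j - 1 < length \<alpha>"
      using occurrence_pos bv[of j] vj pj by auto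
    have kp: "1 \<le> occurrence v p" "occurrence v p - 1 < length \<alpha>"
      using occurrence_pos bv[of p] vp pj by auto
    have chain_d: "?X ^ x' dvd ?X ^ (w p - 1) * ?X ^ (x' - v x') \<or>
        j < x' \<and> ?X ^ (j - 1) dvd ?X ^ (w p - 1) * ?X ^ (x' - v x')"
      if "0 < w x'" "x' \<noteq> j" "occurrence v x' = occurrence v j" for x'
      using chain_term[OF balv v0 vj, of x', where 'k='k] that supp[of x'] pj by simp
    consider (p) "x = p" | (j) "x = j" | (other) "x \<noteq> p" "x \<noteq> j" by blast
    then show "\<exists>u. box_witness w x (\<lambda>x'. ?X ^ (w x - 1) * (\<Sum>c<length \<alpha>. u c * ?M c x'))"
    proof cases
      case p
      \<comment> \<open>The generator of the v-chain through j witnesses row p: its extra term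
        supplies the unit t, and its component in row j lies in a longer column and is divisible by
        p^(p-1).\<close>
      have "?X ^ (w p - 1) * ?X ^ (p - w p) = ?X ^ (p - 1)"
        using pd pj by (simp add: power_add[symmetric])
      then have "?X ^ (w x - 1) * (A (occurrence v j) x + B (occurrence v j) x) = ?X ^ (x - 1) * fps_const t"
        using occ_ne unfolding p A_def B_def by (simp add: mult.left_commute mult.commute)
      moreover have "?X ^ x' dvd ?X ^ (w x - 1) * (A (occurrence v j) x' + B (occurrence v j) x') \<or>
        x < x' \<and> ?X ^ (x - 1) dvd ?X ^ (w x - 1) * (A (occurrence v j) x' + B (occurrence v j) x')"
        if x': "0 < w x'" "x' \<noteq> x" for x'
      proof (cases "occurrence v x' = occurrence v j")
        case True
        have eq: "A (occurrence v j) x' + B (occurrence v j) x' = ?X ^ (x' - v x')"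
          using True x' p by (simp add: A_def B_def)
        have pj1: "?X ^ (p - 1) dvd ?X ^ (j - 1)" using pj by (intro le_imp_power_dvd) simp
        show ?thesis
        proof (cases "x' = j")
          case True
          have "?X ^ (w p - 1) * ?X ^ (j - w p) = ?X ^ (j - 1)"
            using jd pj by (simp add: power_add[symmetric])
          then show ?thesis unfolding eq p using pj1 pj True vj by simp
        next
          case False
          then show ?thesis unfolding eq p using chain_d[OF x'(1) False True] pj1 pj by (auto intro: dvd_trans)
        qed
      qed (use x' p in \<open>simp add: A_def B_def\<close>)
      moreover have "fps_nth (fps_const t) 0 \<noteq> 0" using t by simp
      ultimately show ?thesis
        by (intro exI[of _ "\<lambda>c. if Suc c = occurrence v j then 1 else 0"]) (unfold box_witness_def S[OF kj] mult_1, blast)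
    next
      case j
      \<comment> \<open>With d = \<open>w p\<close> and e = \<open>w j\<close>, the multiple t^-1
        p^(d-e) of the generator used for row p is subtracted from the generator of the v-chain
        through p. After multiplication by p^(e-1) row p cancels, and row j holds -t^-1
        p^(j-1).\<close>
      define \<tau> where "\<tau> = fps_const (inverse t)"
      define r where "r = - \<tau> * ?X ^ (w p - w j)"
      let ?u = "\<lambda>c. (if Suc c = occurrence v p then 1 else 0) + (if Suc c = occurrence v j then r else 0)"
      define Z where "Z x' = ?X ^ (w j - 1) * (\<Sum>c<length \<alpha>. ?u c * ?M c x')" for x'
      have rX: "?X ^ (w j - 1) * r = - \<tau> * ?X ^ (w p - 1)"
        using pj by (simp add: r_def mult.left_commute power_add[symmetric])
      have Z: "Z x' = ?X ^ (w j - 1) * (A (occurrence v p) x' + B (occurrence v p) x') -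
          \<tau> * (?X ^ (w p - 1) * (A (occurrence v j) x' + B (occurrence v j) x'))" for x'
      proof -
        have "Z x' = ?X ^ (w j - 1) * (A (occurrence v p) x' + B (occurrence v p) x') +
          (?X ^ (w j - 1) * r) * (A (occurrence v j) x' + B (occurrence v j) x')"
          unfolding Z_def distrib_right sum.distrib S[OF kj] S[OF kp] by (simp add: distrib_left mult.assoc)
        then show ?thesis unfolding rX by (simp add: algebra_simps)
      qed
      have Xj: "?X ^ (w p - 1) * ?X ^ (j - w p) = ?X ^ (j - 1)"
        using jd pj by (simp add: power_add[symmetric])
      have "Z x = ?X ^ (x - 1) * (- \<tau>)"
        unfolding Z j A_def B_def using occ_ne pj vj Xj by (simp add: mult.commute)
      moreover have "?X ^ x' dvd Z x' \<or> x < x' \<and> ?X ^ (x - 1) dvd Z x'" if x': "0 < w x'" "x' \<noteq> x" for x'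
      proof (cases "x' = p")
        case True
        have 1: "?X ^ (w j - 1) * ?X ^ (p - w j) = ?X ^ (p - 1)" "?X ^ (w p - 1) * ?X ^ (p - w p) = ?X ^ (p - 1)"
          using pe pd pj by (simp_all add: power_add[symmetric])
        have "\<tau> * fps_const t = 1" using t by (simp add: \<tau>_def)
        then have tt: "\<tau> * (?X ^ (w p - 1) * (fps_const t * ?X ^ (p - w p))) = ?X ^ (w p - 1) * ?X ^ (p - w p)"
          by (metis mult.assoc mult.left_commute mult_1)
        have "Z x' = ?X ^ (w j - 1) * ?X ^ (p - w j) - \<tau> * (?X ^ (w p - 1) * (fps_const t * ?X ^ (p - w p)))"
          unfolding Z True A_def B_def using occ_ne vp by simp
        also have "\<dots> = 0" unfolding tt 1 by simp
        finally have "Z x' = 0" .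
        then show ?thesis by simp
      next
        case False
        note xp = this
        show ?thesis
        proof (cases "occurrence v x' = occurrence v p")
          case True
          have "Z x' = ?X ^ (w j - 1) * ?X ^ (x' - w x')"
            unfolding Z A_def B_def using True occ_ne xp x' j vx by simp
          moreover have "occurrence w x' = occurrence w j" using True occ_j occ_same xp x' j by simp
          ultimately show ?thesis using chain_term[OF balw w0 refl, of j x', where 'k='k] x' j pj by simp
        next
          case F2: False
          show ?thesis
          proof (cases "occurrence v x' = occurrence v j")
            case True
            have "Z x' = - \<tau> * (?X ^ (w p - 1) * ?X ^ (x' - v x'))"
              unfolding Z A_def B_def using True F2 xp by simp
            then show ?thesis using chain_d[OF x'(1) _ True] x' j by (auto intro: dvd_mult)
          next
            case False
            then have "Z x' = 0" unfolding Z A_def B_def using F2 xp by simp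
            then show ?thesis by simp
          qed
        qed
      qed
      moreover have "fps_nth (- \<tau>) 0 \<noteq> 0" using t by (simp add: \<tau>_def)
      ultimately show ?thesis unfolding box_witness_def Z_def j by (intro exI[of _ ?u]) blast
    next
      case other
      define k where "k = occurrence v x"
      have vxw: "v x = w x" by (rule vx[OF other])
      have k: "1 \<le> k" "k - 1 < length \<alpha>" using occurrence_pos bv[of x] x vxw by (auto simp: k_def)
      have kw: "occurrence w x = k" using occ_same[OF other] by (simp add: k_def)
      have "?X ^ (w x - 1) * (A k x + B k x) = ?X ^ (x - 1) * 1"
        using entry_le_row[OF balw w0, of x] x other vxw by (simp add: A_def B_def k_def power_add[symmetric])
      moreover have "?X ^ x' dvd ?X ^ (w x - 1) * (A k x' + B k x') \<or>
        x < x' \<and> ?X ^ (x - 1) dvd ?X ^ (w x - 1) * (A k x' + B k x')"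
        if x': "0 < w x'" "x' \<noteq> x" for x'
      \<comment> \<open>Only here does the extra term appear. Row p then belongs to the w-chain of
        x, so the estimate for w applies; all other components come from the v-chain.\<close>
      proof (cases "x' = p \<and> k = occurrence v j")
        case True
        then have "A k x' + B k x' = fps_const t * ?X ^ (p - w p)" using occ_ne by (simp add: A_def B_def)
        then have eq: "?X ^ (w x - 1) * (A k x' + B k x') = fps_const t * (?X ^ (w x - 1) * ?X ^ (x' - w x'))"
          using True by (simp add: mult.left_commute)
        show ?thesis unfolding eq
          using chain_term[OF balw w0 refl, of x x', where 'k='k] x x' True occ_p kw by (auto intro: dvd_mult)
      next
        case False
        then have eq: "A k x' + B k x' = (if occurrence v x' = k then ?X ^ (x' - v x') else 0)"
          by (auto simp: A_def B_def)
        show ?thesis unfolding eq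
          using chain_term[OF balv v0 vxw, of x', where 'k='k] x x' supp[of x'] by (simp add: k_def)
      qed
      moreover have "fps_nth (1 :: 'k fps) 0 \<noteq> 0" by simp
      ultimately show ?thesis
        by (intro exI[of _ "\<lambda>c. if Suc c = k then 1 else 0"]) (unfold box_witness_def S[OF k] mult_1, blast)
    qed
  qed
qed

section \<open>Degeneration along a line\<close>

lemma infinite_UNIV_alg_closed_field: "infinite (UNIV :: 'k::alg_closed_field set)"
proof
  assume fin: "finite (UNIV :: 'k set)"
  define q :: "'k poly" where "q = (\<Prod>a\<in>UNIV. [:- a, 1:])"
  have "degree q = (\<Sum>a\<in>(UNIV :: 'k set). degree [:- a, 1:])"
    unfolding q_def by (rule degree_prod_sum_eq) simp
  then have deg: "degree (1 :: 'k poly) < degree q"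
    using fin by (simp add: finite_UNIV_card_ge_0)
  then have "degree (q + 1) > 0" by (simp add: degree_add_eq_left)
  then obtain z where z: "poly (q + 1) z = 0" using alg_closed_imp_poly_has_root by blast
  have "poly q z = 0" unfolding q_def poly_prod using fin by (intro prod_zero) auto
  then show False using z by simp
qed

lemma Hom_Lambda_subset_Hom_k: "Hom_Lambda V W \<subseteq> Hom_k V W"
  unfolding Hom_Lambda_def Hom_k_def linear_maps_def by auto

lemma poly_functions_on_line:
  fixes g0 g1 :: "nat \<Rightarrow> nat \<Rightarrow> 'k::field fps"
  assumes P: "P \<in> poly_functions (N_mod \<alpha>) (N_mod \<beta>)"
    and comp: "\<And>t. compatible_matrix \<alpha> \<beta> (\<lambda>c i. g0 c i + fps_const t * g1 c i)"
  shows "\<exists>q. \<forall>t. P (hom_of \<alpha> \<beta> (\<lambda>c i. g0 c i + fps_const t * g1 c i)) = poly q t"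
  using P
proof (induction rule: poly_functions.induct)
  case (const c)
  show ?case by (rule exI[of _ "[:c:]"]) simp
next
  case (coord v \<phi>)
  obtain u where u: "v = elt \<alpha> u" using coord(1) unfolding carrier_N_mod by blast
  have "\<phi> (hom_of \<alpha> \<beta> (\<lambda>c i. g0 c i + fps_const t * g1 c i) v) =
      \<phi> (elt \<beta> (lin \<alpha> g0 u)) + t * \<phi> (elt \<beta> (lin \<alpha> g1 u))" for t
  proof -
    have "lin \<alpha> (\<lambda>c i. g0 c i + fps_const t * g1 c i) u = (\<lambda>i. lin \<alpha> g0 u i + fps_const t * lin \<alpha> g1 u i)"
      by (intro ext) (simp add: lin_def algebra_simps sum.distrib sum_distrib_left)
    then have "hom_of \<alpha> \<beta> (\<lambda>c i. g0 c i + fps_const t * g1 c i) v =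
        elt \<beta> (lin \<alpha> g0 u) \<oplus>\<^bsub>N_mod \<beta>\<^esub> fps_const t \<odot>\<^bsub>N_mod \<beta>\<^esub> elt \<beta> (lin \<alpha> g1 u)"
      unfolding u hom_of_elt[OF comp] by (simp add: elt_add elt_smult)
    moreover have "fps_const t \<odot>\<^bsub>N_mod \<beta>\<^esub> elt \<beta> (lin \<alpha> g1 u) \<in> carrier (N_mod \<beta>)"
      by (simp add: elt_smult)
    ultimately show ?thesis using coord(2) unfolding k_dual_def by simp
  qed
  then show ?case
    by (intro exI[of _ "[:\<phi> (elt \<beta> (lin \<alpha> g0 u)), \<phi> (elt \<beta> (lin \<alpha> g1 u)):]"]) simp
next
  case (add P Q)
  then obtain a b where "\<forall>t. P (hom_of \<alpha> \<beta> (\<lambda>c i. g0 c i + fps_const t * g1 c i)) = poly a t"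
    "\<forall>t. Q (hom_of \<alpha> \<beta> (\<lambda>c i. g0 c i + fps_const t * g1 c i)) = poly b t" by blast
  then show ?case by (intro exI[of _ "a + b"]) simp
next
  case (mult P Q)
  then obtain a b where "\<forall>t. P (hom_of \<alpha> \<beta> (\<lambda>c i. g0 c i + fps_const t * g1 c i)) = poly a t"
    "\<forall>t. Q (hom_of \<alpha> \<beta> (\<lambda>c i. g0 c i + fps_const t * g1 c i)) = poly b t" by blast
  then show ?case by (intro exI[of _ "a * b"]) simp
qed

text \<open>Along the line a polynomial function is a polynomial in t. If it does not vanish at t =
  0 it has finitely many roots, so over an infinite field it is nonzero at some t \<noteq>
  0.\<close>

lemma line_in_closure:
  fixes g0 g1 :: "nat \<Rightarrow> nat \<Rightarrow> 'k::alg_closed_field fps"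
  assumes comp: "\<And>t. compatible_matrix \<alpha> \<beta> (\<lambda>c i. g0 c i + fps_const t * g1 c i)"
    and S: "\<And>t. t \<noteq> 0 \<Longrightarrow> hom_of \<alpha> \<beta> (\<lambda>c i. g0 c i + fps_const t * g1 c i) \<in> S"
  shows "hom_of \<alpha> \<beta> g0 \<in> Abstract_Topology.closure_of (zariski (N_mod \<alpha>) (N_mod \<beta>)) S"
proof -
  let ?f = "\<lambda>t. hom_of \<alpha> \<beta> (\<lambda>c i. g0 c i + fps_const t * g1 c i)"
  have f0: "?f 0 = hom_of \<alpha> \<beta> g0" by simp
  have Hom: "?f t \<in> Hom_k (N_mod \<alpha>) (N_mod \<beta>)" for t
    using hom_of_in_Hom_Lambda[OF comp] Hom_Lambda_subset_Hom_k by blast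
  have "\<exists>y. y \<in> S \<and> y \<in> U" if U: "?f 0 \<in> U" "openin (zariski (N_mod \<alpha>) (N_mod \<beta>)) U" for U
  proof -
    obtain T where T: "T \<subseteq> poly_functions (N_mod \<alpha>) (N_mod \<beta>)"
      "U = Hom_k (N_mod \<alpha>) (N_mod \<beta>) - {f. \<forall>P\<in>T. P f = 0}"
      using U(2) unfolding openin_zariski zariski_open_def by blast
    obtain P where P: "P \<in> T" "P (?f 0) \<noteq> 0" using U(1) T(2) by blast
    obtain q where q: "\<And>t. P (?f t) = poly q t"
      using poly_functions_on_line[OF _ comp] P(1) T(1) by blast
    have "q \<noteq> 0" using P(2) q[of 0] by auto
    then have "finite (insert 0 {t. poly q t = 0})" by (simp add: poly_roots_finite)
    then obtain t where "t \<notin> insert 0 {t. poly q t = 0}"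
      using ex_new_if_finite[OF infinite_UNIV_alg_closed_field] by blast
    then have "t \<noteq> 0" "P (?f t) \<noteq> 0" using q by auto
    then show ?thesis using S[of t] Hom[of t] P(1) T(2) by blast
  qed
  then show ?thesis using Hom[of 0] unfolding f0 in_closure_of topspace_zariski by blast
qed

lemma tableau_exchange_boundary_step:
  assumes \<alpha>: "is_partition \<alpha>" and \<beta>: "is_partition \<beta>" and "tableau_exchange \<alpha> \<beta> \<gamma> \<Gamma> \<Gamma>'"
  shows "boundary_step TYPE('k::alg_closed_field) \<alpha> \<beta> \<gamma> \<Gamma> \<Gamma>'"
proof -
  obtain w v where ex: "word_exchange w v" and corner: "corner_word \<beta> w" and content: "has_content \<alpha> w"
    and \<Gamma>: "\<Gamma> = tableau_of \<beta> w" and \<Gamma>': "\<Gamma>' = tableau_of \<beta> v"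
    and LR: "LR_tableau \<alpha> \<beta> \<gamma> \<Gamma>" "LR_tableau \<alpha> \<beta> \<gamma> \<Gamma>'"
    using assms(3) unfolding tableau_exchange_def by blast
  obtain p j where bal: "ballot w" "ballot v" and pj: "p < j" "0 < w j" "w j < w p"
    and v: "v = transpose_word p j w"
    and all_between: "\<forall>x. p < x \<longrightarrow> x < j \<longrightarrow> w x \<noteq> w p \<and> w x \<noteq> w j"
    using ex unfolding word_exchange_def by blast
  have between: "w x \<noteq> w p \<and> w x \<noteq> w j" if "p < x" "x < j" for x
    using all_between that by blast
  have \<gamma>: "tableau_of \<beta> w 0 = \<gamma>" "tableau_of \<beta> v 0 = \<gamma>"
    using LR unfolding LR_tableau_def \<Gamma> \<Gamma>' by auto
  define g0 where "g0 = column_matrix \<beta> v (exchange_matrix p j v (0::'k))"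
  define g1 where "g1 = column_matrix \<beta> v (\<lambda>c x. if x = p \<and> Suc c = occurrence v j then (fps_X :: 'k fps) ^ (p - v j) else 0)"
  have line: "column_matrix \<beta> v (exchange_matrix p j v t) = (\<lambda>c i. g0 c i + fps_const t * g1 c i)" for t :: 'k
    by (intro ext) (simp add: g0_def g1_def column_matrix_def exchange_matrix_def)
  note family = word_exchange_family[OF \<alpha> \<beta> corner content bal pj v between, where 'k='k]
  have "hom_of \<alpha> \<beta> g0 \<in> VV_tableau \<alpha> \<beta> \<gamma> \<Gamma>'"
    using family(2) unfolding g0_def \<Gamma>' \<gamma> by blast
  moreover have "hom_of \<alpha> \<beta> g0 \<in> Abstract_Topology.closure_of (zariski (N_mod \<alpha>) (N_mod \<beta>)) (VV_tableau \<alpha> \<beta> \<gamma> \<Gamma>)"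
  proof (rule line_in_closure)
    show "compatible_matrix \<alpha> \<beta> (\<lambda>c i. g0 c i + fps_const t * g1 c i)" for t :: 'k
      using family(1)[of t] unfolding line by blast
    show "hom_of \<alpha> \<beta> (\<lambda>c i. g0 c i + fps_const t * g1 c i) \<in> VV_tableau \<alpha> \<beta> \<gamma> \<Gamma>" if "t \<noteq> 0" for t :: 'k
      using family(3)[of t] that unfolding line \<Gamma> \<gamma> by blast
  qed
  ultimately show ?thesis unfolding boundary_step_def using LR by blast
qed

section \<open>Semicontinuity\<close>

text \<open>Representatives of y agree in component i only modulo p to the power
  \<open>\<beta> ! i\<close>, so the value is independent of the choice exactly for the indices in
  \<open>list_index_set \<beta>\<close>.\<close>

definition coordinate :: "nat list \<Rightarrow> nat \<times> nat \<Rightarrow> (nat \<Rightarrow> 'k::field fps set) \<Rightarrow> 'k" where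
  "coordinate \<beta> im y = fps_nth ((SOME u. y = elt \<beta> u) (fst im)) (snd im)"

lemma coordinate_elt:
  assumes "im \<in> list_index_set \<beta>"
  shows "coordinate \<beta> im (elt \<beta> u) = fps_nth (u (fst im)) (snd im)"
proof -
  define v where "v = (SOME v. elt \<beta> u = elt \<beta> v)"
  have "elt \<beta> u = elt \<beta> v" unfolding v_def by (rule someI[of "\<lambda>v. elt \<beta> u = elt \<beta> v"]) simp
  then have "cong_mod \<beta> (\<lambda>i. u i - v i) (\<lambda>_. 0)" unfolding elt_eq_iff cong_mod_diff .
  then have "fps_nth (u (fst im) - v (fst im)) (snd im) = 0"
    using assms unfolding cong_mod_zero_iff by (auto simp: list_index_set_def)
  then show ?thesis by (simp add: coordinate_def v_def)
qed

lemma coordinate_smult_in_k_dual: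
  assumes "im \<in> list_index_set \<beta>"
  shows "(\<lambda>y. coordinate \<beta> im (fps_X ^ l \<odot>\<^bsub>N_mod \<beta>\<^esub> y)) \<in> k_dual (N_mod \<beta>)"
  unfolding k_dual_def
proof (intro CollectI conjI ballI allI)
  fix x y assume "x \<in> carrier (N_mod \<beta> :: ('a fps, nat \<Rightarrow> 'a fps set) module)"
    "y \<in> carrier (N_mod \<beta> :: ('a fps, nat \<Rightarrow> 'a fps set) module)"
  then obtain u v where "x = elt \<beta> u" "y = elt \<beta> v" unfolding carrier_N_mod by blast
  then show "coordinate \<beta> im (fps_X ^ l \<odot>\<^bsub>N_mod \<beta>\<^esub> (x \<oplus>\<^bsub>N_mod \<beta>\<^esub> y)) =
      coordinate \<beta> im (fps_X ^ l \<odot>\<^bsub>N_mod \<beta>\<^esub> x) + coordinate \<beta> im (fps_X ^ l \<odot>\<^bsub>N_mod \<beta>\<^esub> y)"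
    by (simp add: elt_add elt_smult coordinate_elt[OF assms] distrib_left)
next
  fix c :: 'a and x assume "x \<in> carrier (N_mod \<beta> :: ('a fps, nat \<Rightarrow> 'a fps set) module)"
  then obtain u where "x = elt \<beta> u" unfolding carrier_N_mod by blast
  then show "coordinate \<beta> im (fps_X ^ l \<odot>\<^bsub>N_mod \<beta>\<^esub> (fps_const c \<odot>\<^bsub>N_mod \<beta>\<^esub> x)) =
      c * coordinate \<beta> im (fps_X ^ l \<odot>\<^bsub>N_mod \<beta>\<^esub> x)"
    by (simp add: elt_smult coordinate_elt[OF assms] mult.left_commute[of "fps_X ^ l"])
qed

lemma sum_list_map_min: "sum_list (map (\<lambda>h. min h m) \<nu>) = (\<Sum>x=1..m. conj_part \<nu> x)"
  by (rule sum_conj_part_eq[symmetric])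

lemma cong_mod_iff_nth:
  "cong_mod \<beta> u v \<longleftrightarrow> (\<forall>im\<in>list_index_set \<beta>. fps_nth (u (fst im)) (snd im) = fps_nth (v (fst im)) (snd im))"
  unfolding cong_mod_diff[of \<beta> u v, symmetric] cong_mod_zero_iff by (auto simp: list_index_set_def)

lemma VV_tableau_quotient_basis:
  fixes f :: "(nat \<Rightarrow> 'k::field fps set) \<Rightarrow> nat \<Rightarrow> 'k fps set"
  assumes "f \<in> VV_tableau \<alpha> \<beta> \<gamma> \<Gamma>"
  obtains g h where "compatible_matrix \<alpha> \<beta> g" "f = hom_of \<alpha> \<beta> g"
    "quotient_basis (\<Gamma> l) (power_image_lattice \<alpha> \<beta> g l) h"
proof -
  have "f \<in> Hom_Lambda (N_mod \<alpha>) (N_mod \<beta>)" using assms unfolding VV_tableau_def VV_def by blast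
  then obtain g where g: "compatible_matrix \<alpha> \<beta> g" "f = hom_of \<alpha> \<beta> g" by (rule Hom_Lambda_hom_of)
  have "has_type (quotient_module (N_mod \<beta>) (p_power_image (N_mod \<beta>) l (f ` carrier (N_mod \<alpha>)))) (\<Gamma> l)"
    using assms unfolding VV_tableau_def embedding_has_tableau_def by blast
  then obtain h where "quotient_basis (\<Gamma> l) (power_image_lattice \<alpha> \<beta> g l) h"
    unfolding g(2) p_power_image_hom_of[OF g(1)] has_type_quotient_iff[OF lattice_mod_power_image] by blast
  then show ?thesis using that g by blast
qed

text \<open>The dimension of \<open>p\<^sup>l A + p\<^sup>m B\<close> is lower semicontinuous. A spanning family
  of \<open>B\<close> consisting of elements of \<open>p\<^sup>l A + p\<^sup>m B\<close> and of lifts of basis vectors of the quotient at the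
  special point remains spanning nearby.\<close>

lemma closure_sum_conj_part_le:
  fixes f0 :: "(nat \<Rightarrow> 'k::field fps set) \<Rightarrow> nat \<Rightarrow> 'k fps set"
  assumes f0: "f0 \<in> VV_tableau \<alpha> \<beta> \<gamma> \<Gamma>'"
    and cl: "f0 \<in> Abstract_Topology.closure_of (zariski (N_mod \<alpha>) (N_mod \<beta>)) (VV_tableau \<alpha> \<beta> \<gamma> \<Gamma>)"
  shows "(\<Sum>i=1..m. conj_part (\<Gamma> l) i) \<le> (\<Sum>i=1..m. conj_part (\<Gamma>' l) i)"
proof -
  define \<mu> where "\<mu> = \<Gamma>' l"
  obtain g0 h0 where g0: "compatible_matrix \<alpha> \<beta> g0" "f0 = hom_of \<alpha> \<beta> g0"
    and h0: "quotient_basis \<mu> (power_image_lattice \<alpha> \<beta> g0 l) h0"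
    using VV_tableau_quotient_basis[OF f0, of l] unfolding \<mu>_def by blast
  \<comment> \<open>The vectors p^n h0_j with n < min(\<mu>_j, m) represent a basis of B/(p^l A +
    p^m B) at f0, and their number is the right-hand side. J adjoins all elements of p^l A and p^m
    B; only those of p^l A depend on f.\<close>
  define E where "E = list_index_set (map (\<lambda>h. min h m) \<mu>)"
  define J :: "(nat \<times> nat + (nat \<Rightarrow> 'k fps set) + (nat \<Rightarrow> 'k fps)) set"
    where "J = E <+> (carrier (N_mod \<alpha>) <+> UNIV)"
  define z where "z k f im = (case k of
      Inl (j, n) \<Rightarrow> fps_nth (fps_X ^ n * h0 j (fst im)) (snd im)
    | Inr (Inl x) \<Rightarrow> coordinate \<beta> im (fps_X ^ l \<odot>\<^bsub>N_mod \<beta>\<^esub> f x)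
    | Inr (Inr b) \<Rightarrow> fps_nth (fps_X ^ m * b (fst im)) (snd im))"
    for k :: "nat \<times> nat + (nat \<Rightarrow> 'k fps set) + (nat \<Rightarrow> 'k fps)"
      and f :: "(nat \<Rightarrow> 'k fps set) \<Rightarrow> nat \<Rightarrow> 'k fps set" and im
  have span0: "\<exists>F c. finite F \<and> F \<subseteq> J \<and> (\<forall>im\<in>list_index_set \<beta>. u im = (\<Sum>k\<in>F. c k * z k f0 im))"
    for u :: "nat \<times> nat \<Rightarrow> 'k"
  proof -
    let ?K = "power_image_lattice \<alpha> \<beta> g0 l"
    have K: "lattice_mod \<beta> ?K" by (rule lattice_mod_power_image)
    define v where "v i = Abs_fps (\<lambda>n. u (i, n))" for i
    obtain r where r: "(\<lambda>i. v i - lin \<mu> h0 r i) \<in> ?K" using h0 unfolding quotient_basis_def by blast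
    \<comment> \<open>The rest r_j - s_j is divisible by p^min(\<mu>_j, m). For \<mu>_j \<le> m it
      contributes to p^l A, because p^(\<mu>_j) h0_j lies there; for larger \<mu>_j it contributes
      to p^m B and is collected in b.\<close>
    define s where "s j = fps_cutoff (min (\<mu> ! j) m) (r j)" for j
    have "\<forall>j. \<exists>q. r j - s j = fps_X ^ min (\<mu> ! j) m * q"
      using dvd_fps_X_power_diff_cutoff unfolding s_def dvd_def by blast
    from choice[OF this] obtain q where q: "\<And>j. r j - s j = fps_X ^ min (\<mu> ! j) m * q j" by blast
    define b where "b i = (\<Sum>j<length \<mu>. if m < \<mu> ! j then q j * h0 j i else 0)" for i
    have "(\<lambda>i. \<Sum>j\<in>{..<length \<mu>}. if m < \<mu> ! j then 0 else q j * (fps_X ^ (\<mu> ! j) * h0 j i)) \<in> ?K"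
    proof (rule lattice_mod_sum[OF K])
      fix j assume j: "j \<in> {..<length \<mu>}"
      have "(\<lambda>i. fps_X ^ (\<mu> ! j) * h0 j i) \<in> ?K" using h0 j unfolding quotient_basis_def by blast
      then have "(\<lambda>i. q j * (fps_X ^ (\<mu> ! j) * h0 j i)) \<in> ?K" by (rule lattice_mod_smult[OF K])
      then show "(\<lambda>i. if m < \<mu> ! j then 0 else q j * (fps_X ^ (\<mu> ! j) * h0 j i)) \<in> ?K"
        using lattice_mod_0[OF K] by (cases "m < \<mu> ! j") simp_all
    qed simp
    moreover have "(\<Sum>j\<in>{..<length \<mu>}. if m < \<mu> ! j then 0 else q j * (fps_X ^ (\<mu> ! j) * h0 j i)) =
        lin \<mu> h0 r i - lin \<mu> h0 s i - fps_X ^ m * b i" for i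
      unfolding lin_diff[symmetric] q
      by (simp add: lin_def b_def sum_distrib_left sum_subtractf[symmetric])
        (intro sum.cong, auto simp: min_def mult_ac)
    ultimately have "(\<lambda>i. lin \<mu> h0 r i - lin \<mu> h0 s i - fps_X ^ m * b i) \<in> ?K" by simp
    then have "(\<lambda>i. (v i - lin \<mu> h0 r i) + (lin \<mu> h0 r i - lin \<mu> h0 s i - fps_X ^ m * b i)) \<in> ?K"
      by (rule lattice_mod_add[OF K r])
    moreover have "(\<lambda>i. (v i - lin \<mu> h0 r i) + (lin \<mu> h0 r i - lin \<mu> h0 s i - fps_X ^ m * b i)) =
        (\<lambda>i. v i - lin \<mu> h0 s i - fps_X ^ m * b i)"
      by (intro ext) (simp add: algebra_simps)
    ultimately have "(\<lambda>i. v i - lin \<mu> h0 s i - fps_X ^ m * b i) \<in> ?K" by (simp only:)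
    then obtain a where a: "cong_mod \<beta> (\<lambda>i. v i - lin \<mu> h0 s i - fps_X ^ m * b i) (\<lambda>i. fps_X ^ l * lin \<alpha> g0 a i)"
      unfolding power_image_lattice_def by blast
    define F where "F = E <+> {Inl (elt \<alpha> a), Inr b}"
    define c where "c k = (case k of Inl (j, n) \<Rightarrow> fps_nth (s j) n | Inr _ \<Rightarrow> 1)"
      for k :: "nat \<times> nat + (nat \<Rightarrow> 'k fps set) + (nat \<Rightarrow> 'k fps)"
    have finE: "finite E" by (simp add: E_def)
    have "u im = (\<Sum>k\<in>F. c k * z k f0 im)" if im: "im \<in> list_index_set \<beta>" for im
    proof -
      have lin_len: "lin \<mu> h0 s i = lin (map (\<lambda>h. min h m) \<mu>) h0 s i" for i by (simp add: lin_def)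
      have "fps_nth (lin \<mu> h0 s (fst im)) (snd im) =
          (\<Sum>(j, n)\<in>E. fps_nth (s j) n * fps_nth (fps_X ^ n * h0 j (fst im)) (snd im))"
        unfolding lin_len E_def by (rule lin_nth_sum) (auto simp: s_def min_le_iff_disj)
      moreover have "z (Inr (Inl (elt \<alpha> a))) f0 im = fps_nth (fps_X ^ l * lin \<alpha> g0 a (fst im)) (snd im)"
        by (simp add: z_def g0(2) hom_of_elt[OF g0(1)] elt_smult coordinate_elt[OF im])
      moreover have "fps_nth (v (fst im) - lin \<mu> h0 s (fst im) - fps_X ^ m * b (fst im)) (snd im) =
          fps_nth (fps_X ^ l * lin \<alpha> g0 a (fst im)) (snd im)"
        using a im unfolding cong_mod_iff_nth by blast
      moreover have "z (Inr (Inr b)) f0 im = fps_nth (fps_X ^ m * b (fst im)) (snd im)" by (simp add: z_def)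
      moreover have "(\<Sum>k\<in>F. c k * z k f0 im) =
          (\<Sum>(j, n)\<in>E. fps_nth (s j) n * fps_nth (fps_X ^ n * h0 j (fst im)) (snd im)) +
          (z (Inr (Inl (elt \<alpha> a))) f0 im + z (Inr (Inr b)) f0 im)"
        unfolding F_def using finE by (simp add: sum.Plus c_def z_def case_prod_unfold)
      moreover have "fps_nth (v (fst im)) (snd im) = u im" by (simp add: v_def)
      ultimately show ?thesis by (simp add: algebra_simps)
    qed
    moreover have "F \<subseteq> J" by (auto simp: F_def J_def)
    moreover have "finite F" using finE by (simp add: F_def)
    ultimately show ?thesis by blast
  qed
  have "\<exists>C\<subseteq>J. finite C \<and> card C = card (list_index_set \<beta>) \<and>
    (\<exists>P\<in>poly_functions (N_mod \<alpha>) (N_mod \<beta>). P f0 \<noteq> 0 \<and>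
      (\<forall>f. P f \<noteq> 0 \<longrightarrow> (\<forall>u. \<exists>c. \<forall>im\<in>list_index_set \<beta>. u im = (\<Sum>k\<in>C. c k * z k f im))))"
  proof (rule spanning_selection[where A = "poly_functions (N_mod \<alpha>) (N_mod \<beta>)"])
    show "\<exists>F c. finite F \<and> F \<subseteq> J \<and> (\<forall>im\<in>list_index_set \<beta>. u im = (\<Sum>k\<in>F. c k * z k f0 im))"
      for u :: "nat \<times> nat \<Rightarrow> 'k" by (rule span0)
  next
    fix k im assume k: "k \<in> J" and im: "im \<in> list_index_set \<beta>"
    from k consider (e) j n where "k = Inl (j, n)" | (x) x where "k = Inr (Inl x)" "x \<in> carrier (N_mod \<alpha>)"
      | (b) b where "k = Inr (Inr b)"
      by (auto simp: J_def)
    then show "(\<lambda>f. z k f im) \<in> poly_functions (N_mod \<alpha>) (N_mod \<beta>)"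
    proof cases
      case x
      show ?thesis unfolding z_def x
        using poly_functions.coord[OF x(2) coordinate_smult_in_k_dual[OF im]] by simp
    qed (auto simp: z_def intro: poly_functions.const)
  qed (auto intro: poly_functions.intros)
  then obtain C P where C: "C \<subseteq> J" "finite C" and P: "P \<in> poly_functions (N_mod \<alpha>) (N_mod \<beta>)" "P f0 \<noteq> 0"
    and spanC: "\<And>f u. P f \<noteq> 0 \<Longrightarrow> \<exists>c. \<forall>im\<in>list_index_set \<beta>. u im = (\<Sum>k\<in>C. c k * z k f im)" by blast
  define U where "U = Hom_k (N_mod \<alpha>) (N_mod \<beta>) - {f. \<forall>Q\<in>{P}. Q f = 0}"
  have clU: "\<And>T. f0 \<in> T \<Longrightarrow> openin (zariski (N_mod \<alpha>) (N_mod \<beta>)) T \<Longrightarrow> \<exists>f. f \<in> VV_tableau \<alpha> \<beta> \<gamma> \<Gamma> \<and> f \<in> T"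
    using cl unfolding in_closure_of by blast
  have openU: "openin (zariski (N_mod \<alpha>) (N_mod \<beta>)) U"
    unfolding openin_zariski zariski_open_def U_def using P(1) by blast
  have "f0 \<in> Hom_k (N_mod \<alpha>) (N_mod \<beta>)" using cl unfolding in_closure_of topspace_zariski by (rule conjunct1)
  then have "f0 \<in> U" using P(2) unfolding U_def by simp
  then obtain f where f: "f \<in> VV_tableau \<alpha> \<beta> \<gamma> \<Gamma>" "f \<in> U" using clU[OF _ openU] by blast
  have Pf: "P f \<noteq> 0" using f(2) unfolding U_def by simp
  define \<nu> where "\<nu> = \<Gamma> l"
  obtain g h where g: "compatible_matrix \<alpha> \<beta> g" "f = hom_of \<alpha> \<beta> g"
    and h: "quotient_basis \<nu> (power_image_lattice \<alpha> \<beta> g l) h"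
    using VV_tableau_quotient_basis[OF f(1), of l] unfolding \<nu>_def by blast
  let ?K = "power_image_lattice \<alpha> \<beta> g l"
  have K: "lattice_mod \<beta> ?K" by (rule lattice_mod_power_image)
  define I where "I = list_index_set (map (\<lambda>h. min h m) \<nu>)"
  \<comment> \<open>R holds the coordinates in the quotient basis at the nearby f. They are 0 for
    vectors from p^l A and divisible by p^m for those from p^m B, so both kinds vanish on I, which
    indexes a basis of B/(p^l A + p^m B) at f.\<close>
  have reps: "\<exists>Z R. (\<forall>im\<in>list_index_set \<beta>. z k f im = fps_nth (Z (fst im)) (snd im)) \<and>
      (\<lambda>i. Z i - lin \<nu> h R i) \<in> ?K \<and> (k \<notin> range Inl \<longrightarrow> (\<forall>jn\<in>I. fps_nth (R (fst jn)) (snd jn) = 0))"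
    if "k \<in> C" for k
  proof -
    have spanK: "\<exists>R. (\<lambda>i. Z i - lin \<nu> h R i) \<in> ?K" for Z using h unfolding quotient_basis_def by blast
    from that C(1) consider (e) j n where "k = Inl (j, n)" | (x) x where "k = Inr (Inl x)" "x \<in> carrier (N_mod \<alpha>)"
      | (b) b where "k = Inr (Inr b)"
      by (auto simp: J_def)
    then show ?thesis
    proof cases
      case e
      obtain R where "(\<lambda>i. fps_X ^ n * h0 j i - lin \<nu> h R i) \<in> ?K"
        using spanK[of "\<lambda>i. fps_X ^ n * h0 j i"] by blast
      then show ?thesis
        by (intro exI[of _ "\<lambda>i. fps_X ^ n * h0 j i"] exI[of _ R]) (simp add: e z_def)
    next
      case x
      obtain a where a: "x = elt \<alpha> a" using x(2) unfolding carrier_N_mod by blast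
      have "(\<lambda>i. fps_X ^ l * lin \<alpha> g a i) \<in> ?K"
        unfolding power_image_lattice_def by (auto intro: exI[of _ a])
      moreover have "z k f im = fps_nth (fps_X ^ l * lin \<alpha> g a (fst im)) (snd im)" if "im \<in> list_index_set \<beta>" for im
        by (simp add: z_def x a g(2) hom_of_elt[OF g(1)] elt_smult coordinate_elt[OF that])
      ultimately show ?thesis
        by (intro exI[of _ "\<lambda>i. fps_X ^ l * lin \<alpha> g a i"] exI[of _ "\<lambda>_. 0"]) (simp add: lin_zero)
    next
      case b
      obtain R where "(\<lambda>i. b i - lin \<nu> h R i) \<in> ?K" using spanK[of b] by blast
      then have "(\<lambda>i. fps_X ^ m * (b i - lin \<nu> h R i)) \<in> ?K" by (rule lattice_mod_smult[OF K])
      then have "(\<lambda>i. fps_X ^ m * b i - lin \<nu> h (\<lambda>j. fps_X ^ m * R j) i) \<in> ?K"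
        by (simp add: lin_smult right_diff_distrib)
      moreover have "fps_nth (fps_X ^ m * R (fst jn)) (snd jn) = 0" if "jn \<in> I" for jn
        using that by (auto simp: I_def list_index_set_def fps_X_power_mult_nth)
      ultimately show ?thesis
        by (intro exI[of _ "\<lambda>i. fps_X ^ m * b i"] exI[of _ "\<lambda>j. fps_X ^ m * R j"]) (simp add: b z_def)
    qed
  qed
  have "\<forall>k. \<exists>Z R. k \<in> C \<longrightarrow> (\<forall>im\<in>list_index_set \<beta>. z k f im = fps_nth (Z (fst im)) (snd im)) \<and>
      (\<lambda>i. Z i - lin \<nu> h R i) \<in> ?K \<and> (k \<notin> range Inl \<longrightarrow> (\<forall>jn\<in>I. fps_nth (R (fst jn)) (snd jn) = 0))"
    using reps by blast
  from choice[OF this] obtain Z where "\<forall>k. \<exists>R. k \<in> C \<longrightarrow> (\<forall>im\<in>list_index_set \<beta>. z k f im = fps_nth (Z k (fst im)) (snd im)) \<and>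
      (\<lambda>i. Z k i - lin \<nu> h R i) \<in> ?K \<and> (k \<notin> range Inl \<longrightarrow> (\<forall>jn\<in>I. fps_nth (R (fst jn)) (snd jn) = 0))"
    by blast
  from choice[OF this] obtain R where
    ZR: "\<And>k im. k \<in> C \<Longrightarrow> im \<in> list_index_set \<beta> \<Longrightarrow> z k f im = fps_nth (Z k (fst im)) (snd im)"
      "\<And>k. k \<in> C \<Longrightarrow> (\<lambda>i. Z k i - lin \<nu> h (R k) i) \<in> ?K"
      "\<And>k jn. k \<in> C \<Longrightarrow> k \<notin> range Inl \<Longrightarrow> jn \<in> I \<Longrightarrow> fps_nth (R k (fst jn)) (snd jn) = 0"
    by blast
  have ind: "\<And>r. lin \<nu> h r \<in> ?K \<Longrightarrow> cong_mod \<nu> r (\<lambda>_. 0)"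
    using h unfolding quotient_basis_def by blast
  \<comment> \<open>Only the selected lifts contribute to the coordinates in I. They therefore span
    these coordinates, which bounds the size of I by that of E.\<close>
  define D where "D = C \<inter> Inl ` E"
  have "\<exists>c. \<forall>jn\<in>I. u jn = (\<Sum>k\<in>D. c k * fps_nth (R k (fst jn)) (snd jn))" for u :: "nat \<times> nat \<Rightarrow> 'k"
  proof -
    define r where "r j = Abs_fps (\<lambda>n. u (j, n))" for j
    obtain c where c: "\<And>im. im \<in> list_index_set \<beta> \<Longrightarrow> fps_nth (lin \<nu> h r (fst im)) (snd im) = (\<Sum>k\<in>C. c k * z k f im)"
      using spanC[OF Pf, of "\<lambda>im. fps_nth (lin \<nu> h r (fst im)) (snd im)"] by blast
    have "cong_mod \<beta> (lin \<nu> h r) (\<lambda>i. \<Sum>k\<in>C. fps_const (c k) * Z k i)"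
      unfolding cong_mod_iff_nth using c ZR(1) by (simp add: fps_sum_nth)
    moreover have "(\<lambda>i. \<Sum>k\<in>C. fps_const (c k) * (Z k i - lin \<nu> h (R k) i)) \<in> ?K"
      by (intro lattice_mod_sum[OF K C(2)] lattice_mod_smult[OF K] ZR(2))
    moreover have "lin \<nu> h (\<lambda>j. \<Sum>k\<in>C. fps_const (c k) * R k j) i = (\<Sum>k\<in>C. fps_const (c k) * lin \<nu> h (R k) i)" for i
      using C(2) by (induction C rule: finite_induct) (simp_all add: lin_zero lin_add lin_smult)
    ultimately have "lin \<nu> h (\<lambda>j. r j - (\<Sum>k\<in>C. fps_const (c k) * R k j)) \<in> ?K"
      by (elim lattice_mod_cong[OF K])
        (simp add: cong_mod_def lin_diff right_diff_distrib sum_subtractf)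
    then have "cong_mod \<nu> (\<lambda>j. r j - (\<Sum>k\<in>C. fps_const (c k) * R k j)) (\<lambda>_. 0)" by (rule ind)
    then have "cong_mod \<nu> r (\<lambda>j. \<Sum>k\<in>C. fps_const (c k) * R k j)" unfolding cong_mod_diff .
    then have r: "fps_nth (r j) n = (\<Sum>k\<in>C. c k * fps_nth (R k j) n)" if "j < length \<nu>" "n < \<nu> ! j" for j n
      using that unfolding cong_mod_iff_nth by (auto simp: list_index_set_def fps_sum_nth)
    have "u jn = (\<Sum>k\<in>D. c k * fps_nth (R k (fst jn)) (snd jn))" if jn: "jn \<in> I" for jn
    proof -
      obtain j n where [simp]: "jn = (j, n)" by (cases jn)
      have jn': "j < length \<nu>" "n < \<nu> ! j" using jn by (auto simp: I_def list_index_set_def)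
      have "u jn = (\<Sum>k\<in>C. c k * fps_nth (R k (fst jn)) (snd jn))" using r[OF jn'] by (simp add: r_def)
      also have "\<dots> = (\<Sum>k\<in>D. c k * fps_nth (R k (fst jn)) (snd jn))"
      proof (rule sum.mono_neutral_right[OF C(2)])
        show "\<forall>k\<in>C - D. c k * fps_nth (R k (fst jn)) (snd jn) = 0"
        proof
          fix k assume k: "k \<in> C - D"
          then have "k \<notin> range Inl" using C(1) by (auto simp: D_def J_def)
          then show "c k * fps_nth (R k (fst jn)) (snd jn) = 0" using ZR(3)[OF _ _ jn] k by simp
        qed
      qed (simp add: D_def)
      finally show ?thesis .
    qed
    then show ?thesis by blast
  qed
  then have "card I \<le> card D"
    by (intro card_le_spanning_family) (simp_all add: I_def D_def C(2))
  also have "card D \<le> card E" by (rule surj_card_le[of E D Inl]) (auto simp: D_def E_def)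
  finally show ?thesis
    unfolding I_def E_def card_list_index_set sum_list_map_min \<nu>_def \<mu>_def .
qed

lemma boundary_step_dom_le:
  assumes "boundary_step TYPE('k::field) \<alpha> \<beta> \<gamma> \<Gamma> \<Gamma>'"
  shows "dom_le \<Gamma> \<Gamma>'"
proof -
  obtain f :: "(nat \<Rightarrow> 'k fps set) \<Rightarrow> nat \<Rightarrow> 'k fps set" where
    "f \<in> VV_tableau \<alpha> \<beta> \<gamma> \<Gamma>'"
    "f \<in> Abstract_Topology.closure_of (zariski (N_mod \<alpha>) (N_mod \<beta>)) (VV_tableau \<alpha> \<beta> \<gamma> \<Gamma>)"
    using assms unfolding boundary_step_def by blast
  then show ?thesis unfolding dom_le_def using closure_sum_conj_part_le by blast
qed

lemma dom_le_trans: "dom_le \<Gamma> \<Gamma>' \<Longrightarrow> dom_le \<Gamma>' \<Gamma>'' \<Longrightarrow> dom_le \<Gamma> \<Gamma>''"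
  unfolding dom_le_def using le_trans by blast

lemma dom_le_rtranclp:
  assumes "R\<^sup>*\<^sup>* \<Gamma> \<Gamma>'" "\<And>\<Gamma> \<Gamma>'. R \<Gamma> \<Gamma>' \<Longrightarrow> dom_le \<Gamma> \<Gamma>'"
  shows "dom_le \<Gamma> \<Gamma>'"
  using assms(1)
proof (induction rule: rtranclp_induct)
  case base
  show ?case by (simp add: dom_le_def)
next
  case (step y z)
  then show ?case using assms(2) dom_le_trans by blast
qed

section \<open>Equivalence of the three orders\<close>

theorem corollary1p2:
  fixes \<alpha> \<beta> \<gamma> :: "nat list" and \<Gamma> \<Gamma>' :: tableau
  assumes "is_partition \<alpha>" and "is_partition \<beta>" and "is_partition \<gamma>"
    and "horizontal_vertical_strip \<beta> \<gamma>"
    and "LR_tableau \<alpha> \<beta> \<gamma> \<Gamma>" and "LR_tableau \<alpha> \<beta> \<gamma> \<Gamma>'"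
  shows "((increasing_box_move \<alpha> \<beta> \<gamma>)\<^sup>*\<^sup>* \<Gamma> \<Gamma>' \<longleftrightarrow>
            boundary_le TYPE('k::alg_closed_field) \<alpha> \<beta> \<gamma> \<Gamma> \<Gamma>') \<and>
         (boundary_le TYPE('k::alg_closed_field) \<alpha> \<beta> \<gamma> \<Gamma> \<Gamma>' \<longleftrightarrow> dom_le \<Gamma> \<Gamma>')"
proof -
  have exchanges: "(tableau_exchange \<alpha> \<beta> \<gamma>)\<^sup>*\<^sup>* \<Gamma> \<Gamma>'" if "dom_le \<Gamma> \<Gamma>'"
    using dom_le_tableau_exchanges assms that by blast
  have "(increasing_box_move \<alpha> \<beta> \<gamma>)\<^sup>*\<^sup>* \<Gamma> \<Gamma>'" if "dom_le \<Gamma> \<Gamma>'"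
    using mono_rtranclp[of "tableau_exchange \<alpha> \<beta> \<gamma>" "increasing_box_move \<alpha> \<beta> \<gamma>"]
      tableau_exchange_increasing_box_move[OF assms(2)] exchanges[OF that] by blast
  moreover have "boundary_le TYPE('k) \<alpha> \<beta> \<gamma> \<Gamma> \<Gamma>'" if "dom_le \<Gamma> \<Gamma>'"
    unfolding boundary_le_def
    using mono_rtranclp[of "tableau_exchange \<alpha> \<beta> \<gamma>" "boundary_step TYPE('k) \<alpha> \<beta> \<gamma>"]
      tableau_exchange_boundary_step[OF assms(1,2)] exchanges[OF that] by blast
  moreover have "dom_le \<Gamma> \<Gamma>'" if "(increasing_box_move \<alpha> \<beta> \<gamma>)\<^sup>*\<^sup>* \<Gamma> \<Gamma>'"
    using that increasing_box_move_dom_le by (rule dom_le_rtranclp)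
  moreover have "dom_le \<Gamma> \<Gamma>'" if "boundary_le TYPE('k) \<alpha> \<beta> \<gamma> \<Gamma> \<Gamma>'"
    using that[unfolded boundary_le_def] boundary_step_dom_le by (rule dom_le_rtranclp)
  ultimately show ?thesis by blast
qed

end
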